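(* Let $f\colon[0,2]\to[0,+\infty]$ be a measurable function and let $\Omega$ be a non-empty bounded open subset of $\mathbb{R}^2$. Assume that the line energy $\mathcal{I}_f$ is lower semicontinuous in $BV(\Omega,\mathbb{S}^1)$ endowed with the weak topology, i.e. whenever $m_n,m\in A(\Omega)$ and $m_n\to m$ weakly in $BV$, one has $\mathcal{I}_f(m)\le\liminf_{n\to\infty}\mathcal{I}_f(m_n)$. Then $f$ is lower semicontinuous and $$\limsup_{t\to0}\frac{f(t)}{t}\;\le\;2\,\limsup_{t\to2}f(t).$$
   Context: $\mathbb{S}^1$ is the unit circle of $\mathbb{R}^2$ and $\mathcal{H}^1$ is the one-dimensional Hausdorff measure. For an open set $\Omega\subset\mathbb{R}^2$, $$A(\Omega)=\{m\in BV(\Omega,\mathbb{R}^2): |m|=1\text{ a.e. and }\nabla\cdot m=0\text{ on }\Omega\},$$ where the divergence is taken in the distributional sense. For $m\in A(\Omega)$, $J(m)$ denotes the $\mathcal{H}^1$-rectifiable jump set of the $BV$ function $m$, oriented by a unit normal $\nu_x$, and $m_\pm(x)\in\mathbb{S}^1$ denote the traces of $m$ on the two sides of $J(m)$ at $\mathcal{H}^1$-a.e. $x\in J(m)$. The line energy with jump cost $f$ is $$\mathcal{I}_f(m)=\int_{J(m)}f(|m_+-m_-|)\,d\mathcal{H}^1,\qquad m\in A(\Omega).$$ Weak convergence $m_n\to m$ in $BV$ means: $m_n\to m$ in $L^1(\Omega)$ and $(m_n)$ is bounded in $BV(\Omega)$. Conventions: $\limsup_{t\to0}f(t)/t=\lim_{\delta\to0^+}\sup\{f(t)/t: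 0<t\le\delta\}$ and $\limsup_{t\to2}f(t)=\lim_{\delta\to0^+}\sup\{f(t): 2-\delta\le t\le2\}$ (the value $t=2$ is included).
   Formalization: Lower semicontinuity of f is proved on (0,2], and at t=0 only if f(0)=0: the energy never sees f(0), so f=0 on (0,2] with f(0)=1 has a lower semicontinuous energy but is not lower semicontinuous at 0. *)

theory Defs
  imports "HOL-Analysis.Analysis"
begin

type_synonym plane = "real^2"

section \<open>Test functions\<close>

definition partial_deriv :: "2 \<Rightarrow> (plane \<Rightarrow> real) \<Rightarrow> plane \<Rightarrow> real" where
  "partial_deriv i \<phi> x = frechet_derivative \<phi> (at x) (axis i 1)"

primrec C_diff :: "nat \<Rightarrow> (plane \<Rightarrow> real) \<Rightarrow> bool" where
  "C_diff 0 \<phi> \<longleftrightarrow> continuous_on UNIV \<phi>"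
| "C_diff (Suc k) \<phi> \<longleftrightarrow>
     (\<forall>x. \<phi> differentiable at x) \<and> (\<forall>i. C_diff k (partial_deriv i \<phi>))"

definition compact_support_in :: "plane set \<Rightarrow> (plane \<Rightarrow> real) \<Rightarrow> bool" where
  "compact_support_in \<Omega> \<phi> \<longleftrightarrow>
     compact (closure {x. \<phi> x \<noteq> 0}) \<and> closure {x. \<phi> x \<noteq> 0} \<subseteq> \<Omega>"

definition test_C1 :: "plane set \<Rightarrow> (plane \<Rightarrow> real) set" where
  "test_C1 \<Omega> = {\<phi>. C_diff 1 \<phi> \<and> compact_support_in \<Omega> \<phi>}"

definition test_Cinf :: "plane set \<Rightarrow> (plane \<Rightarrow> real) set" where
  "test_Cinf \<Omega> = {\<phi>. (\<forall>k. C_diff k \<phi>) \<and> compact_support_in \<Omega> \<phi>}"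

section \<open>Vector fields of bounded variation\<close>

text \<open>
  The total variation \<open>|Dm|(\<Omega>)\<close> in its dual form.  The norm on matrices is the Euclidean
  (Frobenius) one.  The real number under \<^const>\<open>ennreal\<close> may be negative and is then truncated
  to 0; this is harmless, since the zero field is admissible.
\<close>

definition total_variation :: "plane set \<Rightarrow> (plane \<Rightarrow> plane) \<Rightarrow> ennreal" where
  "total_variation \<Omega> m =
     (SUP \<phi> \<in> {\<phi> :: plane \<Rightarrow> real^2^2.
                 (\<forall>i j. (\<lambda>x. \<phi> x $ i $ j) \<in> test_C1 \<Omega>) \<and> (\<forall>x. norm (\<phi> x) \<le> 1)}.
        ennreal (LINT x:\<Omega>|lebesgue.
          (\<Sum>i\<in>UNIV. m x $ i * (\<Sum>j\<in>UNIV. partial_deriv j (\<lambda>y. \<phi> y $ i $ j) x))))"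

definition BV :: "plane set \<Rightarrow> (plane \<Rightarrow> plane) set" where
  "BV \<Omega> = {m. m absolutely_integrable_on \<Omega> \<and> total_variation \<Omega> m < \<infinity>}"

definition BV_norm :: "plane set \<Rightarrow> (plane \<Rightarrow> plane) \<Rightarrow> ennreal" where
  "BV_norm \<Omega> m = ennreal (LINT x:\<Omega>|lebesgue. norm (m x)) + total_variation \<Omega> m"

definition BV_weakly_converges ::
    "plane set \<Rightarrow> (nat \<Rightarrow> plane \<Rightarrow> plane) \<Rightarrow> (plane \<Rightarrow> plane) \<Rightarrow> bool" where
  "BV_weakly_converges \<Omega> mn m \<longleftrightarrow>
     (\<lambda>n. LINT x:\<Omega>|lebesgue. norm (mn n x - m x)) \<longlonglongrightarrow> 0 \<and>
     (\<exists>C::real. \<forall>n. BV_norm \<Omega> (mn n) \<le> ennreal C)"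

definition divergence_free :: "plane set \<Rightarrow> (plane \<Rightarrow> plane) \<Rightarrow> bool" where
  "divergence_free \<Omega> m \<longleftrightarrow>
     (\<forall>\<phi> \<in> test_Cinf \<Omega>. (LINT x:\<Omega>|lebesgue. (\<Sum>i\<in>UNIV. m x $ i * partial_deriv i \<phi> x)) = 0)"

text \<open>Elements are functions on the whole plane; only their values on \<open>\<Omega>\<close> matter.\<close>

definition A_space :: "plane set \<Rightarrow> (plane \<Rightarrow> plane) set" where
  "A_space \<Omega> = {m \<in> BV \<Omega>. (AE x in lebesgue. x \<in> \<Omega> \<longrightarrow> norm (m x) = 1) \<and> divergence_free \<Omega> m}"

section \<open>Jump set and traces\<close>

definition half_ball :: "plane \<Rightarrow> plane \<Rightarrow> real \<Rightarrow> plane set" where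
  "half_ball x \<nu> r = {y \<in> ball x r. (y - x) \<bullet> \<nu> > 0}"

definition approx_one_sided_limit ::
    "(plane \<Rightarrow> plane) \<Rightarrow> plane \<Rightarrow> plane \<Rightarrow> plane \<Rightarrow> bool" where
  "approx_one_sided_limit m x \<nu> a \<longleftrightarrow>
     ((\<lambda>r. (LINT y:half_ball x \<nu> r|lebesgue. norm (m y - a)) / measure lebesgue (half_ball x \<nu> r))
        \<longlongrightarrow> 0) (at_right 0)"

text \<open>
  Approximate jump points in the sense of Ambrosio, Fusco and Pallara.  The triple
  \<open>(a, b, \<nu>)\<close> is unique up to replacing it by \<open>(b, a, -\<nu>)\<close>, so that the jump \<open>norm (a - b)\<close> does
  not depend on the choice of the orientation.
\<close>

definition is_jump_triple ::
    "(plane \<Rightarrow> plane) \<Rightarrow> plane \<Rightarrow> plane \<times> plane \<times> plane \<Rightarrow> bool" where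
  "is_jump_triple m x = (\<lambda>(a, b, \<nu>). a \<noteq> b \<and> norm \<nu> = 1 \<and>
     approx_one_sided_limit m x \<nu> a \<and> approx_one_sided_limit m x (- \<nu>) b)"

definition jump_set :: "plane set \<Rightarrow> (plane \<Rightarrow> plane) \<Rightarrow> plane set" where
  "jump_set \<Omega> m = {x \<in> \<Omega>. \<exists>T. is_jump_triple m x T}"

definition jump_triple :: "(plane \<Rightarrow> plane) \<Rightarrow> plane \<Rightarrow> plane \<times> plane \<times> plane" where
  "jump_triple m x = (SOME T. is_jump_triple m x T)"

definition trace_plus :: "(plane \<Rightarrow> plane) \<Rightarrow> plane \<Rightarrow> plane" where
  "trace_plus m x = fst (jump_triple m x)"

definition trace_minus :: "(plane \<Rightarrow> plane) \<Rightarrow> plane \<Rightarrow> plane" where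
  "trace_minus m x = fst (snd (jump_triple m x))"

section \<open>One-dimensional Hausdorff measure\<close>

text \<open>
  Coverings are by bounded sets because \<^const>\<open>diameter\<close> is 0 on unbounded ones.  In dimension one
  the normalising constant of the Hausdorff measure is 1.
\<close>

definition hausdorff1_pre :: "real \<Rightarrow> plane set \<Rightarrow> ennreal" where
  "hausdorff1_pre \<delta> S =
     (INF C \<in> {C :: nat \<Rightarrow> plane set. S \<subseteq> (\<Union>i. C i) \<and> (\<forall>i. bounded (C i) \<and> diameter (C i) \<le> \<delta>)}.
        \<Sum>i. ennreal (diameter (C i)))"

definition hausdorff1_outer :: "plane set \<Rightarrow> ennreal" where
  "hausdorff1_outer S = (SUP \<delta> \<in> {0<..}. hausdorff1_pre \<delta> S)"

text \<open>
  A metric outer measure is countably additive on Borel sets, so that \<^const>\<open>emeasure\<close> agrees with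
  \<^const>\<open>hausdorff1_outer\<close> there.
\<close>

definition hausdorff1 :: "plane measure" where
  "hausdorff1 = measure_of UNIV (sets borel) hausdorff1_outer"

section \<open>Line energies\<close>

text \<open>
  The traces differ at every jump point, so the value \<open>f 0\<close> never enters the energy: semicontinuity
  of the energy cannot yield semicontinuity of \<open>f\<close> at 0 unless \<open>f 0 = 0\<close>.
\<close>

definition line_energy :: "(real \<Rightarrow> ennreal) \<Rightarrow> plane set \<Rightarrow> (plane \<Rightarrow> plane) \<Rightarrow> ennreal" where
  "line_energy f \<Omega> m =
     (\<integral>\<^sup>+ x \<in> jump_set \<Omega> m. f (norm (trace_plus m x - trace_minus m x)) \<partial>hausdorff1)"

definition BV_weakly_lsc :: "plane set \<Rightarrow> ((plane \<Rightarrow> plane) \<Rightarrow> ennreal) \<Rightarrow> bool" where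
  "BV_weakly_lsc \<Omega> E \<longleftrightarrow>
     (\<forall>mn m. (\<forall>n. mn n \<in> A_space \<Omega>) \<longrightarrow> m \<in> A_space \<Omega> \<longrightarrow> BV_weakly_converges \<Omega> mn m \<longrightarrow>
        E m \<le> liminf (\<lambda>n. E (mn n)))"

definition lsc_on :: "real set \<Rightarrow> (real \<Rightarrow> ennreal) \<Rightarrow> bool" where
  "lsc_on S f \<longleftrightarrow> (\<forall>t\<in>S. f t \<le> Liminf (at t within S) f)"

text \<open>Unlike a limit superior along \<^term>\<open>at_left (2::real)\<close>, this one takes the value at 2 into account.\<close>

definition limsup_at_2 :: "(real \<Rightarrow> ennreal) \<Rightarrow> ennreal" where
  "limsup_at_2 f = (INF \<delta> \<in> {0<..2}. SUP t \<in> {2 - \<delta>..2}. f t)"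

definition limsup_slope_at_0 :: "(real \<Rightarrow> ennreal) \<Rightarrow> ennreal" where
  "limsup_slope_at_0 f = (INF \<delta> \<in> {0<..2}. SUP t \<in> {0<..\<delta>}. f t / ennreal t)"

end

theory Submission
  imports Defs
begin

text \<open>
  Divergence-free unit fields are the rotated gradients of solutions of the eikonal equation.

  Lower semicontinuity of \<open>f\<close> is tested on fields that are constant on both sides of a vertical line.
  For the slope bound put \<open>s = t/2\<close> and \<open>c = sqrt (1 - s\<^sup>2)\<close>.  The potential
  \<open>c * y + s * \<bar>x\<bar>\<close> has a gradient jump of size \<open>t\<close> on the vertical axis.  It agrees with the distance to
  the origin on the two rays through \<open>(\<plusminus>s, c)\<close>, so it can be glued to vortices in such a way that
  the jump set is a bounded segment of length \<open>l\<close>; no jump is left elsewhere that could have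
  infinite energy.  Now divide the segment into \<open>N\<close> pieces of length \<open>H\<close> and replace the potential,
  in the sector between the two rays above the lower end point of each piece, by its maximum with
  \<open>min r (H * (1 + c) - r)\<close>, where \<open>r\<close> is the distance to that end point.  The small jump disappears,
  and new jumps occur only on an arc of a circle and on two arcs of parabolas.  They have sizes
  between \<open>sqrt (2 + 2 * c)\<close> and \<open>2\<close>, and the arcs have total length at most \<open>4 * s * H / c\<^sup>2\<close>.
  Letting \<open>N\<close> tend to infinity gives \<open>f t * l \<le> 2 * t * l / c\<^sup>2 * (SUP x\<in>{sqrt (2 + 2 * c)..2}. f x)\<close>.
\<close>

section \<open>One-dimensional Hausdorff measure\<close>

text \<open>The cost \<open>f\<close> is uncontrolled away from 2 and may be infinite there, so a
  comparison field may not jump by intermediate amounts. Hence the new jumps only oppose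
  \<open>- sgn y\<close> to \<open>sgn y\<close> or \<open>edir y\<close>, two nearly opposite
  vectors; on the circle the jump is exactly 2, so the value at 2 has to count in the upper limit.

  Weak convergence also asks for a variation bound that does not depend on \<open>N\<close>. Each
  cell contributes a fixed multiple of its size \<open>l / N\<close>, and the cells shrink towards
  the axis, so the fields converge almost everywhere.

  The constant \<open>H * (1 + c)\<close> makes the cells fit: at height \<open>h\<close> on the
  axis the wedge potential is \<open>c * h\<close>, and \<open>c * h = H * (1 + c) - h\<close> holds
  exactly for \<open>h = H\<close>. So each cell ends at the base point of the next one and the
  whole segment is covered.

  The arcs are graphs over the horizontal with slope at most \<open>s / c\<close>, so each has
  length at most \<open>1 / c\<close> times its width. The widths are at most
  \<open>2 * s * H / c\<close> for the circle and \<open>s * H / c\<close> for each parabola. As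
  \<open>t = 2 * s\<close> tends to 0, \<open>c\<close> tends to 1; division by \<open>t\<close>
  then leaves the factor 2.\<close>

lemma metric_outer_measure_split_closed:
  fixes f :: "'a::metric_space set \<Rightarrow> ennreal"
  assumes out: "outer_measure_space UNIV f"
    and sep: "\<And>A B d. 0 < d \<Longrightarrow> (\<And>x y. x \<in> A \<Longrightarrow> y \<in> B \<Longrightarrow> d \<le> dist x y) \<Longrightarrow> f A + f B \<le> f (A \<union> B)"
    and K: "closed K" "K \<noteq> {}"
  shows "f (a \<inter> K) + f (a - K) \<le> f a"
proof (cases "f a = \<infinity>")
  case False
  have pos: "f {} = 0" and mono: "\<And>A B. A \<subseteq> B \<Longrightarrow> f A \<le> f B"
    and csub: "countably_subadditive UNIV f"
    using out by (auto simp: outer_measure_space_def positive_def increasing_def)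
  have sub: "f (A \<union> B) \<le> f A + f B" for A B
  proof -
    have "subadditive UNIV f"
      using ring_of_sets.countably_subadditive_subadditive[of UNIV UNIV f] csub out
      by (metis Pow_UNIV outer_measure_space_def ring_of_sets_Pow)
    moreover have "A \<union> B = A \<union> (B - A)" "f (B - A) \<le> f B"
      by (auto intro: mono)
    ultimately show ?thesis
      unfolding subadditive_def by (metis Diff_disjoint UNIV_I add_left_mono order_trans)
  qed
  \<comment> \<open>\<open>B n\<close> keeps a positive distance from \<open>K\<close>, so
    \<open>f\<close> is additive on \<open>a \<inter> K\<close> and \<open>B n\<close>. What is
    missing from \<open>a - K\<close> is made of the shells \<open>R k\<close> with
    \<open>k \<ge> n\<close>. The proof consists in showing that the shells have a finite
    sum.\<close>
  define B where "B n = {x \<in> a. infdist x K \<ge> 1 / real (Suc n)}" for n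
  define R where "R n = B (Suc n) - B n" for n
  have Bmono: "B m \<subseteq> B n" if "m \<le> n" for m n
  proof -
    have "1 / real (Suc n) \<le> 1 / real (Suc m)"
      using that by (simp add: frac_le)
    then show ?thesis by (auto simp: B_def)
  qed
  have Ra: "R n \<subseteq> a" for n by (auto simp: R_def B_def)
  \<comment> \<open>Neighbouring shells may touch, but two shells whose indices differ by at least 2
    have a full shell between them. This is why shells of even and of odd index are summed
    separately below.\<close>
  have sepR: "1 / real k - 1 / real (Suc k) \<le> dist x y"
    if "x \<in> R j" "y \<in> R k" "j + 2 \<le> k" for x y j k
  proof -
    have 1: "1 / real (Suc (Suc j)) \<le> infdist x K" using that by (auto simp: R_def B_def)
    have 2: "infdist y K < 1 / real (Suc k)" using that by (auto simp: R_def B_def)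
    have 3: "1 / real k \<le> 1 / real (Suc (Suc j))"
      using that by (intro frac_le) auto
    have "infdist x K \<le> infdist y K + dist x y" by (rule infdist_triangle)
    then show ?thesis using 1 2 3 by linarith
  qed
  have part: "(\<Sum>k<m. f (R (2*k+i))) \<le> f (\<Union>k<m. R (2*k+i))" for m i
  proof (induction m)
    case (Suc m)
    show ?case
    proof (cases "m = 0")
      case False
      \<comment> \<open>For \<open>m = 0\<close> and \<open>i = 0\<close> the first fraction would
        be \<open>1 / 0 = 0\<close> and the gap negative; hence the separate case.\<close>
      define d where "d = 1 / real (2*m+i) - 1 / real (Suc (2*m+i))"
      have "0 < d"
        using False unfolding d_def by (simp add: frac_less2)
      moreover have "d \<le> dist x y" if x: "x \<in> (\<Union>k<m. R (2*k+i))" and y: "y \<in> R (2*m+i)" for x y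
      proof -
        obtain k where k: "k < m" "x \<in> R (2*k+i)" using x by auto
        then show ?thesis unfolding d_def by (intro sepR[OF k(2) y]) auto
      qed
      ultimately have "f (\<Union>k<m. R (2*k+i)) + f (R (2*m+i)) \<le> f ((\<Union>k<m. R (2*k+i)) \<union> R (2*m+i))"
        by (rule sep)
      moreover have "(\<Union>k<Suc m. R (2*k+i)) = (\<Union>k<m. R (2*k+i)) \<union> R (2*m+i)"
        by (auto simp: lessThan_Suc)
      ultimately show ?thesis
        using order_trans[OF add_right_mono[OF Suc.IH, of "f (R (2*m+i))"]] by simp
    qed (simp add: lessThan_Suc)
  qed (simp add: pos)
  have bound: "(\<Sum>k<m. f (R k)) \<le> 2 * f a" for m
  proof -
    have "(\<Sum>k<m. f (R k)) \<le> (\<Sum>k<2*m. f (R k))"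
      by (intro sum_mono2) auto
    also have "\<dots> = (\<Sum>k<m. f (R (2*k+0))) + (\<Sum>k<m. f (R (2*k+1)))"
      by (induction m) (simp_all add: algebra_simps)
    also have "\<dots> \<le> f a + f a"
      by (rule add_mono; rule order_trans[OF part mono]; use Ra in blast)
    finally show ?thesis by (simp add: mult_2)
  qed
  define T where "T = (\<Sum>k. f (R k))"
  have "T \<le> 2 * f a"
    unfolding T_def by (intro suminf_le_const summableI bound)
  then have T: "T \<noteq> \<infinity>"
    using False by (auto simp: top_unique ennreal_mult_eq_top_iff)
  have cover: "a - K \<subseteq> B n \<union> (\<Union>k. R (k + n))" for n
  proof
    fix x assume x: "x \<in> a - K"
    then have "0 < infdist x K"
      using K in_closed_iff_infdist_zero[of K x] infdist_nonneg[of x K] by force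
    then obtain m where m: "1 / real (Suc m) < infdist x K"
      using nat_approx_posE by blast
    then have ex: "\<exists>m. x \<in> B m" using x by (intro exI[of _ m]) (auto simp: B_def)
    define q where "q = (LEAST m. x \<in> B m)"
    have q: "x \<in> B q" unfolding q_def using ex by (rule LeastI_ex)
    show "x \<in> B n \<union> (\<Union>k. R (k + n))"
    proof (cases "q \<le> n")
      case True then show ?thesis using q Bmono by blast
    next
      case False
      then obtain p where p: "q = Suc (p + n)"
        by (metis add.commute less_imp_Suc_add not_le add_Suc_right)
      have "x \<notin> B (p + n)" using not_less_Least[of "p+n" "\<lambda>m. x \<in> B m"] p by (auto simp: q_def)
      then have "x \<in> R (p + n)" using q p by (simp add: R_def)
      then show ?thesis by blast
    qed
  qed
  \<comment> \<open>Instead of letting the tail of the series tend to 0, the partial sums are added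
    on both sides. In the limit this adds \<open>T\<close> to both sides, and \<open>T\<close>,
    being finite, cancels.\<close>
  have key: "f (a \<inter> K) + f (a - K) + (\<Sum>k<n. f (R k)) \<le> f a + T" for n
  proof -
    have "f (\<Union>k. R (k + n)) \<le> (\<Sum>k. f (R (k + n)))"
    proof -
      have "disjoint_family (\<lambda>k. R (k + n))"
        unfolding disjoint_family_on_def
      proof (intro ballI impI)
        have *: "R i \<inter> R j = {}" if "i < j" for i j
          using Bmono[of "Suc i" j] that by (auto simp: R_def)
        fix i j :: nat assume "i \<noteq> j"
        then show "R (i + n) \<inter> R (j + n) = {}"
          using *[of "i+n" "j+n"] *[of "j+n" "i+n"] by (cases "i < j") auto
      qed
      then show ?thesis using csub unfolding countably_subadditive_def by simp
    qed
    then have 1: "f (a - K) \<le> f (B n) + (\<Sum>k. f (R (k + n)))"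
      by (intro order_trans[OF mono[OF cover] order_trans[OF sub add_left_mono]])
    have 2: "f (a \<inter> K) + f (B n) \<le> f a"
    proof -
      have "f (a \<inter> K) + f (B n) \<le> f ((a \<inter> K) \<union> B n)"
      proof (rule sep)
        fix x y assume "x \<in> a \<inter> K" "y \<in> B n"
        then have "1 / real (Suc n) \<le> infdist y K" "infdist y K \<le> dist y x"
          by (auto simp: B_def intro: infdist_le)
        then show "1 / real (Suc n) \<le> dist x y" by (simp add: dist_commute)
      qed simp
      also have "\<dots> \<le> f a" by (intro mono) (auto simp: B_def)
      finally show ?thesis .
    qed
    have "f (a \<inter> K) + f (a - K) + (\<Sum>k<n. f (R k))
        \<le> f (a \<inter> K) + (f (B n) + (\<Sum>k. f (R (k + n)))) + (\<Sum>k<n. f (R k))"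
      by (intro add_mono 1 order_refl)
    also have "\<dots> = (f (a \<inter> K) + f (B n)) + ((\<Sum>k. f (R (k + n))) + (\<Sum>k<n. f (R k)))"
      by (simp add: algebra_simps)
    also have "(\<Sum>k. f (R (k + n))) + (\<Sum>k<n. f (R k)) = T"
      unfolding T_def by (rule suminf_offset[symmetric]) (rule summableI)
    finally show ?thesis by (rule order_trans[OF _ add_right_mono[OF 2]])
  qed
  have "T + (f (a \<inter> K) + f (a - K)) \<le> f a + T"
    unfolding T_def by (rule ennreal_suminf_bound_add) (use key in \<open>simp add: add.commute T_def\<close>)
  then show ?thesis
    using T by (simp add: add.commute[of "f a"] ennreal_add_left_cancel_le)
qed simp

text \<open>Caratheodory's criterion. The sets that split every set additively form a sigma-algebra
  on which \<open>f\<close> is countably additive; closed sets belong to it by the preceding lemma,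
  and they generate the Borel sets.\<close>

lemma metric_outer_measure_borel:
  fixes f :: "'a::metric_space set \<Rightarrow> ennreal"
  assumes out: "outer_measure_space UNIV f"
    and sep: "\<And>A B d. 0 < d \<Longrightarrow> (\<And>x y. x \<in> A \<Longrightarrow> y \<in> B \<Longrightarrow> d \<le> dist x y) \<Longrightarrow> f A + f B \<le> f (A \<union> B)"
  shows "measure_space UNIV (sets borel) f"
proof -
  interpret U: sigma_algebra UNIV "UNIV :: 'a set set"
    using sigma_algebra_Pow[of "UNIV :: 'a set"] by simp
  define L where "L = lambda_system UNIV UNIV f"
  have ms: "measure_space UNIV L f"
    unfolding L_def by (rule U.caratheodory_lemma[OF out])
  have L: "sigma_algebra UNIV L"
    using ms by (simp add: measure_space_def)
  have pos: "f {} = 0" and mono: "\<And>A B. A \<subseteq> B \<Longrightarrow> f A \<le> f B"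
    and csub: "countably_subadditive UNIV f"
    using out by (auto simp: outer_measure_space_def positive_def increasing_def)
  have subadd: "subadditive UNIV f"
    using out by (intro U.countably_subadditive_subadditive) (auto simp: outer_measure_space_def)
  have "K \<in> L" if K: "closed K" for K :: "'a set"
  proof -
    have "f (a \<inter> K) + f (a - K) = f a" for a
    proof (rule antisym)
      show "f (a \<inter> K) + f (a - K) \<le> f a"
      proof (cases "K = {}")
        case False
        show ?thesis by (rule metric_outer_measure_split_closed[OF out _ K False]) (rule sep)
      qed (simp add: pos)
      have "f ((a \<inter> K) \<union> (a - K)) \<le> f (a \<inter> K) + f (a - K)"
        by (intro subadditiveD[OF subadd]) auto
      moreover have "(a \<inter> K) \<union> (a - K) = a" by blast
      ultimately show "f a \<le> f (a \<inter> K) + f (a - K)" by simp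
    qed
    then show "K \<in> L"
      unfolding L_def U.lambda_system_eq by blast
  qed
  then have "Collect closed \<subseteq> L" by auto
  then have "sigma_sets UNIV (Collect closed) \<subseteq> L"
    by (rule sigma_algebra.sigma_sets_subset[OF L])
  moreover have "sets (borel :: 'a measure) = sigma_sets UNIV (Collect closed)"
    by (subst borel_eq_closed) (rule sets_measure_of, simp)
  ultimately have "sets (borel :: 'a measure) \<subseteq> L" by simp
  moreover have "sigma_algebra UNIV (sets (borel :: 'a measure))"
    using sets.sigma_algebra_axioms[of "borel :: 'a measure"] unfolding space_borel .
  ultimately show ?thesis
    by (intro measure_down[OF ms])
qed

section \<open>The Hausdorff measure as a metric outer measure\<close>

lemma hausdorff1_pre_mono: "A \<subseteq> B \<Longrightarrow> hausdorff1_pre \<delta> A \<le> hausdorff1_pre \<delta> B"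
  unfolding hausdorff1_pre_def by (rule INF_superset_mono) auto

lemma hausdorff1_pre_antimono: "\<delta> \<le> \<epsilon> \<Longrightarrow> hausdorff1_pre \<epsilon> A \<le> hausdorff1_pre \<delta> A"
  unfolding hausdorff1_pre_def by (rule INF_superset_mono) (blast intro: order_trans, rule order_refl)

lemma hausdorff1_pre_le:
  assumes "A \<subseteq> (\<Union>i. C i)" "\<And>i. bounded (C i)" "\<And>i. diameter (C i) \<le> \<delta>"
  shows "hausdorff1_pre \<delta> A \<le> (\<Sum>i. ennreal (diameter (C i)))"
  unfolding hausdorff1_pre_def using assms by (intro INF_lower) auto

lemma hausdorff1_pre_Union_le:
  "hausdorff1_pre \<delta> (\<Union>i::nat. A i) \<le> (\<Sum>i. hausdorff1_pre \<delta> (A i))"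
proof (rule ennreal_le_epsilon)
  fix e :: real assume e: "(\<Sum>i. hausdorff1_pre \<delta> (A i)) < top" "0 < e"
  have "\<exists>C. A n \<subseteq> (\<Union>i. C i) \<and> (\<forall>i. bounded (C i) \<and> diameter (C i) \<le> \<delta>) \<and>
      (\<Sum>i. ennreal (diameter (C i))) \<le> hausdorff1_pre \<delta> (A n) + e * (1/2)^Suc n" for n
  proof -
    have "hausdorff1_pre \<delta> (A n) < hausdorff1_pre \<delta> (A n) + e * (1/2)^Suc n"
      using e by (auto simp add: less_top dest!: ennreal_suminf_lessD)
    then obtain C where "A n \<subseteq> (\<Union>i. C i)" "\<forall>i. bounded (C i) \<and> diameter (C i) \<le> \<delta>"
      "(\<Sum>i. ennreal (diameter (C i))) < hausdorff1_pre \<delta> (A n) + e * (1/2)^Suc n"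
      unfolding hausdorff1_pre_def[of \<delta> "A n"] INF_less_iff by blast
    then show ?thesis by (intro exI[of _ C]) simp
  qed
  then obtain B where B: "\<And>n. A n \<subseteq> (\<Union>i. B n i)"
    "\<And>n i. bounded (B n i)" "\<And>n i. diameter (B n i) \<le> \<delta>"
    "\<And>n. (\<Sum>i. ennreal (diameter (B n i))) \<le> hausdorff1_pre \<delta> (A n) + e * (1/2)^Suc n"
    by metis
  define C where "C = case_prod B o prod_decode"
  have "(\<Union>i. A i) \<subseteq> (\<Union>i. C i)"
  proof
    fix x assume "x \<in> (\<Union>i. A i)"
    then obtain n i where "x \<in> B n i" using B(1) by blast
    then have "x \<in> C (prod_encode (n, i))" by (simp add: C_def)
    then show "x \<in> (\<Union>i. C i)" by blast
  qed
  then have "hausdorff1_pre \<delta> (\<Union>i. A i) \<le> (\<Sum>i. ennreal (diameter (C i)))"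
    by (rule hausdorff1_pre_le) (auto simp: C_def split_def B)
  also have "\<dots> = (\<Sum>n. \<Sum>i. ennreal (diameter (B n i)))"
    unfolding C_def comp_def by (intro suminf_ennreal_2dimen[of _ "\<lambda>p. ennreal (diameter (case_prod B p))", simplified]) auto
  also have "\<dots> \<le> (\<Sum>n. hausdorff1_pre \<delta> (A n) + e * (1/2) ^ Suc n)"
    by (intro suminf_le allI B) auto
  also have "\<dots> = (\<Sum>n. hausdorff1_pre \<delta> (A n)) + (\<Sum>n. ennreal e * ennreal ((1/2) ^ Suc n))"
    using \<open>0 < e\<close> by (subst suminf_add[symmetric])
       (auto simp del: ennreal_suminf_cmult simp add: ennreal_mult[symmetric])
  also have "\<dots> = (\<Sum>n. hausdorff1_pre \<delta> (A n)) + e"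
    unfolding ennreal_suminf_cmult
    by (subst suminf_ennreal_eq[OF zero_le_power power_half_series]) auto
  finally show "hausdorff1_pre \<delta> (\<Union>i. A i) \<le> (\<Sum>n. hausdorff1_pre \<delta> (A n)) + e" .
qed

text \<open>A covering set of diameter less than \<open>d\<close> cannot meet both \<open>A\<close>
  and \<open>B\<close>, so a covering of the union falls apart into a covering of \<open>A\<close>
  and one of \<open>B\<close>. Sets that meet neither are counted with \<open>B\<close>.\<close>

lemma hausdorff1_pre_separated:
  assumes d: "\<And>x y. x \<in> A \<Longrightarrow> y \<in> B \<Longrightarrow> d \<le> dist x y" and \<delta>: "0 < \<delta>" "\<delta> < d"
  shows "hausdorff1_pre \<delta> A + hausdorff1_pre \<delta> B \<le> hausdorff1_pre \<delta> (A \<union> B)"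
  unfolding hausdorff1_pre_def[of \<delta> "A \<union> B"]
proof (rule INF_greatest)
  fix C :: "nat \<Rightarrow> plane set"
  assume "C \<in> {C. A \<union> B \<subseteq> (\<Union>i. C i) \<and> (\<forall>i. bounded (C i) \<and> diameter (C i) \<le> \<delta>)}"
  then have C: "A \<union> B \<subseteq> (\<Union>i. C i)" "\<And>i. bounded (C i)" "\<And>i. diameter (C i) \<le> \<delta>" by auto
  define C1 where "C1 i = (if C i \<inter> A \<noteq> {} then C i else {})" for i
  define C2 where "C2 i = (if C i \<inter> A = {} then C i else {})" for i
  have "hausdorff1_pre \<delta> A \<le> (\<Sum>i. ennreal (diameter (C1 i)))"
  proof (intro hausdorff1_pre_le)
    show "A \<subseteq> (\<Union>i. C1 i)"
    proof
      fix x assume x: "x \<in> A"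
      then obtain i where "x \<in> C i" using C by blast
      then have "x \<in> C1 i" using x by (auto simp: C1_def)
      then show "x \<in> (\<Union>i. C1 i)" by blast
    qed
  qed (use C \<delta> in \<open>auto simp: C1_def\<close>)
  moreover have "hausdorff1_pre \<delta> B \<le> (\<Sum>i. ennreal (diameter (C2 i)))"
  proof (intro hausdorff1_pre_le)
    show "B \<subseteq> (\<Union>i. C2 i)"
    proof
      fix y assume y: "y \<in> B"
      then obtain i where i: "y \<in> C i" using C by blast
      have "C i \<inter> A = {}"
      proof (rule ccontr)
        assume "C i \<inter> A \<noteq> {}"
        then obtain x where "x \<in> A" "x \<in> C i" by blast
        then have "d \<le> dist x y" "dist x y \<le> diameter (C i)"
          using d y i C by (auto intro: diameter_bounded_bound)
        then show False using C(3)[of i] \<delta> by linarith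
      qed
      then show "y \<in> (\<Union>i. C2 i)" using i by (auto simp: C2_def)
    qed
  qed (use C \<delta> in \<open>auto simp: C2_def\<close>)
  ultimately have "hausdorff1_pre \<delta> A + hausdorff1_pre \<delta> B
      \<le> (\<Sum>i. ennreal (diameter (C1 i))) + (\<Sum>i. ennreal (diameter (C2 i)))"
    by (rule add_mono)
  also have "\<dots> = (\<Sum>i. ennreal (diameter (C1 i)) + ennreal (diameter (C2 i)))"
    by (rule suminf_add) auto
  also have "\<dots> = (\<Sum>i. ennreal (diameter (C i)))"
    by (rule suminf_cong) (auto simp: C1_def C2_def)
  finally show "hausdorff1_pre \<delta> A + hausdorff1_pre \<delta> B \<le> (\<Sum>i. ennreal (diameter (C i)))" .
qed

lemma hausdorff1_pre_le_outer: "0 < \<delta> \<Longrightarrow> hausdorff1_pre \<delta> A \<le> hausdorff1_outer A"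
  unfolding hausdorff1_outer_def by (rule SUP_upper) auto

lemma hausdorff1_outer_mono: "A \<subseteq> B \<Longrightarrow> hausdorff1_outer A \<le> hausdorff1_outer B"
  unfolding hausdorff1_outer_def by (intro SUP_mono') (rule hausdorff1_pre_mono)

lemma outer_measure_space_hausdorff1: "outer_measure_space UNIV hausdorff1_outer"
  unfolding outer_measure_space_def
proof (intro conjI)
  have "hausdorff1_pre \<delta> {} = 0" if "0 < \<delta>" for \<delta>
    using hausdorff1_pre_le[of "{}" "\<lambda>_. {}" \<delta>] that by simp
  then show "positive UNIV hausdorff1_outer"
    by (simp add: positive_def hausdorff1_outer_def)
  show "increasing UNIV hausdorff1_outer"
    by (simp add: increasing_def hausdorff1_outer_mono)
  have "hausdorff1_outer (\<Union>i. A i) \<le> (\<Sum>i. hausdorff1_outer (A i))" for A :: "nat \<Rightarrow> plane set"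
    unfolding hausdorff1_outer_def[of "\<Union>i. A i"]
  proof (rule SUP_least)
    fix \<delta> :: real assume "\<delta> \<in> {0<..}"
    then have "(\<Sum>i. hausdorff1_pre \<delta> (A i)) \<le> (\<Sum>i. hausdorff1_outer (A i))"
      by (intro suminf_le hausdorff1_pre_le_outer) auto
    then show "hausdorff1_pre \<delta> (\<Union>i. A i) \<le> (\<Sum>i. hausdorff1_outer (A i))"
      using hausdorff1_pre_Union_le order_trans by blast
  qed
  then show "countably_subadditive UNIV hausdorff1_outer"
    by (simp add: countably_subadditive_def)
qed

text \<open>The two suprema on the left run over independent scales. Since the premeasure grows as
  the scale shrinks, both may be replaced by one common scale below \<open>d\<close>.\<close>

lemma hausdorff1_outer_separated:
  assumes d: "0 < d" "\<And>x y. x \<in> A \<Longrightarrow> y \<in> B \<Longrightarrow> d \<le> dist x y"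
  shows "hausdorff1_outer A + hausdorff1_outer B \<le> hausdorff1_outer (A \<union> B)"
proof -
  have *: "hausdorff1_pre \<delta> A + hausdorff1_pre \<epsilon> B \<le> hausdorff1_outer (A \<union> B)"
    if "0 < \<delta>" "0 < \<epsilon>" for \<delta> \<epsilon>
  proof -
    define \<eta> where "\<eta> = min (d/2) (min \<delta> \<epsilon>)"
    have \<eta>: "0 < \<eta>" "\<eta> < d" "\<eta> \<le> \<delta>" "\<eta> \<le> \<epsilon>" using that d by (auto simp: \<eta>_def)
    have "hausdorff1_pre \<delta> A + hausdorff1_pre \<epsilon> B \<le> hausdorff1_pre \<eta> A + hausdorff1_pre \<eta> B"
      by (intro add_mono hausdorff1_pre_antimono \<eta>)
    also have "\<dots> \<le> hausdorff1_pre \<eta> (A \<union> B)"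
      by (rule hausdorff1_pre_separated[OF d(2) \<eta>(1,2)])
    also have "\<dots> \<le> hausdorff1_outer (A \<union> B)" by (rule hausdorff1_pre_le_outer[OF \<eta>(1)])
    finally show ?thesis .
  qed
  have "hausdorff1_outer A + hausdorff1_outer B
      = (SUP \<epsilon>\<in>{0<..}. SUP \<delta>\<in>{0<..}. hausdorff1_pre \<delta> A + hausdorff1_pre \<epsilon> B)"
    unfolding hausdorff1_outer_def by (simp add: ennreal_SUP_add_left ennreal_SUP_add_right)
  also have "\<dots> \<le> hausdorff1_outer (A \<union> B)" by (intro SUP_least *) auto
  finally show ?thesis .
qed

lemma sets_hausdorff1 [simp]: "sets hausdorff1 = sets borel"
  unfolding hausdorff1_def
  by (metis sets.sigma_sets_eq sets_measure_of space_borel sets.space_closed)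

lemma emeasure_hausdorff1:
  assumes "S \<in> sets borel"
  shows "emeasure hausdorff1 S = hausdorff1_outer S"
proof -
  have "measure_space UNIV (sets borel) hausdorff1_outer"
    by (rule metric_outer_measure_borel[OF outer_measure_space_hausdorff1 hausdorff1_outer_separated])
  then show ?thesis
    using assms
    by (intro emeasure_measure_of[OF hausdorff1_def]) (auto simp: measure_space_def)
qed

text \<open>\<open>S\<close> is seen as a graph over the values of \<open>g\<close>. Cutting
  \<open>[a, b]\<close> into \<open>n\<close> equal strips cuts \<open>S\<close> into
  \<open>n\<close> pieces of diameter at most \<open>K * (b - a) / n\<close>, whose sum does not
  depend on \<open>n\<close>.\<close>

lemma hausdorff1_outer_le_graph:
  fixes g :: "plane \<Rightarrow> real"
  assumes lip: "\<And>x y. x \<in> S \<Longrightarrow> y \<in> S \<Longrightarrow> norm (x - y) \<le> K * \<bar>g x - g y\<bar>"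
    and g: "\<And>x. x \<in> S \<Longrightarrow> a \<le> g x \<and> g x \<le> b" and K: "0 \<le> K" and ab: "a < b"
  shows "hausdorff1_outer S \<le> ennreal (K * (b - a))"
  unfolding hausdorff1_outer_def
proof (rule SUP_least)
  fix \<delta> :: real assume "\<delta> \<in> {0<..}"
  then obtain m where m: "K * (b - a) / \<delta> < real m" using reals_Archimedean2 by blast
  define n where "n = Suc m"
  have n: "n > 0" "K * ((b - a) / n) \<le> \<delta>"
  proof -
    have "K * (b - a) < real n * \<delta>"
      using m \<open>\<delta> \<in> _\<close> by (simp add: n_def field_simps add_strict_increasing)
    then show "K * ((b - a) / n) \<le> \<delta>" by (simp add: n_def field_simps)
  qed (simp add: n_def)
  define w where "w = (b - a) / n"
  have w: "0 < w" using ab n by (simp add: w_def)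
  define C where "C i = (if i < n then {x \<in> S. a + i * w \<le> g x \<and> g x \<le> a + (i + 1) * w} else {})" for i :: nat
  have no: "norm (x - y) \<le> K * w" if "x \<in> C i" "y \<in> C i" for x y i
  proof -
    have "\<bar>g x - g y\<bar> \<le> w" using that by (auto simp: C_def algebra_simps split: if_splits)
    then have "K * \<bar>g x - g y\<bar> \<le> K * w" using K by (rule mult_left_mono)
    moreover have "norm (x - y) \<le> K * \<bar>g x - g y\<bar>" 
      using that by (intro lip) (auto simp: C_def split: if_splits)
    ultimately show ?thesis by linarith
  qed
  have dia: "diameter (C i) \<le> K * w" for i
    by (rule diameter_le) (use K w no in auto)
  have bdd: "bounded (C i)" for i
    unfolding bounded_two_points using no by (auto simp: dist_norm)
  have "S \<subseteq> (\<Union>i. C i)"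
  proof
    fix x assume x: "x \<in> S"
    \<comment> \<open>The minimum puts points with \<open>g x = b\<close>, whose strip number would
      be \<open>n\<close>, into the last strip.\<close>
    define j where "j = min (n - 1) (nat \<lfloor>(g x - a) / w\<rfloor>)"
    have gx: "0 \<le> (g x - a) / w" using g[OF x] w by simp
    have jn: "j < n" using n by (auto simp: j_def)
    have "real j \<le> (g x - a) / w"
      unfolding j_def using gx by (simp add: of_nat_min) linarith
    moreover have "(g x - a) / w \<le> real j + 1"
    proof (cases "nat \<lfloor>(g x - a) / w\<rfloor> \<le> n - 1")
      case True
      then have "j = nat \<lfloor>(g x - a) / w\<rfloor>" by (simp add: j_def)
      then show ?thesis using gx by linarith
    next
      case False
      then have "real j + 1 = n" using n by (simp add: j_def)
      moreover have "(g x - a) / w \<le> n"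
        using g[OF x] ab n by (simp add: w_def field_simps)
      ultimately show ?thesis by simp
    qed
    ultimately have "x \<in> C j" using x jn w by (simp add: C_def field_simps)
    then show "x \<in> (\<Union>i. C i)" by blast
  qed
  then have "hausdorff1_pre \<delta> S \<le> (\<Sum>i. ennreal (diameter (C i)))"
    using bdd dia n by (intro hausdorff1_pre_le) (auto simp: w_def intro: order_trans)
  also have "\<dots> = (\<Sum>i<n. ennreal (diameter (C i)))"
    by (rule suminf_finite) (auto simp: C_def)
  also have "\<dots> \<le> (\<Sum>i<n. ennreal (K * w))"
    by (intro sum_mono ennreal_leI dia)
  also have "\<dots> = ennreal (K * (b - a))"
    using n K w by (simp add: ennreal_of_nat_eq_real_of_nat flip: ennreal_mult) (simp add: w_def)
  finally show "hausdorff1_pre \<delta> S \<le> ennreal (K * (b - a))" .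
qed

text \<open>Projection to the second coordinate does not increase diameters, so any covering of
  \<open>S\<close> yields intervals that cover \<open>(a, b)\<close> and whose lengths are at most
  the given diameters. The scale 1 is an arbitrary choice.\<close>

lemma hausdorff1_outer_vertical_segment_ge:
  fixes S :: "plane set"
  assumes S: "\<And>y. a < y \<Longrightarrow> y < b \<Longrightarrow> vector [x, y] \<in> S"
  shows "ennreal (b - a) \<le> hausdorff1_outer S"
proof -
  have "ennreal (b - a) \<le> hausdorff1_pre 1 S"
    unfolding hausdorff1_pre_def
  proof (rule INF_greatest)
    fix C :: "nat \<Rightarrow> plane set"
    assume "C \<in> {C. S \<subseteq> (\<Union>i. C i) \<and> (\<forall>i. bounded (C i) \<and> diameter (C i) \<le> 1)}"
    then have C: "S \<subseteq> (\<Union>i. C i)" "\<And>i. bounded (C i)" by auto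
    define p where "p i = (\<lambda>y. y $ 2) ` C i" for i
    \<comment> \<open>The projections need not be measurable; their interval hulls are, and they are
      no longer than the diameters. Empty sets are kept apart because \<open>Inf\<close> and
      \<open>Sup\<close> say nothing about them.\<close>
    define J where "J i = (if C i = {} then {} else {Inf (p i)..Sup (p i)})" for i
    have bp: "bounded (p i)" for i
    proof -
      obtain B where "\<And>y. y \<in> C i \<Longrightarrow> norm y \<le> B" using C(2) bounded_iff by blast
      then show ?thesis unfolding p_def bounded_iff
        by (intro exI[of _ B]) (auto intro: order_trans[OF component_le_norm_cart])
    qed
    have JJ: "emeasure lborel (J i) \<le> ennreal (diameter (C i))" for i
    proof (cases "C i = {}")
      case False
      then have ne: "p i \<noteq> {}" by (simp add: p_def)
      have ab: "u \<le> v + diameter (C i)" if uv: "u \<in> p i" "v \<in> p i" for u v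
      proof -
        obtain y z where yz: "y \<in> C i" "z \<in> C i" "u = y $ 2" "v = z $ 2" using uv unfolding p_def by blast
        have "\<bar>(y - z) $ 2\<bar> \<le> norm (y - z)" by (rule component_le_norm_cart)
        also have "\<dots> \<le> diameter (C i)" using diameter_bounded_bound[OF C(2) yz(1,2)] by (simp add: dist_norm)
        finally show ?thesis using yz by simp
      qed
      have "Sup (p i) \<le> v + diameter (C i)" if "v \<in> p i" for v
        by (rule cSup_least[OF ne]) (use ab that in auto)
      then have "Sup (p i) - diameter (C i) \<le> Inf (p i)"
        by (intro cInf_greatest[OF ne]) (simp add: algebra_simps)
      moreover have "Inf (p i) \<le> Sup (p i)"
        by (rule cInf_le_cSup[OF ne]) (rule bounded_imp_bdd_above[OF bp], rule bounded_imp_bdd_below[OF bp])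
      ultimately show ?thesis using False by (simp add: J_def ennreal_leI)
    qed (simp add: J_def)
    have "{a<..<b} \<subseteq> (\<Union>i. J i)"
    proof
      fix y assume "y \<in> {a<..<b}"
      then have "(vector [x, y] :: plane) \<in> S" using S by simp
      then obtain i where i: "vector [x, y] \<in> C i" using C by blast
      then have "y \<in> p i" unfolding p_def by (rule rev_image_eqI) simp
      then have "y \<in> J i" using i
        using cInf_lower[OF _ bounded_imp_bdd_below[OF bp]] cSup_upper[OF _ bounded_imp_bdd_above[OF bp]]
        by (auto simp: J_def)
      then show "y \<in> (\<Union>i. J i)" by blast
    qed
    then have "emeasure lborel {a<..<b} \<le> emeasure lborel (\<Union>i. J i)"
      by (rule emeasure_mono) (auto simp: J_def)
    also have "\<dots> \<le> (\<Sum>i. emeasure lborel (J i))"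
      by (rule emeasure_subadditive_countably) (auto simp: J_def)
    also have "\<dots> \<le> (\<Sum>i. ennreal (diameter (C i)))"
      by (intro suminf_le JJ) auto
    finally show "ennreal (b - a) \<le> (\<Sum>i. ennreal (diameter (C i)))"
      by (cases "a \<le> b") (simp_all add: ennreal_neg)
  qed
  also have "\<dots> \<le> hausdorff1_outer S" by (rule hausdorff1_pre_le_outer) simp
  finally show ?thesis .
qed

section \<open>Rotated gradients of Lipschitz potentials\<close>

text \<open>Contains both classes of test functions, the one of the variation and the one of the
  divergence. The support may lie anywhere, so that all integrals can be taken over the
  plane.\<close>

definition C1_compact :: "(plane \<Rightarrow> real) \<Rightarrow> bool" where
  "C1_compact \<phi> \<longleftrightarrow> C_diff 1 \<phi> \<and> compact (closure {x. \<phi> x \<noteq> 0})"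

lemma test_C1_compact: "\<phi> \<in> test_C1 \<Omega> \<Longrightarrow> C1_compact \<phi>"
  by (auto simp: test_C1_def C1_compact_def compact_support_in_def)

lemma test_Cinf_compact: "\<phi> \<in> test_Cinf \<Omega> \<Longrightarrow> C1_compact \<phi>"
  by (auto simp: test_Cinf_def C1_compact_def compact_support_in_def)

lemma plane_decomp: "(h :: plane) = (\<Sum>i\<in>UNIV. h $ i *\<^sub>R axis i 1)"
  by (simp add: vec_eq_iff UNIV_2 forall_2 axis_def)

lemma C1_compact_has_derivative:
  assumes "C1_compact \<phi>"
  shows "(\<phi> has_derivative (\<lambda>h. \<Sum>i\<in>UNIV. h $ i * partial_deriv i \<phi> x)) (at x)"
proof -
  have "\<phi> differentiable at x" using assms by (simp add: C1_compact_def)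
  then have d: "(\<phi> has_derivative frechet_derivative \<phi> (at x)) (at x)"
    by (simp add: frechet_derivative_works)
  then interpret l: linear "frechet_derivative \<phi> (at x)" by (rule has_derivative_linear)
  have "frechet_derivative \<phi> (at x) h = (\<Sum>i\<in>UNIV. h $ i * partial_deriv i \<phi> x)" for h
    by (subst plane_decomp[of h]) (simp add: l.sum l.scaleR partial_deriv_def)
  then have "frechet_derivative \<phi> (at x) = (\<lambda>h. \<Sum>i\<in>UNIV. h $ i * partial_deriv i \<phi> x)" by blast
  then show ?thesis using d by simp
qed

lemma C1_compact_continuous:
  assumes "C1_compact \<phi>"
  shows "continuous_on UNIV \<phi>" "continuous_on UNIV (partial_deriv i \<phi>)"
proof -
  show "continuous_on UNIV \<phi>"
    using C1_compact_has_derivative[OF assms]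
    by (meson continuous_at_imp_continuous_on has_derivative_continuous)
  show "continuous_on UNIV (partial_deriv i \<phi>)"
    using assms by (simp add: C1_compact_def)
qed

lemma C1_compact_measurable [measurable_dest]:
  assumes "C1_compact \<phi>"
  shows "\<phi> \<in> borel_measurable borel" "partial_deriv i \<phi> \<in> borel_measurable borel"
  using C1_compact_continuous[OF assms] by (auto intro: borel_measurable_continuous_onI)

lemma partial_deriv_zero_outside:
  assumes "x \<notin> closure {x. \<phi> x \<noteq> 0}"
  shows "partial_deriv i \<phi> x = 0"
proof -
  have "((\<lambda>x. 0) has_derivative (\<lambda>x. 0)) (at x :: plane filter)" by simp
  then have "(\<phi> has_derivative (\<lambda>x. 0)) (at x)"
  proof (rule has_derivative_transform_within_open)
    show "open (- closure {x. \<phi> x \<noteq> 0})" "x \<in> - closure {x. \<phi> x \<noteq> 0}" using assms by auto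
    fix y assume "y \<in> - closure {x. \<phi> x \<noteq> 0}"
    then show "0 = \<phi> y" using closure_subset[of "{x. \<phi> x \<noteq> 0}"] by auto
  qed
  then have "frechet_derivative \<phi> (at x) = (\<lambda>x. 0)" by (rule frechet_derivative_at[symmetric])
  then show ?thesis by (simp add: partial_deriv_def)
qed

lemma partial_deriv_zero_outside_test:
  assumes "\<phi> \<in> test_C1 \<Omega> \<or> \<phi> \<in> test_Cinf \<Omega>" "x \<notin> \<Omega>"
  shows "partial_deriv i \<phi> x = 0" "\<phi> x = 0"
proof -
  have "x \<notin> closure {x. \<phi> x \<noteq> 0}"
    using assms by (auto simp: test_C1_def test_Cinf_def compact_support_in_def)
  then show "partial_deriv i \<phi> x = 0" "\<phi> x = 0"
    using partial_deriv_zero_outside[of x \<phi> i] closure_subset[of "{x. \<phi> x \<noteq> 0}"] by auto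
qed

lemma C1_compact_bounds:
  assumes \<phi>: "C1_compact \<phi>"
  obtains R M where "0 < R" "0 < M" "\<And>x. \<bar>\<phi> x\<bar> \<le> M" "\<And>x i. \<bar>partial_deriv i \<phi> x\<bar> \<le> M"
    "\<And>x. x \<notin> cball 0 R \<Longrightarrow> \<phi> x = 0" "\<And>x i. x \<notin> cball 0 R \<Longrightarrow> partial_deriv i \<phi> x = 0"
    "\<And>x y. \<bar>\<phi> x - \<phi> y\<bar> \<le> M * norm (x - y)"
proof -
  define K where "K = closure {x. \<phi> x \<noteq> 0}"
  have K: "compact K" using \<phi> by (simp add: C1_compact_def K_def)
  obtain R where R: "0 < R" "\<And>x. x \<in> K \<Longrightarrow> norm x \<le> R"
    using compact_imp_bounded[OF K] unfolding bounded_pos by blast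
  have out: "\<phi> x = 0" "partial_deriv i \<phi> x = 0" if "x \<notin> cball 0 R" for x i
  proof -
    have "x \<notin> K" using that R(2)[of x] by auto
    then show "\<phi> x = 0" "partial_deriv i \<phi> x = 0"
      using closure_subset[of "{x. \<phi> x \<noteq> 0}"] partial_deriv_zero_outside[of x \<phi> i]
      unfolding K_def by auto
  qed
  have bd: "\<exists>B>0. \<forall>x. \<bar>g x\<bar> \<le> B"
    if g: "continuous_on UNIV g" "\<And>x. x \<notin> cball 0 R \<Longrightarrow> g x = 0" for g :: "plane \<Rightarrow> real"
  proof -
    have "compact (g ` cball 0 R)"
      by (intro compact_continuous_image continuous_on_subset[OF g(1)]) auto
    then obtain B where B: "0 < B" "\<And>x. x \<in> cball 0 R \<Longrightarrow> \<bar>g x\<bar> \<le> B"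
      using bounded_pos[of "g ` cball 0 R"] compact_imp_bounded by auto
    then have "\<bar>g x\<bar> \<le> B" for x using g(2)[of x] by (cases "x \<in> cball 0 R") auto
    then show ?thesis using B by blast
  qed
  obtain B0 where B0: "0 < B0" "\<And>x. \<bar>\<phi> x\<bar> \<le> B0"
    using bd[OF C1_compact_continuous(1)[OF \<phi>] out(1)] by blast
  obtain B1 where B1: "0 < B1" "\<And>x. \<bar>partial_deriv 1 \<phi> x\<bar> \<le> B1"
    using bd[OF C1_compact_continuous(2)[OF \<phi>] out(2)] by blast
  obtain B2 where B2: "0 < B2" "\<And>x. \<bar>partial_deriv 2 \<phi> x\<bar> \<le> B2"
    using bd[OF C1_compact_continuous(2)[OF \<phi>] out(2)] by blast
  define M where "M = B0 + B1 + B2"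
  have "\<bar>\<phi> x - \<phi> y\<bar> \<le> M * norm (x - y)" for x y
  proof -
    have "norm (\<phi> x - \<phi> y) \<le> M * norm (x - y)"
    proof (rule differentiable_bound[OF convex_UNIV])
      fix z :: plane
      show "(\<phi> has_derivative (\<lambda>h. \<Sum>i\<in>UNIV. h $ i * partial_deriv i \<phi> z)) (at z within UNIV)"
        using C1_compact_has_derivative[OF \<phi>] by simp
      show "onorm (\<lambda>h. \<Sum>i\<in>UNIV. h $ i * partial_deriv i \<phi> z) \<le> M"
      proof (rule onorm_le)
        fix h :: plane
        have "\<bar>h $ i * partial_deriv i \<phi> z\<bar> \<le> norm h * \<bar>partial_deriv i \<phi> z\<bar>" for i
          by (simp add: abs_mult component_le_norm_cart mult_right_mono)
        from add_mono[OF this[of 1] this[of 2]]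
        have "\<bar>\<Sum>i\<in>UNIV. h $ i * partial_deriv i \<phi> z\<bar>
            \<le> norm h * \<bar>partial_deriv 1 \<phi> z\<bar> + norm h * \<bar>partial_deriv 2 \<phi> z\<bar>"
          by (simp add: UNIV_2)
        also have "\<dots> \<le> norm h * B1 + norm h * B2"
          using B1 B2 by (intro add_mono mult_left_mono) auto
        also have "\<dots> \<le> M * norm h" using B0 by (simp add: M_def algebra_simps)
        finally show "norm (\<Sum>i\<in>UNIV. h $ i * partial_deriv i \<phi> z) \<le> M * norm h" by simp
      qed
    qed auto
    then show ?thesis by simp
  qed
  moreover have "\<bar>\<phi> x\<bar> \<le> M" for x using B0(2)[of x] B1(1) B2(1) by (simp add: M_def)
  moreover have "\<bar>partial_deriv i \<phi> x\<bar> \<le> M" for i x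
    using B0(1) B1(1) B1(2)[of x] B2(1) B2(2)[of x] exhaust_2[of i] unfolding M_def by auto
  moreover have "0 < M" using B0 B1 B2 by (simp add: M_def)
  ultimately show thesis by (intro that[OF R(1), of M]) (use out in blast)+
qed

lemma integrable_bounded_support:
  fixes f :: "'a::euclidean_space \<Rightarrow> real"
  assumes [measurable]: "f \<in> borel_measurable borel"
    and "\<And>x. \<bar>f x\<bar> \<le> B" "\<And>x. x \<notin> cball 0 R \<Longrightarrow> f x = 0"
  shows "integrable lborel f"
  by (rule integrableI_bounded_set[where A = "cball 0 R" and B = B])
    (use assms emeasure_lborel_cball_finite[of 0 R] in auto)

lemma lborel_integral_translation:
  fixes f :: "plane \<Rightarrow> real"
  assumes [measurable]: "f \<in> borel_measurable borel"
  shows "(\<integral>x. f (x + c) \<partial>lborel) = (\<integral>x. f x \<partial>lborel)"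
proof -
  have "(\<integral>x. f x \<partial>lborel) = (\<integral>x. f x \<partial>(distr lborel borel ((+) c)))"
    by (simp add: lborel_distr_plus)
  also have "\<dots> = (\<integral>x. f (c + x) \<partial>lborel)"
    by (rule integral_distr) auto
  finally show ?thesis by (simp add: add.commute)
qed

lemma negligible_AE_lborel:
  assumes "negligible {x. \<not> P x}"
  shows "AE x in lborel. P (x::'a::euclidean_space)"
proof -
  have "{x. \<not> P x} \<in> null_sets (completion lborel)" using assms by (simp add: negligible_iff_null_sets)
  then obtain N where "N \<in> null_sets lborel" "{x. \<not> P x} \<subseteq> N"
    unfolding null_sets_completion_iff2 by blast
  then show ?thesis by (intro AE_I'[of N]) auto
qed

text \<open>\<open>G\<close> is an everywhere defined bounded Borel representative of the gradient
  of a Lipschitz function \<open>u\<close>. The almost everywhere derivative belongs to the data, so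
  that sums, translates and glued functions come with an explicit gradient.\<close>

definition is_potential :: "(plane \<Rightarrow> real) \<Rightarrow> (plane \<Rightarrow> plane) \<Rightarrow> bool" where
  "is_potential u G \<longleftrightarrow> (\<exists>L. L-lipschitz_on UNIV u) \<and> G \<in> borel_measurable borel \<and>
     (\<exists>B. \<forall>x. norm (G x) \<le> B) \<and> negligible {x. \<not> (u has_derivative (\<lambda>h. G x \<bullet> h)) (at x)}"

lemma is_potential_measurable [measurable_dest]:
  assumes "is_potential u G"
  shows "G \<in> borel_measurable borel" "u \<in> borel_measurable borel"
proof -
  obtain L where "L-lipschitz_on UNIV u" using assms by (auto simp: is_potential_def)
  then show "u \<in> borel_measurable borel"
    by (intro borel_measurable_continuous_onI lipschitz_on_continuous_on)
qed (use assms in \<open>simp add: is_potential_def\<close>)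

lemma borel_measurable_vec_nth [measurable (raw)]:
  fixes f :: "'a \<Rightarrow> real^'n"
  assumes "f \<in> borel_measurable M"
  shows "(\<lambda>x. f x $ i) \<in> borel_measurable M"
  using measurable_compose[OF assms borel_measurable_continuous_onI[of "\<lambda>v. v $ i"]]
  by (simp add: continuous_on_component)

lemma difference_quotient_tendsto:
  fixes f :: "plane \<Rightarrow> real"
  assumes "(f has_derivative D) (at x)"
  shows "(\<lambda>n. real (Suc n) * (f (x + (1 / real (Suc n)) *\<^sub>R v) - f x)) \<longlonglongrightarrow> D v"
proof -
  have "((\<lambda>t. f (x + t *\<^sub>R v)) has_derivative (\<lambda>t. D (t *\<^sub>R v))) (at 0)"
  proof -
    have "((\<lambda>t::real. x + t *\<^sub>R v) has_derivative (\<lambda>t. t *\<^sub>R v)) (at 0)"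
      by (auto intro!: derivative_eq_intros)
    moreover have "(f has_derivative D) (at (x + 0 *\<^sub>R v))" using assms by simp
    ultimately show ?thesis using has_derivative_compose by fast
  qed
  moreover have "(\<lambda>t. D (t *\<^sub>R v)) = (*) (D v)"
    using linear_scale[OF has_derivative_linear[OF assms]] by (auto simp: fun_eq_iff)
  ultimately have "((\<lambda>t. f (x + t *\<^sub>R v)) has_field_derivative D v) (at 0)"
    by (simp add: has_field_derivative_def)
  then have "((\<lambda>t. (f (x + t *\<^sub>R v) - f x) / t) \<longlongrightarrow> D v) (at 0)"
    by (simp add: has_field_derivative_iff)
  moreover have "filterlim (\<lambda>n. 1 / real (Suc n)) (at 0) sequentially"
    unfolding filterlim_at using LIMSEQ_inverse_real_of_nat by (simp add: inverse_eq_divide)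
  ultimately have "(\<lambda>n. (f (x + (1 / real (Suc n)) *\<^sub>R v) - f x) / (1 / real (Suc n))) \<longlonglongrightarrow> D v"
    by (rule filterlim_compose)
  then show ?thesis by (simp add: mult.commute)
qed

text \<open>The difference quotients are dominated by the Lipschitz constant times
  \<open>norm v\<close>, and they converge wherever \<open>u\<close> is differentiable.\<close>

lemma integral_difference_quotient_potential:
  assumes u: "is_potential u G"
    and \<psi>: "\<psi> \<in> borel_measurable borel" "\<And>x. \<bar>\<psi> x\<bar> \<le> M" "\<And>x. x \<notin> cball 0 R \<Longrightarrow> \<psi> x = 0"
  shows "(\<lambda>n. \<integral>x. real (Suc n) * (u (x + (1 / real (Suc n)) *\<^sub>R v) - u x) * \<psi> x \<partial>lborel)
    \<longlonglongrightarrow> (\<integral>x. (G x \<bullet> v) * \<psi> x \<partial>lborel)"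
proof -
  obtain L where L: "L-lipschitz_on UNIV u" using u by (auto simp: is_potential_def)
  have [measurable]: "u \<in> borel_measurable borel" "G \<in> borel_measurable borel" "\<psi> \<in> borel_measurable borel"
    using is_potential_measurable[OF u] \<psi>(1) by auto
  have L0: "0 \<le> L" using L lipschitz_on_nonneg by blast
  have M0: "0 \<le> M" using \<psi>(2)[of 0] by linarith
  show ?thesis
  proof (rule integral_dominated_convergence[where w = "\<lambda>x. L * norm v * M * indicator (cball 0 R) x"])
    show "integrable lborel (\<lambda>x::plane. L * norm v * M * indicator (cball 0 R) x)"
      by (rule integrable_bounded_support[where B = "L * norm v * M" and R = R])
        (use L0 M0 in \<open>auto simp: indicator_def\<close>)
    show "AE x in lborel. (\<lambda>n. real (Suc n) * (u (x + (1 / real (Suc n)) *\<^sub>R v) - u x) * \<psi> x)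
        \<longlonglongrightarrow> (G x \<bullet> v) * \<psi> x"
    proof -
      have "AE x in lborel. (u has_derivative (\<lambda>h. G x \<bullet> h)) (at x)"
        using u by (intro negligible_AE_lborel) (simp add: is_potential_def)
      then show ?thesis
        by eventually_elim (intro tendsto_mult tendsto_const difference_quotient_tendsto)
    qed
    show "AE x in lborel. norm (real (Suc n) * (u (x + (1 / real (Suc n)) *\<^sub>R v) - u x) * \<psi> x)
        \<le> L * norm v * M * indicator (cball 0 R) x" for n
    proof (rule AE_I2)
      fix x
      have "\<bar>u (x + (1 / real (Suc n)) *\<^sub>R v) - u x\<bar> \<le> L * norm ((1 / real (Suc n)) *\<^sub>R v)"
        using lipschitz_onD[OF L, of "x + (1 / real (Suc n)) *\<^sub>R v" x] by (simp add: dist_norm)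
      then have "real (Suc n) * \<bar>u (x + (1 / real (Suc n)) *\<^sub>R v) - u x\<bar> \<le> L * norm v"
        by (simp add: field_simps)
      then have "real (Suc n) * \<bar>u (x + (1 / real (Suc n)) *\<^sub>R v) - u x\<bar> * \<bar>\<psi> x\<bar> \<le> L * norm v * M"
        by (rule mult_mono[OF _ \<psi>(2)]) (use L0 in auto)
      then show "norm (real (Suc n) * (u (x + (1 / real (Suc n)) *\<^sub>R v) - u x) * \<psi> x)
        \<le> L * norm v * M * indicator (cball 0 R) x"
        using \<psi>(3)[of x] by (cases "x \<in> cball 0 R") (auto simp: abs_mult)
    qed
  qed measurable
qed

lemma C1_compact_potential:
  assumes \<phi>: "C1_compact \<phi>"
  shows "is_potential \<phi> (\<lambda>x. \<chi> i. partial_deriv i \<phi> x)"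
proof -
  obtain R M where M: "0 < M" "\<And>x i. \<bar>partial_deriv i \<phi> x\<bar> \<le> M"
    "\<And>x y. \<bar>\<phi> x - \<phi> y\<bar> \<le> M * norm (x - y)"
    using C1_compact_bounds[OF \<phi>] by metis
  have "M-lipschitz_on UNIV \<phi>"
    using M by (intro lipschitz_onI) (auto simp: dist_norm)
  moreover have "(\<lambda>x. \<chi> i. partial_deriv i \<phi> x) \<in> borel_measurable borel"
    using C1_compact_continuous[OF \<phi>]
    by (intro borel_measurable_continuous_onI continuous_on_vec_lambda) auto
  moreover have "norm (\<chi> i. partial_deriv i \<phi> x) \<le> 2 * M" for x
  proof -
    have "norm (\<chi> i. partial_deriv i \<phi> x) \<le> (\<Sum>i\<in>UNIV. \<bar>partial_deriv i \<phi> x\<bar>)"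
      using norm_le_l1_cart[of "\<chi> i. partial_deriv i \<phi> x"] by simp
    also have "\<dots> \<le> 2 * M" using M(2)[of 1 x] M(2)[of 2 x] by (simp add: UNIV_2)
    finally show ?thesis .
  qed
  moreover have "(\<phi> has_derivative (\<lambda>h. (\<chi> i. partial_deriv i \<phi> x) \<bullet> h)) (at x)" for x
    using C1_compact_has_derivative[OF \<phi>, of x] by (simp add: inner_vec_def mult.commute)
  ultimately show ?thesis
    unfolding is_potential_def by auto
qed

lemma integrable_mult_support:
  fixes w g :: "plane \<Rightarrow> real"
  assumes [measurable]: "w \<in> borel_measurable borel" "g \<in> borel_measurable borel"
    and w: "\<And>x. x \<in> cball 0 R \<Longrightarrow> \<bar>w x\<bar> \<le> B" and g: "\<And>x. \<bar>g x\<bar> \<le> M" "\<And>x. x \<notin> cball 0 R \<Longrightarrow> g x = 0"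
  shows "integrable lborel (\<lambda>x. w x * g x)"
proof (rule integrable_bounded_support[where B = "\<bar>B\<bar> * \<bar>M\<bar>" and R = R])
  show "\<bar>w x * g x\<bar> \<le> \<bar>B\<bar> * \<bar>M\<bar>" for x
  proof (cases "x \<in> cball 0 R")
    case True
    have "\<bar>w x\<bar> \<le> \<bar>B\<bar>" "\<bar>g x\<bar> \<le> \<bar>M\<bar>" using w[OF True] g(1)[of x] by linarith+
    then show ?thesis unfolding abs_mult by (rule mult_mono) auto
  qed (simp add: g(2))
qed (use g(2) in auto)

lemma continuous_bounded_on_cball:
  fixes w :: "plane \<Rightarrow> real"
  assumes "continuous_on UNIV w"
  obtains B where "0 < B" "\<And>x. x \<in> cball 0 R \<Longrightarrow> \<bar>w x\<bar> \<le> B"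
proof -
  have "compact (w ` cball 0 R)"
    by (intro compact_continuous_image continuous_on_subset[OF assms]) auto
  then show thesis
    using that bounded_pos[of "w ` cball 0 R"] compact_imp_bounded by auto
qed

lemma is_potential_continuous: "is_potential u G \<Longrightarrow> continuous_on UNIV u"
  unfolding is_potential_def using lipschitz_on_continuous_on by blast

text \<open>The same limit with the roles exchanged: the quotients fall on the test function, which
  is itself a potential, and the weight \<open>w\<close>, cut off to a ball, takes the place of the
  test function. So \<open>w\<close> needs no regularity.\<close>

lemma difference_quotient_C1_compact_tendsto:
  assumes \<psi>: "C1_compact \<psi>" "\<And>x. x \<notin> cball 0 R \<Longrightarrow> \<psi> x = 0" and v: "norm v \<le> 1"
    and w: "w \<in> borel_measurable borel" "\<And>x. x \<in> cball 0 (R + 1) \<Longrightarrow> \<bar>w x\<bar> \<le> B"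
  shows "(\<lambda>n. \<integral>x. w x * (real (Suc n) * (\<psi> (x + (1 / real (Suc n)) *\<^sub>R v) - \<psi> x)) \<partial>lborel)
    \<longlonglongrightarrow> (\<integral>x. w x * (\<Sum>i\<in>UNIV. v $ i * partial_deriv i \<psi> x) \<partial>lborel)"
proof -
  \<comment> \<open>The margin 1 absorbs the shifts, which have norm at most
    \<open>norm v \<le> 1\<close>.\<close>
  define K :: "plane set" where "K = cball 0 (R + 1)"
  have shift: "\<psi> (x + (1 / real (Suc n)) *\<^sub>R v) = 0" if "x \<notin> K" for x n
  proof (rule \<psi>(2))
    have "norm ((1 / real (Suc n)) *\<^sub>R v) \<le> 1" using v by (simp add: field_simps)
    then show "x + (1 / real (Suc n)) *\<^sub>R v \<notin> cball 0 R"
      using that norm_diff_ineq[of x "(1 / real (Suc n)) *\<^sub>R v"] unfolding K_def mem_cball_0 by linarith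
  qed
  have zero: "\<psi> x = 0" "partial_deriv i \<psi> x = 0" if "x \<notin> K" for x i
  proof -
    show "\<psi> x = 0" using that by (intro \<psi>(2)) (auto simp: K_def)
    have "closure {x. \<psi> x \<noteq> 0} \<subseteq> cball 0 R"
      using \<psi>(2) by (intro closure_minimal) (blast, rule closed_cball)
    then show "partial_deriv i \<psi> x = 0"
      using that by (intro partial_deriv_zero_outside) (auto simp: K_def)
  qed
  have lim: "(\<lambda>n. \<integral>x. real (Suc n) * (\<psi> (x + (1 / real (Suc n)) *\<^sub>R v) - \<psi> x) * (indicator K x * w x) \<partial>lborel)
    \<longlonglongrightarrow> (\<integral>x. ((\<chi> i. partial_deriv i \<psi> x) \<bullet> v) * (indicator K x * w x) \<partial>lborel)"
  proof (rule integral_difference_quotient_potential[OF C1_compact_potential[OF \<psi>(1)], where M = "\<bar>B\<bar>" and R = "R + 1"])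
    show "(\<lambda>x. indicator K x * w x) \<in> borel_measurable borel" 
      by (intro borel_measurable_times borel_measurable_indicator w(1)) (simp add: K_def)
    show "\<bar>indicator K x * w x\<bar> \<le> \<bar>B\<bar>" for x
      using w(2)[of x] by (cases "x \<in> K") (auto simp: K_def)
  qed (simp add: K_def)
  have eq1: "real (Suc n) * (\<psi> (x + (1 / real (Suc n)) *\<^sub>R v) - \<psi> x) * (indicator K x * w x)
      = w x * (real (Suc n) * (\<psi> (x + (1 / real (Suc n)) *\<^sub>R v) - \<psi> x))" for n x
    by (cases "x \<in> K") (simp_all add: shift zero del: of_nat_Suc)
  have eq2: "((\<chi> i. partial_deriv i \<psi> x) \<bullet> v) * (indicator K x * w x)
      = w x * (\<Sum>i\<in>UNIV. v $ i * partial_deriv i \<psi> x)" for x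
    by (cases "x \<in> K") (simp_all add: zero inner_vec_def mult.commute)
  show ?thesis using lim unfolding eq1 eq2 .
qed

text \<open>Translation invariance of Lebesgue measure moves a difference quotient from
  \<open>\<psi>\<close> to \<open>u\<close> at the price of reversing the direction. Both sides then
  converge, the left one because \<open>\<psi>\<close> is smooth and the right one because
  \<open>u\<close> is Lipschitz.\<close>

lemma integration_by_parts_potential:
  assumes u: "is_potential u G" and \<psi>: "C1_compact \<psi>"
  shows "(\<integral>x. u x * partial_deriv j \<psi> x \<partial>lborel) = - (\<integral>x. G x $ j * \<psi> x \<partial>lborel)"
proof -
  obtain R M where M: "\<And>x. \<bar>\<psi> x\<bar> \<le> M" "\<And>x. x \<notin> cball 0 R \<Longrightarrow> \<psi> x = 0"
    using C1_compact_bounds[OF \<psi>] by metis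
  note cu = is_potential_continuous[OF u]
  have [measurable]: "u \<in> borel_measurable borel" "G \<in> borel_measurable borel" "\<psi> \<in> borel_measurable borel"
    using is_potential_measurable[OF u] C1_compact_measurable[OF \<psi>] by auto
  obtain B where B: "\<And>x. x \<in> cball 0 (R + 1) \<Longrightarrow> \<bar>u x\<bar> \<le> B"
    using continuous_bounded_on_cball[OF cu] by metis
  define e :: plane where "e = axis j 1"
  have e: "norm e = 1" by (simp add: e_def)
  have "(\<Sum>i\<in>UNIV. e $ i * partial_deriv i \<psi> x) = partial_deriv j \<psi> x" for x
    by (simp add: e_def axis_def if_distrib[of "\<lambda>c. c * _"] cong: if_cong)
  then have 1: "(\<lambda>n. \<integral>x. u x * (real (Suc n) * (\<psi> (x + (1 / real (Suc n)) *\<^sub>R e) - \<psi> x)) \<partial>lborel)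
      \<longlonglongrightarrow> (\<integral>x. u x * partial_deriv j \<psi> x \<partial>lborel)"
    using difference_quotient_C1_compact_tendsto[OF \<psi> M(2), where v = e and w = u and B = B] B e by simp
  have 2: "(\<integral>x. u x * (real (Suc n) * (\<psi> (x + (1 / real (Suc n)) *\<^sub>R e) - \<psi> x)) \<partial>lborel)
    = (\<integral>x. real (Suc n) * (u (x + (1 / real (Suc n)) *\<^sub>R (- e)) - u x) * \<psi> x \<partial>lborel)" for n
  proof -
    define c where "c = (1 / real (Suc n)) *\<^sub>R e"
    have c: "norm c \<le> 1" using e by (simp add: c_def)
    have int: "integrable lborel (\<lambda>x. w x * \<psi> x)" if w: "continuous_on UNIV w" for w
    proof -
      obtain B' where "\<And>x. x \<in> cball 0 R \<Longrightarrow> \<bar>w x\<bar> \<le> B'"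
        using continuous_bounded_on_cball[OF w] by metis
      then show ?thesis
        using w M by (intro integrable_mult_support[where R = R]) (auto intro: borel_measurable_continuous_onI)
    qed
    have "continuous_on UNIV (\<lambda>x. u (x - c))"
      by (intro continuous_on_compose2[OF cu]) (auto intro!: continuous_intros)
    note i = int[OF this] int[OF cu]
    have "integrable lborel (\<lambda>x. u x * \<psi> (x + c))"
    proof (rule integrable_mult_support[where R = "R + 1" and B = B and M = M])
      show "\<psi> (x + c) = 0" if "x \<notin> cball 0 (R + 1)" for x
        using that c norm_diff_ineq[of x c] unfolding mem_cball_0 by (intro M(2)) simp
    qed (use B M in auto)
    moreover have "(\<integral>x. u x * \<psi> (x + c) \<partial>lborel) = (\<integral>x. u (x - c) * \<psi> x \<partial>lborel)"
      using lborel_integral_translation[of "\<lambda>x. u (x - c) * \<psi> x" c] by simp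
    ultimately have "(\<integral>x. u x * \<psi> (x + c) - u x * \<psi> x \<partial>lborel) = (\<integral>x. u (x - c) * \<psi> x - u x * \<psi> x \<partial>lborel)"
      using i by simp
    then have "(\<integral>x. real (Suc n) * (u x * \<psi> (x + c) - u x * \<psi> x) \<partial>lborel)
      = (\<integral>x. real (Suc n) * (u (x - c) * \<psi> x - u x * \<psi> x) \<partial>lborel)"
      by (simp only: integral_mult_right_zero)
    then show ?thesis by (simp add: c_def algebra_simps)
  qed
  have 3: "(\<lambda>n. \<integral>x. real (Suc n) * (u (x + (1 / real (Suc n)) *\<^sub>R (- e)) - u x) * \<psi> x \<partial>lborel)
      \<longlonglongrightarrow> (\<integral>x. (G x \<bullet> (- e)) * \<psi> x \<partial>lborel)"
    by (rule integral_difference_quotient_potential[OF u _ M]) simp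
  have "(\<integral>x. u x * partial_deriv j \<psi> x \<partial>lborel) = (\<integral>x. (G x \<bullet> (- e)) * \<psi> x \<partial>lborel)"
    using LIMSEQ_unique[OF 1] 2 3 by simp
  also have "\<dots> = - (\<integral>x. G x $ j * \<psi> x \<partial>lborel)"
    by (simp add: e_def inner_axis)
  finally show ?thesis .
qed

section \<open>Operations on potentials and the curl identity\<close>

lemma is_potential_translate:
  assumes "is_potential u G"
  shows "is_potential (\<lambda>x. u (x - c)) (\<lambda>x. G (x - c))"
proof -
  obtain L B where L: "L-lipschitz_on UNIV u" and B: "\<And>x. norm (G x) \<le> B"
    and N: "negligible {x. \<not> (u has_derivative (\<lambda>h. G x \<bullet> h)) (at x)}"
    using assms by (auto simp: is_potential_def)
  have [measurable]: "G \<in> borel_measurable borel" using assms by (simp add: is_potential_def)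
  have "L-lipschitz_on UNIV (\<lambda>x. u (x - c))"
  proof (rule lipschitz_onI)
    show "dist (u (x - c)) (u (y - c)) \<le> L * dist x y" for x y
      using lipschitz_onD[OF L, of "x - c" "y - c"] by (simp add: dist_norm)
  qed (rule lipschitz_on_nonneg[OF L])
  moreover have "negligible {x. \<not> ((\<lambda>x. u (x - c)) has_derivative (\<lambda>h. G (x - c) \<bullet> h)) (at x)}"
  proof (rule negligible_subset[OF negligible_translation[OF N, of c]], rule subsetI)
    fix x assume x: "x \<in> {x. \<not> ((\<lambda>x. u (x - c)) has_derivative (\<lambda>h. G (x - c) \<bullet> h)) (at x)}"
    have "\<not> (u has_derivative (\<lambda>h. G (x - c) \<bullet> h)) (at (x - c))"
    proof
      assume d: "(u has_derivative (\<lambda>h. G (x - c) \<bullet> h)) (at (x - c))"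
      have "((\<lambda>x. x - c) has_derivative (\<lambda>h. h)) (at x)" by (auto intro!: derivative_eq_intros)
      from has_derivative_compose[OF this d] show False using x by simp
    qed
    then show "x \<in> (+) c ` {x. \<not> (u has_derivative (\<lambda>h. G x \<bullet> h)) (at x)}"
      by (intro image_eqI[of _ _ "x - c"]) auto
  qed
  ultimately show ?thesis using B by (auto simp: is_potential_def)
qed

lemma is_potential_add:
  assumes "is_potential u G" "is_potential v H"
  shows "is_potential (\<lambda>x. u x + v x) (\<lambda>x. G x + H x)"
proof -
  obtain L B where L: "L-lipschitz_on UNIV u" and B: "\<And>x. norm (G x) \<le> B"
    and N: "negligible {x. \<not> (u has_derivative (\<lambda>h. G x \<bullet> h)) (at x)}"
    using assms by (auto simp: is_potential_def)
  obtain L' B' where L': "L'-lipschitz_on UNIV v" and B': "\<And>x. norm (H x) \<le> B'"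
    and N': "negligible {x. \<not> (v has_derivative (\<lambda>h. H x \<bullet> h)) (at x)}"
    using assms by (auto simp: is_potential_def)
  have [measurable]: "G \<in> borel_measurable borel" "H \<in> borel_measurable borel"
    using assms by (auto simp: is_potential_def)
  have "negligible {x. \<not> ((\<lambda>x. u x + v x) has_derivative (\<lambda>h. (G x + H x) \<bullet> h)) (at x)}"
    by (rule negligible_subset[OF negligible_Un[OF N N']])
      (auto simp: inner_add_left intro: has_derivative_add)
  moreover have "norm (G x + H x) \<le> B + B'" for x
    using norm_triangle_mono[OF B B'] .
  ultimately show ?thesis
    using lipschitz_on_add[OF L L'] by (auto simp: is_potential_def)
qed

lemma is_potential_uminus:
  assumes "is_potential u G"
  shows "is_potential (\<lambda>x. - u x) (\<lambda>x. - G x)"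
proof -
  obtain L B where L: "L-lipschitz_on UNIV u" and B: "\<And>x. norm (G x) \<le> B"
    and N: "negligible {x. \<not> (u has_derivative (\<lambda>h. G x \<bullet> h)) (at x)}"
    using assms by (auto simp: is_potential_def)
  have [measurable]: "G \<in> borel_measurable borel"
    using assms by (auto simp: is_potential_def)
  have "negligible {x. \<not> ((\<lambda>x. - u x) has_derivative (\<lambda>h. (- G x) \<bullet> h)) (at x)}"
    by (rule negligible_subset[OF N]) (auto intro: has_derivative_minus)
  moreover have "L-lipschitz_on UNIV (\<lambda>x. - u x)" using L by simp
  ultimately show ?thesis
    using B by (auto simp: is_potential_def)
qed

lemma is_potential_zero: "is_potential (\<lambda>x. 0) (\<lambda>x. 0)"
  by (auto simp: is_potential_def intro: lipschitz_on_constant)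

lemma is_potential_sum:
  assumes "finite I" "\<And>i. i \<in> I \<Longrightarrow> is_potential (u i) (G i)"
  shows "is_potential (\<lambda>x. \<Sum>i\<in>I. u i x) (\<lambda>x. \<Sum>i\<in>I. G i x)"
  using assms by (induction I) (auto intro: is_potential_zero is_potential_add)

text \<open>
  Integrating by parts a difference quotient of \<open>u\<close> moves both derivatives to where they exist, so
  that test functions need only one derivative.
\<close>

lemma potential_curl_free:
  assumes u: "is_potential u G" and \<phi>: "C1_compact \<phi>"
  shows "(\<integral>x. G x $ 1 * partial_deriv 2 \<phi> x \<partial>lborel) = (\<integral>x. G x $ 2 * partial_deriv 1 \<phi> x \<partial>lborel)"
proof -
  obtain R M where M: "\<And>x. \<bar>\<phi> x\<bar> \<le> M" "\<And>x i. \<bar>partial_deriv i \<phi> x\<bar> \<le> M"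
    "\<And>x. x \<notin> cball 0 R \<Longrightarrow> \<phi> x = 0" "\<And>x i. x \<notin> cball 0 R \<Longrightarrow> partial_deriv i \<phi> x = 0"
    using C1_compact_bounds[OF \<phi>] by metis
  obtain B where B: "\<And>x. norm (G x) \<le> B" using u by (auto simp: is_potential_def)
  note cu = is_potential_continuous[OF u]
  have [measurable]: "u \<in> borel_measurable borel" "G \<in> borel_measurable borel" "\<phi> \<in> borel_measurable borel"
    "\<And>j. partial_deriv j \<phi> \<in> borel_measurable borel"
    using is_potential_measurable[OF u] C1_compact_measurable[OF \<phi>] by auto
  define e :: plane where "e = axis 1 1"
  have e: "norm e = 1" by (simp add: e_def)
  have G2: "\<bar>G x $ 2\<bar> \<le> B" for x using B[of x] component_le_norm_cart order_trans by blast
  have 1: "(\<lambda>n. \<integral>x. real (Suc n) * (u (x + (1 / real (Suc n)) *\<^sub>R e) - u x) * partial_deriv 2 \<phi> x \<partial>lborel)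
      \<longlonglongrightarrow> (\<integral>x. (G x \<bullet> e) * partial_deriv 2 \<phi> x \<partial>lborel)"
    by (rule integral_difference_quotient_potential[OF u _ M(2,4)]) simp
  have 2: "(\<integral>x. real (Suc n) * (u (x + (1 / real (Suc n)) *\<^sub>R e) - u x) * partial_deriv 2 \<phi> x \<partial>lborel)
    = - (\<integral>x. G x $ 2 * (real (Suc n) * (\<phi> (x + (1 / real (Suc n)) *\<^sub>R (- e)) - \<phi> x)) \<partial>lborel)" for n
  proof -
    define c where "c = (1 / real (Suc n)) *\<^sub>R e"
    have c: "norm c \<le> 1" using e by (simp add: c_def)
    have int: "integrable lborel (\<lambda>x. w x * partial_deriv 2 \<phi> x)" if w: "continuous_on UNIV w" for w
    proof -
      obtain B' where "\<And>x. x \<in> cball 0 R \<Longrightarrow> \<bar>w x\<bar> \<le> B'"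
        using continuous_bounded_on_cball[OF w] by metis
      then show ?thesis
        using w M by (intro integrable_mult_support[where R = R]) (auto intro: borel_measurable_continuous_onI)
    qed
    have intG: "integrable lborel (\<lambda>x. G x $ 2 * \<phi> x)"
      using G2 M by (intro integrable_mult_support[where R = R]) auto
    have intG': "integrable lborel (\<lambda>x. G x $ 2 * \<phi> (x - c))"
    proof (rule integrable_mult_support[where R = "R + 1" and B = B and M = M])
      show "\<phi> (x - c) = 0" if "x \<notin> cball 0 (R + 1)" for x
        using that c norm_triangle_ineq2[of x c] unfolding mem_cball_0 by (intro M(3)) simp
    qed (use G2 M in auto)
    have tr: "is_potential (\<lambda>x. u (x + c)) (\<lambda>x. G (x + c))"
      using is_potential_translate[OF u, of "- c"] by simp
    have "(\<integral>x. u (x + c) * partial_deriv 2 \<phi> x \<partial>lborel) = - (\<integral>x. G (x + c) $ 2 * \<phi> x \<partial>lborel)"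
      by (rule integration_by_parts_potential[OF tr \<phi>])
    also have "(\<integral>x. G (x + c) $ 2 * \<phi> x \<partial>lborel) = (\<integral>x. G x $ 2 * \<phi> (x - c) \<partial>lborel)"
      using lborel_integral_translation[of "\<lambda>x. G x $ 2 * \<phi> (x - c)" c] by simp
    finally have a: "(\<integral>x. u (x + c) * partial_deriv 2 \<phi> x \<partial>lborel) = - (\<integral>x. G x $ 2 * \<phi> (x - c) \<partial>lborel)" .
    have b: "(\<integral>x. u x * partial_deriv 2 \<phi> x \<partial>lborel) = - (\<integral>x. G x $ 2 * \<phi> x \<partial>lborel)"
      by (rule integration_by_parts_potential[OF u \<phi>])
    have "(\<integral>x. u (x + c) * partial_deriv 2 \<phi> x - u x * partial_deriv 2 \<phi> x \<partial>lborel)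
      = - (\<integral>x. G x $ 2 * \<phi> (x - c) - G x $ 2 * \<phi> x \<partial>lborel)"
      using int[OF is_potential_continuous[OF tr]] int[OF cu] intG intG' a b by simp
    then have "(\<integral>x. real (Suc n) * (u (x + c) * partial_deriv 2 \<phi> x - u x * partial_deriv 2 \<phi> x) \<partial>lborel)
      = - (\<integral>x. real (Suc n) * (G x $ 2 * \<phi> (x - c) - G x $ 2 * \<phi> x) \<partial>lborel)"
      by (simp only: integral_mult_right_zero mult_minus_right)
    then show ?thesis by (simp add: c_def algebra_simps)
  qed
  have "(\<Sum>i\<in>UNIV. (- e) $ i * partial_deriv i \<phi> x) = - partial_deriv 1 \<phi> x" for x
    by (simp add: e_def axis_def UNIV_2)
  then have 3: "(\<lambda>n. \<integral>x. G x $ 2 * (real (Suc n) * (\<phi> (x + (1 / real (Suc n)) *\<^sub>R (- e)) - \<phi> x)) \<partial>lborel)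
      \<longlonglongrightarrow> (\<integral>x. G x $ 2 * (- partial_deriv 1 \<phi> x) \<partial>lborel)"
    using difference_quotient_C1_compact_tendsto[OF \<phi> M(3), where v = "- e" and w = "\<lambda>x. G x $ 2" and B = B] G2 e by simp
  have "(\<integral>x. (G x \<bullet> e) * partial_deriv 2 \<phi> x \<partial>lborel) = - (\<integral>x. G x $ 2 * (- partial_deriv 1 \<phi> x) \<partial>lborel)"
    using LIMSEQ_unique[OF 1] tendsto_minus[OF 3] unfolding 2 by blast
  then show ?thesis by (simp add: e_def inner_axis)
qed

section \<open>Rotation of gradients and gluing of potentials\<close>

definition rot :: "plane \<Rightarrow> plane" where
  "rot v = vector [- v $ 2, v $ 1]"

lemma rot_component [simp]: "rot v $ 1 = - v $ 2" "rot v $ 2 = v $ 1"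
  by (simp_all add: rot_def)

lemma rot_diff: "rot v - rot w = rot (v - w)"
  by (simp add: vec_eq_iff forall_2)

lemma norm_rot [simp]: "norm (rot v) = norm v"
  by (simp add: norm_eq_sqrt_inner inner_vec_def UNIV_2)

lemma continuous_rot: "continuous_on UNIV rot"
proof -
  have "1-lipschitz_on UNIV rot"
    by (intro lipschitz_onI) (auto simp: dist_norm rot_diff)
  then show ?thesis by (rule lipschitz_on_continuous_on)
qed

lemma rot_measurable [measurable (raw)]:
  "f \<in> borel_measurable M \<Longrightarrow> (\<lambda>x. rot (f x)) \<in> borel_measurable M"
  using measurable_compose[OF _ borel_measurable_continuous_onI[OF continuous_rot]] .

lemma set_integral_lebesgue_eq_lborel:
  fixes g :: "plane \<Rightarrow> real"
  assumes "g \<in> borel_measurable borel" "\<And>x. x \<notin> \<Omega> \<Longrightarrow> g x = 0"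
  shows "(LINT x:\<Omega>|lebesgue. g x) = (\<integral>x. g x \<partial>lborel)"
proof -
  have "(LINT x:\<Omega>|lebesgue. g x) = (\<integral>x. g x \<partial>lebesgue)"
    unfolding set_lebesgue_integral_def
    by (intro Bochner_Integration.integral_cong refl) (auto simp: indicator_def assms(2))
  then show ?thesis using assms(1) by (simp add: integral_completion)
qed

text \<open>Tested with a gradient, the divergence of \<open>rot G\<close> is the curl identity for
  \<open>G\<close>. Agreement on \<open>\<Omega>\<close> is enough because the derivatives of the
  test function vanish elsewhere.\<close>

lemma potential_divergence_free:
  assumes u: "is_potential u G" and m: "\<And>x. x \<in> \<Omega> \<Longrightarrow> m x = rot (G x)"
  shows "divergence_free \<Omega> m"
  unfolding divergence_free_def
proof
  fix \<phi> assume \<phi>: "\<phi> \<in> test_Cinf \<Omega>"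
  note C = test_Cinf_compact[OF \<phi>]
  obtain R M where M: "0 < R" "0 < M" "\<And>x. \<bar>\<phi> x\<bar> \<le> M" "\<And>x i. \<bar>partial_deriv i \<phi> x\<bar> \<le> M"
    "\<And>x. x \<notin> cball 0 R \<Longrightarrow> \<phi> x = 0" "\<And>x i. x \<notin> cball 0 R \<Longrightarrow> partial_deriv i \<phi> x = 0"
    using C1_compact_bounds[OF C] by metis
  obtain B where B: "\<And>x. norm (G x) \<le> B" using u by (auto simp: is_potential_def)
  have B0: "0 \<le> B" using B[of 0] norm_ge_zero order_trans by blast
  have Gi: "\<bar>G x $ i\<bar> \<le> B" for x i using B[of x] component_le_norm_cart order_trans by blast
  have [measurable]: "G \<in> borel_measurable borel" "\<And>j. partial_deriv j \<phi> \<in> borel_measurable borel"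
    using is_potential_measurable[OF u] C1_compact_measurable[OF C] by auto
  have int: "integrable lborel (\<lambda>x. G x $ i * partial_deriv j \<phi> x)" for i j
  proof (rule integrable_bounded_support[where B = "B * M" and R = R])
    show "\<bar>G x $ i * partial_deriv j \<phi> x\<bar> \<le> B * M" for x
      using Gi[of x i] B0 M(4)[of j x] by (auto simp: abs_mult intro!: mult_mono)
  qed (use M in auto)
  have "(LINT x:\<Omega>|lebesgue. (\<Sum>i\<in>UNIV. m x $ i * partial_deriv i \<phi> x))
      = (LINT x:\<Omega>|lebesgue. (G x $ 1 * partial_deriv 2 \<phi> x - G x $ 2 * partial_deriv 1 \<phi> x))"
    unfolding set_lebesgue_integral_def
    by (intro Bochner_Integration.integral_cong refl) (auto simp: indicator_def m UNIV_2)
  also have "\<dots> = (\<integral>x. G x $ 1 * partial_deriv 2 \<phi> x - G x $ 2 * partial_deriv 1 \<phi> x \<partial>lborel)"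
    using \<phi> by (intro set_integral_lebesgue_eq_lborel) (auto simp: partial_deriv_zero_outside_test(1)[of \<phi> \<Omega>])
  also have "\<dots> = 0"
    using potential_curl_free[OF u C] by (simp add: int)
  finally show "(LINT x:\<Omega>|lebesgue. (\<Sum>i\<in>UNIV. m x $ i * partial_deriv i \<phi> x)) = 0" .
qed

text \<open>The gluing device for sectors and cells. A segment from a point of \<open>A\<close> to a
  point outside crosses the frontier, where \<open>h\<close> vanishes; hence the extension keeps the
  Lipschitz constant. Convexity of \<open>A\<close> makes the frontier negligible, so nothing has to
  be known about derivatives there.\<close>

lemma is_potential_extend_by_zero:
  assumes A: "closed A" "convex A" and h: "L-lipschitz_on A h" and fr: "\<And>x. x \<in> frontier A \<Longrightarrow> h x = 0"
    and G: "G \<in> borel_measurable borel" "\<And>x. norm (G x) \<le> B"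
    and d: "negligible {x \<in> interior A. \<not> (h has_derivative (\<lambda>y. G x \<bullet> y)) (at x)}"
  shows "is_potential (\<lambda>x. if x \<in> A then h x else 0) (\<lambda>x. if x \<in> A then G x else 0)"
proof -
  define g where "g x = (if x \<in> A then h x else 0)" for x
  have L0: "0 \<le> L" using h lipschitz_on_nonneg by blast
  have cross: "\<bar>h x\<bar> \<le> L * dist x y" if x: "x \<in> A" and y: "y \<notin> A" for x y
  proof -
    have "closed_segment x y \<inter> frontier A \<noteq> {}"
      by (rule connected_Int_frontier) (use x y in auto)
    then obtain z where z: "z \<in> closed_segment x y" "z \<in> frontier A" by blast
    have "z \<in> A" using z(2) A(1) by (simp add: frontier_def closure_closed)
    then have "\<bar>h x - h z\<bar> \<le> L * dist x z" using lipschitz_onD[OF h x] by (simp add: dist_norm)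
    also have "\<dots> \<le> L * dist x y"
      using dist_in_closed_segment[OF z(1)] L0 by (intro mult_left_mono) (auto simp: dist_commute)
    finally show ?thesis using fr[OF z(2)] by simp
  qed
  have "L-lipschitz_on UNIV g"
  proof (rule lipschitz_onI[OF _ L0])
    fix x y :: plane
    show "dist (g x) (g y) \<le> L * dist x y"
      using lipschitz_onD[OF h, of x y] cross[of x y] cross[of y x] L0
      by (auto simp: g_def dist_real_def dist_commute)
  qed
  moreover have "negligible {x. \<not> (g has_derivative (\<lambda>y. (if x \<in> A then G x else 0) \<bullet> y)) (at x)}"
  proof (rule negligible_subset[OF negligible_Un[OF d negligible_convex_frontier[OF A(2)]]], rule subsetI)
    fix x assume "x \<in> {x. \<not> (g has_derivative (\<lambda>y. (if x \<in> A then G x else 0) \<bullet> y)) (at x)}"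
    then have nd: "\<not> (g has_derivative (\<lambda>y. (if x \<in> A then G x else 0) \<bullet> y)) (at x)" by simp
    show "x \<in> {x \<in> interior A. \<not> (h has_derivative (\<lambda>y. G x \<bullet> y)) (at x)} \<union> frontier A"
    proof (rule ccontr)
      assume n: "\<not> ?thesis"
      consider "x \<in> interior A" | "x \<notin> A"
        using n A(1) by (auto simp: frontier_def closure_closed)
      then show False
      proof cases
        case 1
        then have "(h has_derivative (\<lambda>y. G x \<bullet> y)) (at x)" using n by blast
        then have "(g has_derivative (\<lambda>y. G x \<bullet> y)) (at x)"
          by (rule has_derivative_transform_within_open[OF _ open_interior 1])
            (use interior_subset[of A] in \<open>auto simp: g_def\<close>)
        then show False using nd 1 interior_subset[of A] by auto
      next
        case 2
        have "((\<lambda>x. 0) has_derivative (\<lambda>y. 0)) (at x)" by simp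
        then have "(g has_derivative (\<lambda>y. 0)) (at x)"
          by (rule has_derivative_transform_within_open[OF _ open_Compl[OF A(1)]])
            (use A 2 in \<open>auto simp: g_def\<close>)
        then show False using nd 2 by auto
      qed
    qed
  qed
  moreover have "(\<lambda>x. if x \<in> A then G x else 0) \<in> borel_measurable borel"
    using G(1) A(1) by (intro measurable_If_set) auto
  moreover have "norm (if x \<in> A then G x else 0) \<le> \<bar>B\<bar>" for x using G(2)[of x] by auto
  ultimately show ?thesis unfolding is_potential_def g_def by blast
qed

section \<open>Total variation of piecewise monotone functions\<close>

definition plane_line :: "2 \<Rightarrow> real \<Rightarrow> real \<Rightarrow> plane" where
  "plane_line j s t = (\<chi> i. if i = j then t else s)"

lemma plane_line_component: "plane_line j s t $ i = (if i = j then t else s)"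
  by (simp add: plane_line_def)

lemma UNIV_2_other:
  fixes j :: 2
  obtains k where "k \<noteq> j" "UNIV = {j, k}"
proof (cases "j = 1")
  case True
  then show thesis by (intro that[of 2]) (auto simp: UNIV_2)
next
  case False
  then have "j = 2" using exhaust_2[of j] by blast
  then show thesis by (intro that[of 1]) (auto simp: UNIV_2)
qed

lemma continuous_plane_line: "continuous_on UNIV (\<lambda>(s, t). plane_line j s t)"
proof -
  have "continuous_on UNIV (\<lambda>p. if i = j then snd p else fst p :: real)" for i
    by (cases "i = j") (auto intro!: continuous_intros)
  then show ?thesis
    unfolding plane_line_def case_prod_unfold by (intro continuous_on_vec_lambda)
qed

lemma plane_line_measurable [measurable]:
  "(\<lambda>(s, t). plane_line j s t) \<in> borel_measurable (lborel \<Otimes>\<^sub>M lborel)"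
  using borel_measurable_continuous_onI[OF continuous_plane_line[of j]]
  by (simp add: borel_prod[symmetric] cong: measurable_cong_sets)

text \<open>Fubini's theorem along the lines of direction \<open>j\<close>, for both values of
  \<open>j\<close> at once; the identity of measures is checked on boxes.\<close>

lemma distr_plane_line: "distr (lborel \<Otimes>\<^sub>M lborel) borel (\<lambda>(s, t). plane_line j s t) = lborel"
proof (rule lborel_eqI[symmetric])
  fix l u :: plane
  assume lu: "\<And>b. b \<in> Basis \<Longrightarrow> l \<bullet> b \<le> u \<bullet> b"
  obtain k where k: "k \<noteq> j" "UNIV = {j, k}" by (rule UNIV_2_other)
  have all: "(\<forall>i::2. P i) \<longleftrightarrow> P j \<and> P k" for P using k(2) by (metis UNIV_I insertE singletonD)
  have le: "l $ i \<le> u $ i" for i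
    using lu[of "axis i 1"] by (auto simp: inner_axis Basis_vec_def)
  have "(\<lambda>(s, t). plane_line j s t) -` box l u = {l $ k <..< u $ k} \<times> {l $ j <..< u $ j}"
    using k(1) by (auto simp: mem_box_cart all plane_line_component)
  then have "emeasure (distr (lborel \<Otimes>\<^sub>M lborel) borel (\<lambda>(s, t). plane_line j s t)) (box l u)
      = emeasure (lborel \<Otimes>\<^sub>M lborel) ({l $ k <..< u $ k} \<times> {l $ j <..< u $ j})"
    by (subst emeasure_distr) (auto simp: space_pair_measure)
  also have "\<dots> = emeasure lborel {l $ k <..< u $ k} * emeasure lborel {l $ j <..< u $ j}"
    by (intro lborel.emeasure_pair_measure_Times) auto
  also have "\<dots> = ennreal ((u $ k - l $ k) * (u $ j - l $ j))"
    using le by (simp add: ennreal_mult)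
  also have "(u $ k - l $ k) * (u $ j - l $ j) = (\<Prod>i\<in>UNIV. (u - l) $ i)"
    using k(1) by (simp add: k(2))
  also have "\<dots> = (\<Prod>b\<in>Basis. (u - l) \<bullet> b)"
  proof -
    have B: "(Basis :: plane set) = (\<lambda>i. axis i 1) ` UNIV" by (auto simp: Basis_vec_def)
    have "inj (\<lambda>i::2. axis i (1::real))" by (auto simp: inj_on_def axis_eq_axis)
    then show ?thesis unfolding B by (subst prod.reindex) (simp_all add: inner_axis)
  qed
  finally show "emeasure (distr (lborel \<Otimes>\<^sub>M lborel) borel (\<lambda>(s, t). plane_line j s t)) (box l u)
    = ennreal (\<Prod>b\<in>Basis. (u - l) \<bullet> b)" .
qed simp

lemma lborel_integral_plane_lines:
  fixes F :: "plane \<Rightarrow> real"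
  assumes F: "integrable lborel F"
  shows "(\<integral>x. F x \<partial>lborel) = (\<integral>s. (\<integral>t. F (plane_line j s t) \<partial>lborel) \<partial>lborel)"
    "integrable lborel (\<lambda>s. \<integral>t. F (plane_line j s t) \<partial>lborel)"
proof -
  have [measurable]: "F \<in> borel_measurable borel" using F by auto
  have i: "integrable (lborel \<Otimes>\<^sub>M lborel) (\<lambda>(s, t). F (plane_line j s t))"
  proof -
    have "integrable (distr (lborel \<Otimes>\<^sub>M lborel) borel (\<lambda>(s, t). plane_line j s t)) F"
      by (simp add: distr_plane_line F)
    then have "integrable (lborel \<Otimes>\<^sub>M lborel) (\<lambda>p. F ((\<lambda>(s, t). plane_line j s t) p))"
      by (subst (asm) integrable_distr_eq) auto
    then show ?thesis by (simp add: case_prod_unfold)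
  qed
  have "(\<integral>x. F x \<partial>lborel) = (\<integral>x. F x \<partial>(distr (lborel \<Otimes>\<^sub>M lborel) borel (\<lambda>(s, t). plane_line j s t)))"
    by (simp add: distr_plane_line)
  also have "\<dots> = (\<integral>p. F ((\<lambda>(s, t). plane_line j s t) p) \<partial>(lborel \<Otimes>\<^sub>M lborel))"
    by (rule integral_distr) auto
  also have "\<dots> = (\<integral>p. (\<lambda>(s, t). F (plane_line j s t)) p \<partial>(lborel \<Otimes>\<^sub>M lborel))"
    by (simp add: case_prod_unfold)
  also have "\<dots> = (\<integral>s. (\<integral>t. F (plane_line j s t) \<partial>lborel) \<partial>lborel)"
    by (rule lborel_pair.integral_fst[OF i, symmetric])
  finally show "(\<integral>x. F x \<partial>lborel) = (\<integral>s. (\<integral>t. F (plane_line j s t) \<partial>lborel) \<partial>lborel)" .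
  show "integrable lborel (\<lambda>s. \<integral>t. F (plane_line j s t) \<partial>lborel)"
    by (rule lborel_pair.integrable_fst[OF i])
qed

section \<open>Monotone functions on lines and convex pieces\<close>

definition monotone_either :: "real set \<Rightarrow> (real \<Rightarrow> real) \<Rightarrow> bool" where
  "monotone_either S h \<longleftrightarrow> (\<forall>x\<in>S. \<forall>y\<in>S. x \<le> y \<longrightarrow> h x \<le> h y) \<or> (\<forall>x\<in>S. \<forall>y\<in>S. x \<le> y \<longrightarrow> h y \<le> h x)"

lemma monotone_either_subset: "monotone_either S h \<Longrightarrow> T \<subseteq> S \<Longrightarrow> monotone_either T h"
  unfolding monotone_either_def by blast

text \<open>The second mean value theorem turns the integral into
  \<open>h a * (\<psi> c - \<psi> a) + h b * (\<psi> b - \<psi> c)\<close>, and each of the two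
  products is at most 2.\<close>

lemma integral_monotone_deriv_bound:
  fixes g \<psi> \<psi>' :: "real \<Rightarrow> real"
  assumes ab: "a \<le> b" and g: "monotone_either {a..b} g" "\<And>x. \<bar>g x\<bar> \<le> 1"
    and d: "\<And>x. (\<psi> has_real_derivative \<psi>' x) (at x)" and \<psi>: "\<And>x. \<bar>\<psi> x\<bar> \<le> 1"
  shows "\<bar>integral {a..b} (\<lambda>x. g x * \<psi>' x)\<bar> \<le> 4"
proof -
  have ftc: "(\<psi>' has_integral (\<psi> v - \<psi> u)) {u..v}" if "u \<le> v" for u v
    using that d by (intro fundamental_theorem_of_calculus)
      (auto simp: has_real_derivative_iff_has_vector_derivative has_vector_derivative_at_within)
  have ftc': "integral {u..v} \<psi>' = \<psi> v - \<psi> u" if "u \<le> v" for u v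
    using ftc[OF that] by (rule integral_unique)
  have int: "\<psi>' integrable_on {a..b}" using ftc[OF ab] by blast
  have main: "\<bar>integral {a..b} (\<lambda>x. h x * \<psi>' x)\<bar> \<le> 4"
    if h: "\<And>x y. a \<le> x \<Longrightarrow> x \<le> y \<Longrightarrow> y \<le> b \<Longrightarrow> h x \<le> h y" "\<And>x. \<bar>h x\<bar> \<le> 1" for h
  proof -
    obtain c where c: "c \<in> {a..b}"
      "integral {a..b} (\<lambda>x. h x * \<psi>' x) = h a * integral {a..c} \<psi>' + h b * integral {c..b} \<psi>'"
      using second_mean_value_theorem[OF int ab, of h] h(1) by blast
    have "\<bar>h a * (\<psi> c - \<psi> a)\<bar> \<le> 1 * 2"
      unfolding abs_mult using h(2)[of a] \<psi>[of c] \<psi>[of a] by (intro mult_mono) auto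
    moreover have "\<bar>h b * (\<psi> b - \<psi> c)\<bar> \<le> 1 * 2"
      unfolding abs_mult using h(2)[of b] \<psi>[of c] \<psi>[of b] by (intro mult_mono) auto
    ultimately show ?thesis using c by (simp add: ftc')
  qed
  show ?thesis
  proof (cases "\<forall>x\<in>{a..b}. \<forall>y\<in>{a..b}. x \<le> y \<longrightarrow> g x \<le> g y")
    case True
    then show ?thesis using g(2) by (intro main) auto
  next
    case False
    then have "\<forall>x\<in>{a..b}. \<forall>y\<in>{a..b}. x \<le> y \<longrightarrow> g y \<le> g x"
      using g(1) unfolding monotone_either_def by blast
    then have "\<bar>integral {a..b} (\<lambda>x. (- g x) * \<psi>' x)\<bar> \<le> 4" using g(2) by (intro main) auto
    then show ?thesis by simp
  qed
qed

text \<open>A compact convex set of reals is an interval. If \<open>c\<close> lies inside, it is cut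
  there and each half contributes at most 4; otherwise one half suffices.\<close>

lemma convex_slice_integral_bound:
  fixes g \<psi> \<psi>' :: "real \<Rightarrow> real"
  assumes I: "compact I" "convex I"
    and g: "monotone_either {..c} g" "monotone_either {c..} g" "\<And>x. \<bar>g x\<bar> \<le> 1"
    and int: "integrable lborel (\<lambda>t. indicator I t * (g t * \<psi>' t))"
    and d: "\<And>x. (\<psi> has_real_derivative \<psi>' x) (at x)" and \<psi>: "\<And>x. \<bar>\<psi> x\<bar> \<le> 1"
  shows "\<bar>\<integral>t. indicator I t * (g t * \<psi>' t) \<partial>lborel\<bar> \<le> 8"
proof -
  obtain a b where ab: "I = {a..b}"
    using I by (metis connected_compact_interval_1 convex_connected)
  define f where "f t = g t * \<psi>' t" for t
  have ind: "(\<lambda>t. indicator I t * (g t * \<psi>' t)) = (\<lambda>t. if t \<in> I then f t else 0)"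
    by (auto simp: f_def fun_eq_iff)
  have fi: "f integrable_on {a..b}"
    using integrable_on_lborel[OF int] unfolding ind unfolding ab integrable_restrict_UNIV .
  have "(\<integral>t. indicator I t * (g t * \<psi>' t) \<partial>lborel) = integral UNIV (\<lambda>t. indicator I t * (g t * \<psi>' t))"
    by (rule integral_lborel[OF int, symmetric])
  also have "\<dots> = integral {a..b} f"
    unfolding ind unfolding ab integral_restrict_UNIV ..
  also have "\<bar>\<dots>\<bar> \<le> 8"
  proof -
    have piece: "\<bar>integral {u..v} f\<bar> \<le> 4" if "u \<le> v" "monotone_either {u..v} g" for u v
      unfolding f_def by (rule integral_monotone_deriv_bound[OF that g(3) d \<psi>])
    consider "b < a" | "a \<le> b" "b \<le> c" | "a \<le> b" "c \<le> a" | "a < c" "c < b" by linarith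
    then show ?thesis
    proof cases
      case 1 then show ?thesis by simp
    next
      case 2
      then show ?thesis using piece[of a b] monotone_either_subset[OF g(1), of "{a..b}"] by force
    next
      case 3
      then show ?thesis using piece[of a b] monotone_either_subset[OF g(2), of "{a..b}"] by force
    next
      case 4
      have "integral {a..c} f + integral {c..b} f = integral {a..b} f"
        using 4 fi by (intro Henstock_Kurzweil_Integration.integral_combine) auto
      moreover have "\<bar>integral {a..c} f\<bar> \<le> 4"
        using 4 by (intro piece monotone_either_subset[OF g(1)]) auto
      moreover have "\<bar>integral {c..b} f\<bar> \<le> 4"
        using 4 by (intro piece monotone_either_subset[OF g(2)]) auto
      ultimately show ?thesis by linarith
    qed
  qed
  finally show ?thesis .
qed

text \<open>The property common to the components of all fields below: on every line parallel to an
  axis they are monotone before and after the coordinate of \<open>p\<close>. The sense may depend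
  on the line and on the side.\<close>

definition linewise_monotone :: "plane \<Rightarrow> (plane \<Rightarrow> real) \<Rightarrow> bool" where
  "linewise_monotone p g \<longleftrightarrow> g \<in> borel_measurable borel \<and> (\<forall>x. \<bar>g x\<bar> \<le> 1) \<and>
     (\<forall>j s. monotone_either {..p $ j} (\<lambda>t. g (plane_line j s t)) \<and>
            monotone_either {p $ j..} (\<lambda>t. g (plane_line j s t)))"

lemma plane_line_has_derivative:
  assumes "C1_compact \<psi>"
  shows "((\<lambda>t. \<psi> (plane_line j s t)) has_real_derivative partial_deriv j \<psi> (plane_line j s t)) (at t)"
proof -
  have eq: "plane_line j s = (\<lambda>t. plane_line j s 0 + t *\<^sub>R axis j 1)"
    by (auto simp: fun_eq_iff vec_eq_iff plane_line_component axis_def)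
  have "(plane_line j s has_derivative (\<lambda>h. h *\<^sub>R axis j 1)) (at t)"
    by (subst eq) (auto intro!: derivative_eq_intros)
  from has_derivative_compose[OF this C1_compact_has_derivative[OF assms]]
  have "((\<lambda>t. \<psi> (plane_line j s t)) has_derivative
      (\<lambda>h. \<Sum>i\<in>UNIV. (h *\<^sub>R axis j 1) $ i * partial_deriv i \<psi> (plane_line j s t))) (at t)" .
  moreover have "(\<lambda>h. \<Sum>i\<in>UNIV. (h *\<^sub>R axis j 1 :: plane) $ i * partial_deriv i \<psi> (plane_line j s t))
      = (*) (partial_deriv j \<psi> (plane_line j s t))"
    by (auto simp: fun_eq_iff axis_def if_distrib[of "\<lambda>c. _ * c"] if_distrib[of "\<lambda>c. c * _"] cong: if_cong)
  ultimately show ?thesis by (simp add: has_field_derivative_def)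
qed

text \<open>By Fubini: a line parallel to an axis meets \<open>A\<close> in an interval and
  contributes at most 8, and the lines that meet \<open>A\<close> have their parameter in an
  interval of length \<open>2 * \<rho>\<close>. The bound is linear in the size of the piece, which
  is what keeps the variation of many small cells under control.\<close>

lemma convex_piece_variation:
  assumes A: "closed A" "convex A" "A \<subseteq> cball p \<rho>" and \<rho>: "0 \<le> \<rho>"
    and g: "linewise_monotone p g" and \<psi>: "C1_compact \<psi>" "\<And>x. \<bar>\<psi> x\<bar> \<le> 1"
  shows "integrable lborel (\<lambda>x. indicator A x * g x * partial_deriv j \<psi> x)"
    "\<bar>\<integral>x. indicator A x * g x * partial_deriv j \<psi> x \<partial>lborel\<bar> \<le> 16 * \<rho>"
proof -
  have [measurable]: "g \<in> borel_measurable borel" "partial_deriv j \<psi> \<in> borel_measurable borel" "A \<in> sets borel"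
    using g C1_compact_measurable[OF \<psi>(1)] A by (auto simp: linewise_monotone_def)
  have g1: "\<bar>g x\<bar> \<le> 1" for x using g by (simp add: linewise_monotone_def)
  obtain R M where M: "0 < R" "0 < M" "\<And>x i. \<bar>partial_deriv i \<psi> x\<bar> \<le> M"
    "\<And>x i. x \<notin> cball 0 R \<Longrightarrow> partial_deriv i \<psi> x = 0"
    using C1_compact_bounds[OF \<psi>(1)] by metis
  define F where "F x = indicator A x * (g x * partial_deriv j \<psi> x)" for x
  have F: "integrable lborel F"
  proof (rule integrable_bounded_support[where B = "1 * M" and R = R])
    show "F \<in> borel_measurable borel" unfolding F_def by measurable
    show "\<bar>F x\<bar> \<le> 1 * M" for x
    proof -
      have "\<bar>g x\<bar> * \<bar>partial_deriv j \<psi> x\<bar> \<le> 1 * M"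
        by (rule mult_mono[OF g1 M(3)]) auto
      then show ?thesis using M(2) by (auto simp: F_def indicator_def abs_mult)
    qed
    show "F x = 0" if "x \<notin> cball 0 R" for x using M(4)[OF that] by (simp add: F_def)
  qed
  then show "integrable lborel (\<lambda>x. indicator A x * g x * partial_deriv j \<psi> x)"
    by (simp add: F_def[abs_def] mult.assoc)
  obtain k where k: "k \<noteq> j" "UNIV = {j, k}" by (rule UNIV_2_other)
  define K where "K s = (\<integral>t. F (plane_line j s t) \<partial>lborel)" for s
  have Kint: "integrable lborel K" unfolding K_def by (rule lborel_integral_plane_lines(2)[OF F])
  have Kb: "\<bar>K s\<bar> \<le> 8 * indicator {p $ k - \<rho>..p $ k + \<rho>} s" for s
  proof (cases "s \<in> {p $ k - \<rho>..p $ k + \<rho>}")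
    case True
    define I where "I = {t. plane_line j s t \<in> A}"
    have eq: "plane_line j s = (\<lambda>t. plane_line j s 0 + t *\<^sub>R axis j 1)"
      by (auto simp: fun_eq_iff vec_eq_iff plane_line_component axis_def)
    have ctn: "continuous_on UNIV (plane_line j s)" by (subst eq) (auto intro!: continuous_intros)
    have "closed I" unfolding I_def
      using closed_vimage[OF A(1) ctn] by (simp add: vimage_def)
    moreover have "bounded I"
    proof (rule bounded_subset[of "{p $ j - \<rho>..p $ j + \<rho>}"])
      show "I \<subseteq> {p $ j - \<rho>..p $ j + \<rho>}"
      proof
        fix t assume "t \<in> I"
        then have "norm (plane_line j s t - p) \<le> \<rho>" using A(3) by (auto simp: I_def dist_norm norm_minus_commute)
        then have "\<bar>(plane_line j s t - p) $ j\<bar> \<le> \<rho>" using component_le_norm_cart order_trans by blast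
        then show "t \<in> {p $ j - \<rho>..p $ j + \<rho>}" by (auto simp: plane_line_component)
      qed
    qed simp
    ultimately have cI: "compact I" by (simp add: compact_eq_bounded_closed)
    have "convex I"
      unfolding convex_alt
    proof (intro ballI allI impI)
      fix t t' u :: real assume t: "t \<in> I" "t' \<in> I" and u: "0 \<le> u \<and> u \<le> 1"
      have "plane_line j s ((1 - u) *\<^sub>R t + u *\<^sub>R t') = (1 - u) *\<^sub>R plane_line j s t + u *\<^sub>R plane_line j s t'"
        by (auto simp: vec_eq_iff plane_line_component algebra_simps)
      also have "\<dots> \<in> A" using t u A(2) unfolding I_def convex_alt by blast
      finally show "(1 - u) *\<^sub>R t + u *\<^sub>R t' \<in> I" by (simp add: I_def)
    qed
    have F': "F (plane_line j s t) = indicator I t * (g (plane_line j s t) * partial_deriv j \<psi> (plane_line j s t))" for t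
      by (simp add: F_def I_def indicator_def)
    have [measurable]: "plane_line j s \<in> borel_measurable borel"
      using ctn by (rule borel_measurable_continuous_onI)
    have "integrable lborel (\<lambda>t. F (plane_line j s t))"
    proof (rule integrable_bounded_support[where B = M and R = R])
      show "(\<lambda>t. F (plane_line j s t)) \<in> borel_measurable borel" unfolding F_def by measurable
      show "\<bar>F (plane_line j s t)\<bar> \<le> M" for t
      proof -
        have "\<bar>g x\<bar> * \<bar>partial_deriv j \<psi> x\<bar> \<le> 1 * M" for x
          by (rule mult_mono[OF g1 M(3)]) auto
        then show ?thesis using M(2) by (auto simp: F_def indicator_def abs_mult)
      qed
      show "F (plane_line j s t) = 0" if "t \<notin> cball 0 R" for t
      proof -
        have "\<bar>plane_line j s t $ j\<bar> \<le> norm (plane_line j s t)" by (rule component_le_norm_cart)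
        then have "plane_line j s t \<notin> cball 0 R" using that by (auto simp: plane_line_component)
        then show ?thesis using M(4) by (simp add: F_def)
      qed
    qed
    then have "\<bar>K s\<bar> \<le> 8"
      unfolding K_def F'
      by (intro convex_slice_integral_bound[OF cI \<open>convex I\<close>, where c = "p $ j" and \<psi> = "\<lambda>t. \<psi> (plane_line j s t)"])
        (use g \<psi>(2) plane_line_has_derivative[OF \<psi>(1)] in \<open>auto simp: linewise_monotone_def\<close>)
    then show ?thesis using True by simp
  next
    case False
    have "F (plane_line j s t) = 0" for t
    proof -
      have "plane_line j s t \<notin> A"
      proof
        assume "plane_line j s t \<in> A"
        then have "norm (plane_line j s t - p) \<le> \<rho>" using A(3) by (auto simp: dist_norm norm_minus_commute)
        then have "\<bar>(plane_line j s t - p) $ k\<bar> \<le> \<rho>" using component_le_norm_cart order_trans by blast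
        then show False using False k(1) by (auto simp: plane_line_component)
      qed
      then show ?thesis by (simp add: F_def)
    qed
    then show ?thesis by (simp add: K_def False)
  qed
  have "\<bar>\<integral>x. F x \<partial>lborel\<bar> = \<bar>\<integral>s. K s \<partial>lborel\<bar>"
    unfolding K_def by (subst lborel_integral_plane_lines(1)[OF F, of j]) simp
  also have "\<dots> \<le> (\<integral>s. \<bar>K s\<bar> \<partial>lborel)" by (rule integral_abs_bound)
  also have "\<dots> \<le> (\<integral>s. 8 * indicator {p $ k - \<rho>..p $ k + \<rho>} s \<partial>lborel)"
  proof (intro integral_mono)
    show "integrable lborel (\<lambda>s. 8 * indicator {p $ k - \<rho>..p $ k + \<rho>} s :: real)"
      by (intro integrable_mult_right integrable_real_indicator) (auto simp: emeasure_lborel_Icc_eq)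
  qed (use Kint Kb in auto)
  also have "\<dots> = 16 * \<rho>" using \<rho> by simp
  finally show "\<bar>\<integral>x. indicator A x * g x * partial_deriv j \<psi> x \<partial>lborel\<bar> \<le> 16 * \<rho>"
    by (simp add: F_def mult.assoc)
qed

text \<open>\<open>2 * M\<close> bounds the total variation of the scalar function \<open>g\<close> on the whole plane.\<close>

definition bounded_variation_by :: "real \<Rightarrow> (plane \<Rightarrow> real) \<Rightarrow> bool" where
  "bounded_variation_by M g \<longleftrightarrow> g \<in> borel_measurable borel \<and> (\<forall>\<psi> j. C1_compact \<psi> \<longrightarrow> (\<forall>x. \<bar>\<psi> x\<bar> \<le> 1) \<longrightarrow>
     integrable lborel (\<lambda>x. g x * partial_deriv j \<psi> x) \<and> \<bar>\<integral>x. g x * partial_deriv j \<psi> x \<partial>lborel\<bar> \<le> M)"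

lemma bounded_variation_by_piece:
  assumes "closed A" "convex A" "A \<subseteq> cball p \<rho>" "0 \<le> \<rho>" "linewise_monotone p g"
  shows "bounded_variation_by (16 * \<rho>) (\<lambda>x. indicator A x * g x)"
  unfolding bounded_variation_by_def
  using convex_piece_variation[OF assms] assms(1,5) by (auto simp: linewise_monotone_def)

lemma bounded_variation_by_add:
  assumes "bounded_variation_by M g" "bounded_variation_by N h"
  shows "bounded_variation_by (M + N) (\<lambda>x. g x + h x)"
  unfolding bounded_variation_by_def
proof (intro allI impI conjI)
  show "(\<lambda>x. g x + h x) \<in> borel_measurable borel"
    using assms by (auto simp: bounded_variation_by_def)
  fix \<psi> j assume p: "C1_compact \<psi>" "\<forall>x. \<bar>\<psi> x\<bar> \<le> 1"
  then have 1: "integrable lborel (\<lambda>x. g x * partial_deriv j \<psi> x)" "integrable lborel (\<lambda>x. h x * partial_deriv j \<psi> x)"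
    "\<bar>\<integral>x. g x * partial_deriv j \<psi> x \<partial>lborel\<bar> \<le> M" "\<bar>\<integral>x. h x * partial_deriv j \<psi> x \<partial>lborel\<bar> \<le> N"
    using assms by (auto simp: bounded_variation_by_def)
  then show "integrable lborel (\<lambda>x. (g x + h x) * partial_deriv j \<psi> x)" by (simp add: algebra_simps)
  show "\<bar>\<integral>x. (g x + h x) * partial_deriv j \<psi> x \<partial>lborel\<bar> \<le> M + N"
    using 1 by (simp add: distrib_right)
qed

lemma bounded_variation_by_mono:
  assumes "bounded_variation_by M g" "M \<le> N"
  shows "bounded_variation_by N g"
  unfolding bounded_variation_by_def
proof (intro conjI allI impI)
  show "g \<in> borel_measurable borel" using assms(1) by (simp add: bounded_variation_by_def)
  fix \<psi> j assume "C1_compact \<psi>" "\<forall>x. \<bar>\<psi> x\<bar> \<le> 1"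
  then have "integrable lborel (\<lambda>x. g x * partial_deriv j \<psi> x)"
    "\<bar>\<integral>x. g x * partial_deriv j \<psi> x \<partial>lborel\<bar> \<le> M"
    using assms(1) by (simp_all add: bounded_variation_by_def)
  then show "integrable lborel (\<lambda>x. g x * partial_deriv j \<psi> x)"
    "\<bar>\<integral>x. g x * partial_deriv j \<psi> x \<partial>lborel\<bar> \<le> N"
    using assms(2) by simp_all
qed

lemma bounded_variation_by_cmult:
  assumes "bounded_variation_by M g"
  shows "bounded_variation_by (\<bar>c\<bar> * M) (\<lambda>x. c * g x)"
  using assms unfolding bounded_variation_by_def
  by (auto simp: mult.assoc abs_mult intro: mult_left_mono)

lemma bounded_variation_by_zero: "bounded_variation_by 0 (\<lambda>x. 0)"
  by (simp add: bounded_variation_by_def)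

text \<open>Every entry of an admissible matrix field is a scalar test function bounded by 1. The
  four entries contribute at most \<open>M\<close> each.\<close>

lemma total_variation_le:
  assumes bv: "\<And>i. bounded_variation_by M (g i)" and m: "\<And>x i. x \<in> \<Omega> \<Longrightarrow> m x $ i = g i x"
  shows "total_variation \<Omega> m \<le> ennreal (4 * M)"
  unfolding total_variation_def
proof (rule SUP_least)
  fix \<phi> :: "plane \<Rightarrow> real^2^2"
  assume "\<phi> \<in> {\<phi>. (\<forall>i j. (\<lambda>x. \<phi> x $ i $ j) \<in> test_C1 \<Omega>) \<and> (\<forall>x. norm (\<phi> x) \<le> 1)}"
  then have t: "\<And>i j. (\<lambda>x. \<phi> x $ i $ j) \<in> test_C1 \<Omega>" and n: "\<And>x. norm (\<phi> x) \<le> 1" by auto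
  note C = test_C1_compact[OF t]
  have one: "\<bar>\<phi> x $ i $ j\<bar> \<le> 1" for x i j
    using component_le_norm_cart[of "\<phi> x $ i" j] Finite_Cartesian_Product.norm_nth_le[of "\<phi> x" i] n[of x] by linarith
  have I: "integrable lborel (\<lambda>x. g i x * partial_deriv j (\<lambda>y. \<phi> y $ i $ j) x)"
    and B: "\<bar>\<integral>x. g i x * partial_deriv j (\<lambda>y. \<phi> y $ i $ j) x \<partial>lborel\<bar> \<le> M" for i j
    using bv[of i] C[of i j] one unfolding bounded_variation_by_def by auto
  have [measurable]: "g i \<in> borel_measurable borel" "partial_deriv j (\<lambda>y. \<phi> y $ i $ j) \<in> borel_measurable borel" for i j
    using bv C1_compact_measurable(2)[OF C] by (auto simp: bounded_variation_by_def)
  have "(LINT x:\<Omega>|lebesgue. (\<Sum>i\<in>UNIV. m x $ i * (\<Sum>j\<in>UNIV. partial_deriv j (\<lambda>y. \<phi> y $ i $ j) x)))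
    = (LINT x:\<Omega>|lebesgue. (\<Sum>i\<in>UNIV. g i x * (\<Sum>j\<in>UNIV. partial_deriv j (\<lambda>y. \<phi> y $ i $ j) x)))"
    unfolding set_lebesgue_integral_def
    by (intro Bochner_Integration.integral_cong refl) (auto simp: indicator_def m)
  also have "\<dots> = (\<integral>x. (\<Sum>i\<in>UNIV. g i x * (\<Sum>j\<in>UNIV. partial_deriv j (\<lambda>y. \<phi> y $ i $ j) x)) \<partial>lborel)"
  proof (rule set_integral_lebesgue_eq_lborel)
    fix x assume "x \<notin> \<Omega>"
    then have "partial_deriv j (\<lambda>y. \<phi> y $ i $ j) x = 0" for i j
      using partial_deriv_zero_outside_test(1)[OF disjI1[OF t]] by blast
    then show "(\<Sum>i\<in>UNIV. g i x * (\<Sum>j\<in>UNIV. partial_deriv j (\<lambda>y. \<phi> y $ i $ j) x)) = 0" by simp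
  qed measurable
  also have "\<dots> = (\<Sum>i\<in>UNIV. \<Sum>j\<in>UNIV. (\<integral>x. g i x * partial_deriv j (\<lambda>y. \<phi> y $ i $ j) x \<partial>lborel))"
    using I by (simp add: sum_distrib_left)
  also have "\<dots> \<le> 4 * M"
    using B[of 1 1] B[of 1 2] B[of 2 1] B[of 2 2] by (simp add: UNIV_2 abs_le_iff)
  finally show "ennreal (LINT x:\<Omega>|lebesgue. (\<Sum>i\<in>UNIV. m x $ i *
      (\<Sum>j\<in>UNIV. partial_deriv j (\<lambda>y. \<phi> y $ i $ j) x))) \<le> ennreal (4 * M)"
    by (rule ennreal_leI)
qed

section \<open>Jumps and line energies\<close>

text \<open>Only the values on \<open>\<Omega>\<close> are prescribed, so that \<open>g\<close> may
  be cut off elsewhere: a field such as \<open>sgn (x - p)\<close> has infinite variation on the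
  whole plane.\<close>

definition bv_field :: "plane set \<Rightarrow> real \<Rightarrow> (plane \<Rightarrow> plane) \<Rightarrow> bool" where
  "bv_field \<Omega> M G \<longleftrightarrow> (\<forall>i. \<exists>g. bounded_variation_by M g \<and> (\<forall>x\<in>\<Omega>. G x $ i = g x))"

lemma bv_field_add:
  assumes "bv_field \<Omega> M G" "bv_field \<Omega> N H"
  shows "bv_field \<Omega> (M + N) (\<lambda>x. G x + H x)"
  unfolding bv_field_def
proof
  fix i
  obtain g h where "bounded_variation_by M g" "\<forall>x\<in>\<Omega>. G x $ i = g x"
    "bounded_variation_by N h" "\<forall>x\<in>\<Omega>. H x $ i = h x"
    using assms unfolding bv_field_def by meson
  then show "\<exists>g. bounded_variation_by (M + N) g \<and> (\<forall>x\<in>\<Omega>. (G x + H x) $ i = g x)"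
    by (intro exI[of _ "\<lambda>x. g x + h x"]) (simp add: bounded_variation_by_add)
qed

lemma bv_field_scale:
  assumes "bv_field \<Omega> M G"
  shows "bv_field \<Omega> (\<bar>c\<bar> * M) (\<lambda>x. c *\<^sub>R G x)"
  unfolding bv_field_def
proof
  fix i
  obtain g where "bounded_variation_by M g" "\<forall>x\<in>\<Omega>. G x $ i = g x"
    using assms unfolding bv_field_def by meson
  then show "\<exists>g. bounded_variation_by (\<bar>c\<bar> * M) g \<and> (\<forall>x\<in>\<Omega>. (c *\<^sub>R G x) $ i = g x)"
    by (intro exI[of _ "\<lambda>x. c * g x"]) (simp add: bounded_variation_by_cmult)
qed

lemma bv_field_mono:
  assumes "bv_field \<Omega> M G" "M \<le> N"
  shows "bv_field \<Omega> N G"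
  unfolding bv_field_def
proof
  fix i
  obtain g where "bounded_variation_by M g" "\<forall>x\<in>\<Omega>. G x $ i = g x"
    using assms(1) unfolding bv_field_def by meson
  then show "\<exists>g. bounded_variation_by N g \<and> (\<forall>x\<in>\<Omega>. G x $ i = g x)"
    using bounded_variation_by_mono[OF _ assms(2)] by blast
qed

lemma bv_field_uminus: "bv_field \<Omega> M G \<Longrightarrow> bv_field \<Omega> M (\<lambda>x. - G x)"
  using bv_field_scale[of \<Omega> M G "- 1"] by simp

lemma bv_field_sum:
  assumes "finite I" "\<And>i. i \<in> I \<Longrightarrow> bv_field \<Omega> (M i) (G i)"
  shows "bv_field \<Omega> (\<Sum>i\<in>I. M i) (\<lambda>x. \<Sum>i\<in>I. G i x)"
  using assms
proof (induction I)
  case empty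
  then show ?case by (auto simp: bv_field_def intro!: exI[of _ "\<lambda>x. 0"] bounded_variation_by_zero)
qed (auto intro: bv_field_add)

lemma bv_field_cong:
  assumes "bv_field \<Omega> M G" "\<And>x. x \<in> \<Omega> \<Longrightarrow> G x = H x"
  shows "bv_field \<Omega> M H"
  unfolding bv_field_def
proof
  fix i
  obtain g where g: "bounded_variation_by M g" "\<And>x. x \<in> \<Omega> \<Longrightarrow> G x $ i = g x"
    using assms(1) unfolding bv_field_def by blast
  have "H x $ i = g x" if "x \<in> \<Omega>" for x
    using g(2)[OF that] assms(2)[OF that] by simp
  then show "\<exists>g. bounded_variation_by M g \<and> (\<forall>x\<in>\<Omega>. H x $ i = g x)"
    using g(1) by blast
qed

lemma bv_field_piece:
  assumes A: "closed A" "convex A" "A \<inter> \<Omega> \<subseteq> cball p \<rho>" "0 \<le> \<rho>"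
    and W: "\<And>i. linewise_monotone p (\<lambda>x. W x $ i)"
  shows "bv_field \<Omega> (16 * \<rho>) (\<lambda>x. if x \<in> A then W x else 0)"
  unfolding bv_field_def
proof
  fix i
  have "bounded_variation_by (16 * \<rho>) (\<lambda>x. indicator (A \<inter> cball p \<rho>) x * W x $ i)"
    by (rule bounded_variation_by_piece[OF _ _ _ A(4) W])
      (simp_all add: A(1,2) closed_Int convex_Int)
  moreover have "(if x \<in> A then W x else 0) $ i = indicator (A \<inter> cball p \<rho>) x * W x $ i" if "x \<in> \<Omega>" for x
  proof (cases "x \<in> A")
    case True
    then have "x \<in> A \<inter> cball p \<rho>" using A(3) that by blast
    then show ?thesis using True by simp
  qed simp
  ultimately have "bounded_variation_by (16 * \<rho>) (\<lambda>x. indicator (A \<inter> cball p \<rho>) x * W x $ i) \<and>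
      (\<forall>x\<in>\<Omega>. (if x \<in> A then W x else 0) $ i = indicator (A \<inter> cball p \<rho>) x * W x $ i)"
    by blast
  then show "\<exists>g. bounded_variation_by (16 * \<rho>) g \<and> (\<forall>x\<in>\<Omega>. (if x \<in> A then W x else 0) $ i = g x)"
    by (rule exI[of _ "\<lambda>x. indicator (A \<inter> cball p \<rho>) x * W x $ i"])
qed

text \<open>\<open>P\<close> collects the vortex centres, where \<open>sgn\<close> takes the value
  0. It is a null set, so the field still has unit length almost everywhere and its integral norm is
  the area of \<open>\<Omega>\<close>.\<close>

lemma potential_A_space:
  assumes \<Omega>: "open \<Omega>" "bounded \<Omega>" and u: "is_potential u G" and bv: "bv_field \<Omega> M G"
    and P: "finite P" "\<And>x. x \<notin> P \<Longrightarrow> norm (G x) = 1"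
  shows "(\<lambda>x. rot (G x)) \<in> A_space \<Omega>"
    "BV_norm \<Omega> (\<lambda>x. rot (G x)) \<le> ennreal (measure lebesgue \<Omega> + 4 * \<bar>M\<bar>)"
proof -
  obtain B where B: "\<And>x. norm (G x) \<le> B" using u by (auto simp: is_potential_def)
  have [measurable]: "G \<in> borel_measurable borel" "\<Omega> \<in> sets borel"
    using is_potential_measurable[OF u] \<Omega> by auto
  have m\<Omega>: "\<Omega> \<in> lmeasurable" using \<Omega> by (simp add: lmeasurable_open)
  have rotm: "(\<lambda>x. rot (G x)) \<in> borel_measurable lebesgue"
    by (rule measurable_completion) measurable
  have AEP: "AE x in lebesgue. x \<notin> P"
  proof -
    have "negligible P" using P(1) by (rule negligible_finite)
    then show ?thesis by (intro AE_not_in) (simp add: negligible_iff_null_sets)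
  qed
  have tv: "total_variation \<Omega> (\<lambda>x. rot (G x)) \<le> ennreal (4 * \<bar>M\<bar>)"
  proof -
    have ex: "\<exists>g. bounded_variation_by M g \<and> (\<forall>x\<in>\<Omega>. G x $ i = g x)" for i
      using bv by (simp add: bv_field_def)
    obtain g1 where g1: "bounded_variation_by M g1" "\<And>x. x \<in> \<Omega> \<Longrightarrow> G x $ 1 = g1 x"
      using ex[of 1] by blast
    obtain g2 where g2: "bounded_variation_by M g2" "\<And>x. x \<in> \<Omega> \<Longrightarrow> G x $ 2 = g2 x"
      using ex[of 2] by blast
    define g where "g i = (if i = 1 then (\<lambda>x. - g2 x) else g1)" for i :: 2
    have "bounded_variation_by M (\<lambda>x. - g2 x)"
      using bounded_variation_by_cmult[OF g2(1), of "- 1"] by simp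
    then have "bounded_variation_by M (g i)" for i using g1 by (simp add: g_def)
    moreover have "rot (G x) $ i = g i x" if "x \<in> \<Omega>" for x i
      using g1(2)[OF that] g2(2)[OF that] exhaust_2[of i] by (auto simp: g_def)
    ultimately have "total_variation \<Omega> (\<lambda>x. rot (G x)) \<le> ennreal (4 * M)"
      by (rule total_variation_le)
    also have "\<dots> \<le> ennreal (4 * \<bar>M\<bar>)" by (intro ennreal_leI) simp
    finally show ?thesis .
  qed
  have "(\<lambda>x. rot (G x)) absolutely_integrable_on \<Omega>"
    unfolding set_integrable_def
  proof (rule integrableI_bounded_set[where A = \<Omega> and B = B])
    show "(\<lambda>x. indicat_real \<Omega> x *\<^sub>R rot (G x)) \<in> borel_measurable lebesgue"
      by (rule measurable_completion) measurable
    show "emeasure lebesgue \<Omega> < \<infinity>" using m\<Omega> by (simp add: fmeasurable_def)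
  qed (use B m\<Omega> in \<open>auto simp: fmeasurable_def\<close>)
  then have BV: "(\<lambda>x. rot (G x)) \<in> BV \<Omega>"
    using le_less_trans[OF tv, of \<infinity>] by (simp add: BV_def)
  have "AE x in lebesgue. x \<in> \<Omega> \<longrightarrow> norm (rot (G x)) = 1"
    using AEP by eventually_elim (simp add: P)
  moreover have "divergence_free \<Omega> (\<lambda>x. rot (G x))"
    by (rule potential_divergence_free[OF u]) simp
  ultimately show "(\<lambda>x. rot (G x)) \<in> A_space \<Omega>" using BV by (simp add: A_space_def)
  have "(LINT x:\<Omega>|lebesgue. norm (rot (G x))) = (LINT x:\<Omega>|lebesgue. 1)"
    unfolding set_lebesgue_integral_def
  proof (rule integral_cong_AE)
    show "AE x in lebesgue. indicat_real \<Omega> x *\<^sub>R norm (rot (G x)) = indicat_real \<Omega> x *\<^sub>R 1"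
      using AEP by eventually_elim (simp add: P)
    show "(\<lambda>x. indicat_real \<Omega> x *\<^sub>R norm (rot (G x))) \<in> borel_measurable lebesgue"
      by (rule measurable_completion) measurable
    show "(\<lambda>x. indicat_real \<Omega> x *\<^sub>R 1 :: real) \<in> borel_measurable lebesgue"
      by (rule measurable_completion) measurable
  qed
  also have "\<dots> = measure lebesgue \<Omega>"
    by (simp add: set_lebesgue_integral_def)
  finally have "BV_norm \<Omega> (\<lambda>x. rot (G x)) \<le> ennreal (measure lebesgue \<Omega>) + ennreal (4 * \<bar>M\<bar>)"
    unfolding BV_norm_def using tv by (intro add_mono) auto
  then show "BV_norm \<Omega> (\<lambda>x. rot (G x)) \<le> ennreal (measure lebesgue \<Omega> + 4 * \<bar>M\<bar>)"
    by simp
qed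

section \<open>Traces of fields with finitely many nearby values\<close>

lemma half_ball_facts:
  assumes "0 < r" "norm \<nu> = 1"
  shows "open (half_ball x \<nu> r)" "half_ball x \<nu> r \<in> lmeasurable" "0 < measure lebesgue (half_ball x \<nu> r)"
proof -
  have eq: "half_ball x \<nu> r = ball x r \<inter> {y. 0 < (y - x) \<bullet> \<nu>}" by (auto simp: half_ball_def)
  have "open {y. 0 < (y - x) \<bullet> \<nu>}" by (intro open_Collect_less continuous_intros)
  then show o: "open (half_ball x \<nu> r)" unfolding eq by (intro open_Int) auto
  have "bounded (half_ball x \<nu> r)" unfolding eq by (intro bounded_Int) auto
  then show l: "half_ball x \<nu> r \<in> lmeasurable" using o by (rule lmeasurable_open)
  have "(r / 2) *\<^sub>R \<nu> \<bullet> \<nu> > 0" using assms by (simp add: dot_square_norm)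
  then have "x + (r / 2) *\<^sub>R \<nu> \<in> half_ball x \<nu> r"
    using assms by (simp add: half_ball_def dist_norm)
  then have "half_ball x \<nu> r \<noteq> {}" by auto
  then have "\<not> negligible (half_ball x \<nu> r)" by (rule open_not_negligible[OF o])
  moreover have "negligible (half_ball x \<nu> r)" if "measure lebesgue (half_ball x \<nu> r) = 0"
    unfolding negligible_iff_measure using l that by blast
  ultimately have "measure lebesgue (half_ball x \<nu> r) \<noteq> 0" by blast
  then show "0 < measure lebesgue (half_ball x \<nu> r)"
    using measure_nonneg[of lebesgue "half_ball x \<nu> r"] by linarith
qed

text \<open>If \<open>a\<close> were not in the finite set \<open>V\<close>, it would have distance
  at least \<open>2 * d\<close> from it for some positive \<open>d\<close>. Near \<open>x\<close>
  the field stays within \<open>d\<close> of \<open>V\<close>, so the averages of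
  \<open>norm (m y - a)\<close> could not fall below \<open>d\<close>.\<close>

lemma approx_one_sided_limit_value:
  assumes m: "m \<in> borel_measurable borel" "\<And>y. norm (m y) \<le> B"
    and V: "finite V" "\<And>\<epsilon>. 0 < \<epsilon> \<Longrightarrow> \<exists>\<delta>>0. \<forall>y. dist y x < \<delta> \<longrightarrow> (\<exists>b\<in>V. dist (m y) b < \<epsilon>)"
    and \<nu>: "norm \<nu> = 1" and lim: "approx_one_sided_limit m x \<nu> a"
  shows "a \<in> V"
proof (rule ccontr)
  assume "a \<notin> V"
  then obtain d where d: "0 < d" "\<And>b. b \<in> V \<Longrightarrow> 2 * d \<le> dist a b"
  proof -
    have "\<exists>d>0. \<forall>b\<in>V. b \<noteq> a \<longrightarrow> d \<le> dist a b" by (rule finite_set_avoid[OF V(1)])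
    then obtain d where "0 < d" "\<forall>b\<in>V. b \<noteq> a \<longrightarrow> d \<le> dist a b" by blast
    then show thesis using \<open>a \<notin> V\<close> by (intro that[of "d / 2"]) auto
  qed
  obtain \<delta> where \<delta>: "0 < \<delta>" "\<And>y. dist y x < \<delta> \<Longrightarrow> \<exists>b\<in>V. dist (m y) b < d"
    using V(2)[OF d(1)] by blast
  have far: "d \<le> norm (m y - a)" if y: "dist y x < \<delta>" for y
  proof -
    obtain b where "b \<in> V" "dist (m y) b < d" using \<delta>(2)[OF y] by blast
    then show ?thesis
      using d(2)[of b] dist_triangle[of a b "m y"] by (simp add: dist_norm norm_minus_commute)
  qed
  have ev: "\<forall>\<^sub>F r in at_right 0. d \<le>
      (LINT y:half_ball x \<nu> r|lebesgue. norm (m y - a)) / measure lebesgue (half_ball x \<nu> r)"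
    unfolding eventually_at_right_field
  proof (intro exI[of _ \<delta>] conjI allI impI)
    fix r assume r: "0 < r" "r < \<delta>"
    note hb = half_ball_facts[OF r(1) \<nu>, of x]
    have [measurable]: "m \<in> borel_measurable borel" "half_ball x \<nu> r \<in> sets borel"
      using m(1) hb(1) by auto
    have "(LINT y:half_ball x \<nu> r|lebesgue. d) \<le> (LINT y:half_ball x \<nu> r|lebesgue. norm (m y - a))"
    proof (rule set_integral_mono)
      show "set_integrable lebesgue (half_ball x \<nu> r) (\<lambda>y. d)"
        using hb(2) by (simp add: set_integrable_def fmeasurable_def)
      show "set_integrable lebesgue (half_ball x \<nu> r) (\<lambda>y. norm (m y - a))"
        unfolding set_integrable_def
      proof (rule integrableI_bounded_set[where A = "half_ball x \<nu> r" and B = "B + norm a"])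
        show "(\<lambda>y. indicat_real (half_ball x \<nu> r) y *\<^sub>R norm (m y - a)) \<in> borel_measurable lebesgue"
          by (rule measurable_completion) measurable
        show "AE y in lebesgue. y \<in> half_ball x \<nu> r \<longrightarrow>
            norm (indicat_real (half_ball x \<nu> r) y *\<^sub>R norm (m y - a)) \<le> B + norm a"
        proof (rule AE_I2)
          fix y
          have "norm (m y - a) \<le> B + norm a"
            using norm_triangle_ineq4[of "m y" a] m(2)[of y] by linarith
          then show "y \<in> half_ball x \<nu> r \<longrightarrow>
            norm (indicat_real (half_ball x \<nu> r) y *\<^sub>R norm (m y - a)) \<le> B + norm a"
            by (auto simp: indicator_def)
        qed
      qed (use hb(2) in \<open>auto simp: fmeasurable_def\<close>)
      show "d \<le> norm (m y - a)" if "y \<in> half_ball x \<nu> r" for y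
        using that r by (intro far) (auto simp: half_ball_def dist_commute)
    qed
    then have "d * measure lebesgue (half_ball x \<nu> r) \<le> (LINT y:half_ball x \<nu> r|lebesgue. norm (m y - a))"
      using hb(2) by (simp add: set_lebesgue_integral_def fmeasurable_def mult.commute)
    then show "d \<le> (LINT y:half_ball x \<nu> r|lebesgue. norm (m y - a)) / measure lebesgue (half_ball x \<nu> r)"
      using hb(3) by (simp add: field_simps)
  qed (rule \<delta>(1))
  have "d \<le> 0"
    using tendsto_lowerbound[OF lim[unfolded approx_one_sided_limit_def] ev] by simp
  then show False using d(1) by simp
qed

text \<open>A closed region that does not contain \<open>x\<close> misses a neighbourhood of
  \<open>x\<close>. So near \<open>x\<close> only the expressions whose regions contain
  \<open>x\<close> occur, and by continuity their values are close to those at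
  \<open>x\<close>.\<close>

lemma closed_cover_values:
  fixes G :: "plane \<Rightarrow> plane"
  assumes C: "finite \<C>" "\<And>R g. (R, g) \<in> \<C> \<Longrightarrow> closed R" "\<And>R g. (R, g) \<in> \<C> \<Longrightarrow> isCont g x"
    and P: "finite P" "x \<notin> P" "\<And>y. y \<notin> P \<Longrightarrow> \<exists>(R, g)\<in>\<C>. y \<in> R \<and> G y = g y" and \<epsilon>: "0 < \<epsilon>"
  shows "\<exists>\<delta>>0. \<forall>y. dist y x < \<delta> \<longrightarrow> (\<exists>b\<in>{g x |R g. (R, g) \<in> \<C> \<and> x \<in> R}. dist (G y) b < \<epsilon>)"
proof -
  have "\<forall>\<^sub>F y in nhds x. y \<in> R \<longrightarrow> x \<in> R \<and> dist (g y) (g x) < \<epsilon>" if "(R, g) \<in> \<C>" for R g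
  proof (cases "x \<in> R")
    case True
    have "(g \<longlongrightarrow> g x) (nhds x)"
      using C(3)[OF that] by (simp add: isCont_def tendsto_at_iff_tendsto_nhds)
    then have "\<forall>\<^sub>F y in nhds x. dist (g y) (g x) < \<epsilon>" using \<epsilon> by (rule tendstoD)
    then show ?thesis by eventually_elim (simp add: True)
  next
    case False
    have "\<forall>\<^sub>F y in nhds x. y \<in> - R"
      using C(2)[OF that] False by (intro eventually_nhds_in_open) auto
    then show ?thesis by eventually_elim simp
  qed
  then have "\<forall>\<^sub>F y in nhds x. \<forall>p\<in>\<C>. y \<in> fst p \<longrightarrow> x \<in> fst p \<and> dist (snd p y) (snd p x) < \<epsilon>"
    by (intro eventually_ball_finite C(1)) auto
  moreover have "\<forall>\<^sub>F y in nhds x. y \<in> - P"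
    using P(1,2) by (intro eventually_nhds_in_open) (auto intro: finite_imp_closed)
  ultimately have "\<forall>\<^sub>F y in nhds x. \<exists>b\<in>{g x |R g. (R, g) \<in> \<C> \<and> x \<in> R}. dist (G y) b < \<epsilon>"
  proof eventually_elim
    case (elim y)
    then obtain R g where "(R, g) \<in> \<C>" "y \<in> R" "G y = g y" using P(3)[of y] by auto
    then have "x \<in> R \<and> dist (G y) (g x) < \<epsilon>" using elim(1) by force
    then show ?case using \<open>(R, g) \<in> \<C>\<close> by blast
  qed
  then show ?thesis by (simp add: eventually_nhds_metric)
qed

text \<open>Both traces at \<open>x\<close> come from the finite list of expressions that are active
  there. This does not decide whether \<open>x\<close> is a jump point, but it limits the possible
  jump sizes, which is what estimates of the energy from above require; where only two values are
  possible it even determines the size.\<close>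

lemma jump_values_closed_cover:
  fixes G :: "plane \<Rightarrow> plane"
  assumes G: "G \<in> borel_measurable borel" "\<And>y. norm (G y) \<le> B"
    and C: "finite \<C>" "\<And>R g. (R, g) \<in> \<C> \<Longrightarrow> closed R" "\<And>R g. (R, g) \<in> \<C> \<Longrightarrow> isCont g x"
    and P: "finite P" "x \<notin> P" "\<And>y. y \<notin> P \<Longrightarrow> \<exists>(R, g)\<in>\<C>. y \<in> R \<and> G y = g y"
    and T: "is_jump_triple (\<lambda>x. rot (G x)) x T"
  obtains R g R' g' where "(R, g) \<in> \<C>" "x \<in> R" "(R', g') \<in> \<C>" "x \<in> R'" "g x \<noteq> g' x"
    "norm (fst T - fst (snd T)) = norm (g x - g' x)"
proof -
  obtain a b \<nu> where Teq: "T = (a, b, \<nu>)" by (cases T)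
  have ab: "a \<noteq> b" "norm \<nu> = 1" "approx_one_sided_limit (\<lambda>x. rot (G x)) x \<nu> a"
    "approx_one_sided_limit (\<lambda>x. rot (G x)) x (- \<nu>) b"
    using T by (auto simp: is_jump_triple_def Teq)
  define V where "V = rot ` {g x |R g. (R, g) \<in> \<C> \<and> x \<in> R}"
  have "{g x |R g. (R, g) \<in> \<C> \<and> x \<in> R} \<subseteq> (\<lambda>p. snd p x) ` \<C>" by force
  then have fV: "finite V" unfolding V_def using C(1) by (meson finite_imageI finite_subset)
  have near: "\<exists>\<delta>>0. \<forall>y. dist y x < \<delta> \<longrightarrow> (\<exists>b\<in>V. dist (rot (G y)) b < \<epsilon>)" if eps: "0 < \<epsilon>" for \<epsilon>
  proof -
    obtain \<delta> where \<delta>: "0 < \<delta>"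
      "\<And>y. dist y x < \<delta> \<Longrightarrow> \<exists>b\<in>{g x |R g. (R, g) \<in> \<C> \<and> x \<in> R}. dist (G y) b < \<epsilon>"
    proof -
      have "\<exists>\<delta>>0. \<forall>y. dist y x < \<delta> \<longrightarrow> (\<exists>b\<in>{g x |R g. (R, g) \<in> \<C> \<and> x \<in> R}. dist (G y) b < \<epsilon>)"
        by (rule closed_cover_values) (fact C P eps)+
      then show thesis using that by blast
    qed
    have "dist (rot v) (rot w) = dist v w" for v w by (simp add: dist_norm rot_diff)
    then have "\<forall>y. dist y x < \<delta> \<longrightarrow> (\<exists>b\<in>V. dist (rot (G y)) b < \<epsilon>)"
      using \<delta>(2) unfolding V_def by (simp add: bex_simps(7))
    then show ?thesis using \<delta>(1) by blast
  qed
  have [measurable]: "(\<lambda>x. rot (G x)) \<in> borel_measurable borel" using G(1) by (rule rot_measurable)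
  have Gb: "norm (rot (G y)) \<le> B" for y using G(2) by simp
  have "a \<in> V"
    by (rule approx_one_sided_limit_value[OF _ Gb fV near ab(2,3)]) simp_all
  moreover have "b \<in> V"
    by (rule approx_one_sided_limit_value[OF _ Gb fV near _ ab(4)]) (simp_all add: ab(2))
  ultimately obtain R g R' g' where *: "(R, g) \<in> \<C>" "x \<in> R" "(R', g') \<in> \<C>" "x \<in> R'"
    "a = rot (g x)" "b = rot (g' x)"
    unfolding V_def by blast
  then show thesis
    using ab(1) by (intro that[of R g R' g']) (auto simp: Teq rot_diff)
qed

lemma jump_triple_jump_set: "x \<in> jump_set \<Omega> m \<Longrightarrow> is_jump_triple m x (jump_triple m x)"
  unfolding jump_set_def jump_triple_def by (auto intro: someI)

section \<open>Bounds for the line energy\<close>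

lemma hausdorff1_finite_null:
  assumes "finite P"
  shows "emeasure hausdorff1 P = 0"
proof -
  have "emeasure hausdorff1 {x} = 0" for x
  proof -
    have "hausdorff1_outer {x} \<le> ennreal (0 * (1 - 0))"
      by (rule hausdorff1_outer_le_graph[where g = "\<lambda>_. 0"]) auto
    then show ?thesis by (simp add: emeasure_hausdorff1)
  qed
  then have "(\<Sum>x\<in>P. emeasure hausdorff1 {x}) = 0" by simp
  moreover have "emeasure hausdorff1 P = (\<Sum>x\<in>P. emeasure hausdorff1 {x})"
    by (rule emeasure_eq_sum_singleton[OF assms]) simp
  ultimately show ?thesis by simp
qed

text \<open>The integrand is dominated pointwise by a Borel function before integrating. On the
  finite set \<open>P\<close> that function is infinite, which costs nothing on a null set and
  allows \<open>f\<close> to be infinite at whatever jump occurs at a vortex centre.\<close>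

lemma line_energy_le:
  assumes \<Gamma>: "\<Gamma> \<in> sets borel" and P: "finite P"
    and J: "\<And>x T. x \<in> \<Omega> \<Longrightarrow> x \<notin> P \<Longrightarrow> is_jump_triple m x T \<Longrightarrow> x \<in> \<Gamma> \<and> f (norm (fst T - fst (snd T))) \<le> S"
  shows "line_energy f \<Omega> m \<le> S * hausdorff1_outer \<Gamma>"
proof -
  have Pb: "P \<in> sets borel" using P by (simp add: finite_imp_closed borel_closed)
  have "line_energy f \<Omega> m \<le> (\<integral>\<^sup>+ x. S * indicator \<Gamma> x + \<infinity> * indicator P x \<partial>hausdorff1)"
    unfolding line_energy_def
  proof (rule nn_integral_mono)
    fix x
    show "f (norm (trace_plus m x - trace_minus m x)) * indicator (jump_set \<Omega> m) x
      \<le> S * indicator \<Gamma> x + \<infinity> * indicator P x"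
    proof (cases "x \<in> jump_set \<Omega> m \<and> x \<notin> P")
      case True
      then have "x \<in> \<Omega>" by (simp add: jump_set_def)
      then show ?thesis
        using J[OF _ _ jump_triple_jump_set, of x \<Omega>] True by (simp add: trace_plus_def trace_minus_def)
    qed (auto simp: indicator_def)
  qed
  also have "\<dots> = S * emeasure hausdorff1 \<Gamma> + \<infinity> * emeasure hausdorff1 P"
  proof (subst nn_integral_add)
    show "(\<lambda>x. S * indicator \<Gamma> x) \<in> borel_measurable hausdorff1"
      by (intro borel_measurable_times_ennreal measurable_const borel_measurable_indicator) (simp_all add: \<Gamma>)
    show "(\<lambda>x. \<infinity> * indicator P x :: ennreal) \<in> borel_measurable hausdorff1"
      by (intro borel_measurable_times_ennreal measurable_const borel_measurable_indicator) (simp_all add: Pb)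
  qed (use \<Gamma> Pb in \<open>simp_all add: nn_integral_cmult_indicator\<close>)
  also have "\<dots> = S * hausdorff1_outer \<Gamma>"
    using \<Gamma> by (simp add: hausdorff1_finite_null[OF P] emeasure_hausdorff1)
  finally show ?thesis .
qed

text \<open>The jump size is assumed for every triple because \<open>jump_triple\<close> selects one
  by choice.\<close>

lemma line_energy_ge:
  assumes \<Sigma>: "\<Sigma> \<in> sets borel" "\<Sigma> \<subseteq> jump_set \<Omega> m"
    and J: "\<And>x T. x \<in> \<Sigma> \<Longrightarrow> is_jump_triple m x T \<Longrightarrow> norm (fst T - fst (snd T)) = t"
  shows "f t * hausdorff1_outer \<Sigma> \<le> line_energy f \<Omega> m"
proof -
  have "f t * hausdorff1_outer \<Sigma> = (\<integral>\<^sup>+ x. f t * indicator \<Sigma> x \<partial>hausdorff1)"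
    using \<Sigma>(1) by (simp add: nn_integral_cmult_indicator emeasure_hausdorff1)
  also have "\<dots> \<le> line_energy f \<Omega> m"
    unfolding line_energy_def
  proof (rule nn_integral_mono)
    fix x
    show "f t * indicator \<Sigma> x \<le> f (norm (trace_plus m x - trace_minus m x)) * indicator (jump_set \<Omega> m) x"
    proof (cases "x \<in> \<Sigma>")
      case True
      then have "x \<in> jump_set \<Omega> m" using \<Sigma>(2) by blast
      then show ?thesis
        using J[OF True jump_triple_jump_set[of x \<Omega>]] True by (simp add: trace_plus_def trace_minus_def)
    qed simp
  qed
  finally show ?thesis .
qed

lemma approx_one_sided_limit_const:
  assumes "0 < \<delta>" "\<And>y. y \<in> half_ball x \<nu> \<delta> \<Longrightarrow> m y = a"
  shows "approx_one_sided_limit m x \<nu> a"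
  unfolding approx_one_sided_limit_def
proof (rule tendsto_eventually)
  show "\<forall>\<^sub>F r in at_right 0.
      (LINT y:half_ball x \<nu> r|lebesgue. norm (m y - a)) / measure lebesgue (half_ball x \<nu> r) = 0"
    unfolding eventually_at_right_field
  proof (intro exI[of _ \<delta>] conjI allI impI)
    fix r assume r: "0 < r" "r < \<delta>"
    have "(LINT y:half_ball x \<nu> r|lebesgue. norm (m y - a)) = (LINT y:half_ball x \<nu> r|lebesgue. 0)"
      unfolding set_lebesgue_integral_def
    proof (intro Bochner_Integration.integral_cong refl)
      fix y
      show "indicat_real (half_ball x \<nu> r) y *\<^sub>R norm (m y - a) = indicat_real (half_ball x \<nu> r) y *\<^sub>R 0"
        using assms(2)[of y] r by (auto simp: indicator_def half_ball_def)
    qed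
    then show "(LINT y:half_ball x \<nu> r|lebesgue. norm (m y - a)) / measure lebesgue (half_ball x \<nu> r) = 0"
      by (simp add: set_lebesgue_integral_def)
  qed (rule assms(1))
qed

section \<open>Fields near a wedge\<close>

lemma sgn_component: "sgn (y :: plane) $ i = y $ i / norm y"
  by (simp add: sgn_div_norm divide_inverse mult.commute)

lemma norm_plane: "norm (y :: plane) = sqrt ((y $ 1)\<^sup>2 + (y $ 2)\<^sup>2)"
  by (simp add: norm_vec_def L2_set_def UNIV_2)

lemma div_sqrt_mono:
  assumes "0 \<le> x" "x \<le> y"
  shows "x / sqrt (x\<^sup>2 + q\<^sup>2) \<le> y / sqrt (y\<^sup>2 + q\<^sup>2)"
proof (cases "x = 0")
  case False
  then have pos: "0 < x" "0 < y" using assms by auto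
  then have p: "0 < sqrt (x\<^sup>2 + q\<^sup>2)" "0 < sqrt (y\<^sup>2 + q\<^sup>2)" by (auto simp: add_pos_nonneg)
  have "x\<^sup>2 \<le> y\<^sup>2" using assms by (intro power_mono)
  then have "x\<^sup>2 * q\<^sup>2 \<le> y\<^sup>2 * q\<^sup>2" by (intro mult_right_mono) auto
  then have "x\<^sup>2 * (y\<^sup>2 + q\<^sup>2) \<le> y\<^sup>2 * (x\<^sup>2 + q\<^sup>2)" by (simp add: algebra_simps)
  then have "sqrt (x\<^sup>2 * (y\<^sup>2 + q\<^sup>2)) \<le> sqrt (y\<^sup>2 * (x\<^sup>2 + q\<^sup>2))" by (rule real_sqrt_le_mono)
  then have "x * sqrt (y\<^sup>2 + q\<^sup>2) \<le> y * sqrt (x\<^sup>2 + q\<^sup>2)" using pos by (simp add: real_sqrt_mult)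
  then show ?thesis using p by (simp add: field_simps)
qed (use assms in auto)

lemma monotone_either_div_sqrt:
  "monotone_either {..a} (\<lambda>t. (t - a) / sqrt ((t - a)\<^sup>2 + q\<^sup>2))"
  "monotone_either {a..} (\<lambda>t. (t - a) / sqrt ((t - a)\<^sup>2 + q\<^sup>2))"
proof -
  have "(x - a) / sqrt ((x - a)\<^sup>2 + q\<^sup>2) \<le> (y - a) / sqrt ((y - a)\<^sup>2 + q\<^sup>2)" if "x \<le> y" "y \<le> a" for x y
  proof -
    have "- ((a - x) / sqrt ((a - x)\<^sup>2 + q\<^sup>2)) \<le> - ((a - y) / sqrt ((a - y)\<^sup>2 + q\<^sup>2))"
      using div_sqrt_mono[of "a - y" "a - x" q] that by simp
    then show ?thesis
      unfolding minus_divide_left by (simp add: power2_commute[of x a] power2_commute[of y a])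
  qed
  then show "monotone_either {..a} (\<lambda>t. (t - a) / sqrt ((t - a)\<^sup>2 + q\<^sup>2))"
    by (simp add: monotone_either_def)
  have "(x - a) / sqrt ((x - a)\<^sup>2 + q\<^sup>2) \<le> (y - a) / sqrt ((y - a)\<^sup>2 + q\<^sup>2)" if "x \<le> y" "a \<le> x" for x y
    using div_sqrt_mono[of "x - a" "y - a" q] that by simp
  then show "monotone_either {a..} (\<lambda>t. (t - a) / sqrt ((t - a)\<^sup>2 + q\<^sup>2))"
    by (simp add: monotone_either_def)
qed

lemma monotone_either_const_div_sqrt:
  "monotone_either {..a} (\<lambda>t. q / sqrt ((t - a)\<^sup>2 + q\<^sup>2))"
  "monotone_either {a..} (\<lambda>t. q / sqrt ((t - a)\<^sup>2 + q\<^sup>2))"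
proof -
  have main: "\<bar>q\<bar> / sqrt (y\<^sup>2 + q\<^sup>2) \<le> \<bar>q\<bar> / sqrt (x\<^sup>2 + q\<^sup>2)" if "\<bar>x\<bar> \<le> \<bar>y\<bar>" for x y
  proof (cases "q = 0")
    case False
    have "x\<^sup>2 \<le> y\<^sup>2" using that by (simp add: abs_le_square_iff)
    then show ?thesis using False by (intro divide_left_mono) (auto simp: add_nonneg_pos)
  qed simp
  have q: "q / r = (if 0 \<le> q then \<bar>q\<bar> / r else - (\<bar>q\<bar> / r))" for r by simp
  have "monotone_either {..a} (\<lambda>t. \<bar>q\<bar> / sqrt ((t - a)\<^sup>2 + q\<^sup>2)) \<and> monotone_either {..a} (\<lambda>t. - (\<bar>q\<bar> / sqrt ((t - a)\<^sup>2 + q\<^sup>2)))"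
    "monotone_either {a..} (\<lambda>t. \<bar>q\<bar> / sqrt ((t - a)\<^sup>2 + q\<^sup>2)) \<and> monotone_either {a..} (\<lambda>t. - (\<bar>q\<bar> / sqrt ((t - a)\<^sup>2 + q\<^sup>2)))"
    unfolding monotone_either_def using main by auto
  then show "monotone_either {..a} (\<lambda>t. q / sqrt ((t - a)\<^sup>2 + q\<^sup>2))"
    "monotone_either {a..} (\<lambda>t. q / sqrt ((t - a)\<^sup>2 + q\<^sup>2))"
    unfolding q by (cases "0 \<le> q"; simp)+
qed

text \<open>On a line at distance \<open>\<bar>q\<bar>\<close> from \<open>p\<close>, with
  \<open>t\<close> measured from the foot of the perpendicular, the components are
  \<open>t / sqrt (t^2 + q^2)\<close>, which is increasing, and \<open>q / sqrt (t^2 + q^2)\<close>,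
  which changes its sense only at \<open>t = 0\<close>.\<close>

lemma linewise_monotone_sgn: "linewise_monotone p (\<lambda>x. sgn (x - p) $ i)"
  unfolding linewise_monotone_def
proof (intro conjI allI)
  show "(\<lambda>x. sgn (x - p) $ i) \<in> borel_measurable borel"
    unfolding sgn_component by measurable
  show "\<bar>sgn (x - p) $ i\<bar> \<le> 1" for x
    using component_le_norm_cart[of "sgn (x - p)" i] norm_sgn[of "x - p"] by (auto split: if_splits)
  fix j r
  have eq: "(\<lambda>t. sgn (plane_line j r t - p) $ i) = (\<lambda>t. (if i = j then t - p $ j else r - p $ i) /
      sqrt ((t - p $ j)\<^sup>2 + (r - p $ (if j = 1 then 2 else 1))\<^sup>2))"
    using exhaust_2[of j] by (auto simp: fun_eq_iff sgn_component norm_plane plane_line_component add.commute)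
  have other: "i \<noteq> j \<Longrightarrow> i = (if j = 1 then 2 else 1)" using exhaust_2[of i] exhaust_2[of j] by auto
  have "monotone_either {..p $ j} (\<lambda>t. sgn (plane_line j r t - p) $ i) \<and>
    monotone_either {p $ j..} (\<lambda>t. sgn (plane_line j r t - p) $ i)"
  proof (cases "i = j")
    case True
    then show ?thesis unfolding eq using monotone_either_div_sqrt by simp
  next
    case False
    then show ?thesis unfolding eq other[OF False, symmetric] using monotone_either_const_div_sqrt by simp
  qed
  then show "monotone_either {..p $ j} (\<lambda>t. sgn (plane_line j r t - p) $ i)"
    "monotone_either {p $ j..} (\<lambda>t. sgn (plane_line j r t - p) $ i)" by auto
qed

lemma sgn_plane_measurable: "(sgn :: plane \<Rightarrow> plane) \<in> borel_measurable borel"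
  unfolding sgn_div_norm by measurable

lemma has_derivative_norm_sgn:
  "x \<noteq> (0 :: plane) \<Longrightarrow> (norm has_derivative (\<lambda>h. sgn x \<bullet> h)) (at x)"
  using has_derivative_norm[of x] by (simp add: inner_commute)

lemma norm_potential: "is_potential norm sgn"
proof -
  have "1-lipschitz_on UNIV (norm :: plane \<Rightarrow> real)"
    by (intro lipschitz_onI) (auto simp: dist_norm norm_triangle_ineq3)
  moreover have "negligible {x::plane. \<not> (norm has_derivative (\<bullet>) (sgn x)) (at x)}"
    by (rule negligible_subset[OF negligible_sing[of 0]]) (auto intro: has_derivative_norm_sgn)
  moreover have "norm (sgn x :: plane) \<le> 1" for x by (simp add: norm_sgn)
  ultimately show ?thesis unfolding is_potential_def using sgn_plane_measurable by auto
qed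

lemma bounded_subset_cball_at:
  assumes "bounded S"
  obtains R where "0 \<le> R" "S \<subseteq> cball p R"
proof -
  obtain R where R: "\<forall>y\<in>S. dist p y \<le> R" using assms bounded_any_center[of S p] by blast
  then show thesis by (intro that[of "\<bar>R\<bar>"]) force+
qed

locale wedge =
  fixes s c :: real
  assumes s_pos: "0 < s" and c_nonneg: "0 \<le> c" and sc: "s\<^sup>2 + c\<^sup>2 = 1"
begin

text \<open>The gradient of \<open>wpot\<close>. On the axis the value from the right is taken, so
  that the length is 1 everywhere.\<close>

definition edir :: "plane \<Rightarrow> plane" where
  "edir y = vector [if y $ 1 < 0 then - s else s, c]"

definition wpot :: "plane \<Rightarrow> real" where
  "wpot y = c * y $ 2 + s * \<bar>y $ 1\<bar>"

lemma edir_component: "edir y $ 1 = (if y $ 1 < 0 then - s else s)" "edir y $ 2 = c"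
  by (simp_all add: edir_def)

lemma s_le_1: "s \<le> 1" and c_le_1: "c \<le> 1"
proof -
  have "s\<^sup>2 \<le> 1" "c\<^sup>2 \<le> 1" using sc zero_le_power2[of c] zero_le_power2[of s] by linarith+
  then show "s \<le> 1" "c \<le> 1" using power2_le_imp_le[of s 1] power2_le_imp_le[of c 1] by simp_all
qed

lemma norm_edir [simp]: "norm (edir y) = 1"
  using sc by (simp add: norm_plane edir_component)

lemma wpot_inner: "wpot y = edir y \<bullet> y"
  by (simp add: wpot_def inner_vec_def UNIV_2 edir_component)

lemma wpot_le_norm: "wpot y \<le> norm y"
  using norm_cauchy_schwarz[of "edir y" y] by (simp add: wpot_inner)

lemma wpot_lipschitz: "\<bar>wpot y - wpot z\<bar> \<le> 2 * norm (y - z)"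
proof -
  have "wpot y - wpot z = c * (y $ 2 - z $ 2) + s * (\<bar>y $ 1\<bar> - \<bar>z $ 1\<bar>)"
    by (simp add: wpot_def algebra_simps)
  also have "\<bar>\<dots>\<bar> \<le> c * \<bar>y $ 2 - z $ 2\<bar> + s * \<bar>\<bar>y $ 1\<bar> - \<bar>z $ 1\<bar>\<bar>"
    using abs_triangle_ineq[of "c * (y $ 2 - z $ 2)" "s * (\<bar>y $ 1\<bar> - \<bar>z $ 1\<bar>)"] s_pos c_nonneg
    by (simp add: abs_mult)
  also have "\<dots> \<le> 1 * norm (y - z) + 1 * norm (y - z)"
  proof (intro add_mono mult_mono)
    show "\<bar>y $ 2 - z $ 2\<bar> \<le> norm (y - z)" using component_le_norm_cart[of "y - z" 2] by simp
    show "\<bar>\<bar>y $ 1\<bar> - \<bar>z $ 1\<bar>\<bar> \<le> norm (y - z)"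
      using component_le_norm_cart[of "y - z" 1] abs_triangle_ineq3[of "y $ 1" "z $ 1"] by simp
  qed (use s_pos s_le_1 c_le_1 in auto)
  finally show ?thesis by simp
qed

lemma wpot_has_derivative:
  assumes "y $ 1 \<noteq> 0"
  shows "(wpot has_derivative (\<lambda>h. edir y \<bullet> h)) (at y)"
proof -
  have "((\<lambda>z. edir y \<bullet> z) has_derivative (\<lambda>h. edir y \<bullet> h)) (at y)"
    by (auto intro!: derivative_eq_intros)
  then show ?thesis
  proof (rule has_derivative_transform_within_open)
    show "open {z :: plane. 0 < z $ 1 * y $ 1}" by (intro open_Collect_less continuous_intros)
    show "y \<in> {z :: plane. 0 < z $ 1 * y $ 1}" using assms zero_less_power2[of "y $ 1"] by (simp add: power2_eq_square)
    fix z :: plane assume "z \<in> {z. 0 < z $ 1 * y $ 1}"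
    then have "edir y = edir z" by (auto simp: edir_def zero_less_mult_iff)
    then show "edir y \<bullet> z = wpot z" by (simp add: wpot_inner)
  qed
qed

lemma edir_measurable: "edir \<in> borel_measurable borel"
proof -
  have eq: "edir = (\<lambda>y. if y \<in> {y. y $ 1 < 0} then vector [- s, c] else vector [s, c])"
    by (auto simp: edir_def fun_eq_iff)
  have "open {y :: plane. y $ 1 < 0}" by (intro open_Collect_less continuous_intros)
  then have "{y :: plane. y $ 1 < 0} \<inter> space borel \<in> sets borel" by simp
  then show ?thesis unfolding eq by (intro measurable_If_set measurable_const) auto
qed

lemma edir_potential: "is_potential wpot edir"
proof -
  have "2-lipschitz_on UNIV wpot"
    using wpot_lipschitz by (intro lipschitz_onI) (auto simp: dist_norm)
  moreover have "negligible {x. \<not> (wpot has_derivative (\<bullet>) (edir x)) (at x)}"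
    by (rule negligible_subset[OF negligible_standard_hyperplane_cart[of 1]]) (auto intro: wpot_has_derivative)
  moreover have "\<exists>B. \<forall>x. norm (edir x) \<le> B" by (rule exI[of _ 1]) simp
  ultimately show ?thesis
    unfolding is_potential_def using edir_measurable by blast
qed

lemma linewise_monotone_edir: "linewise_monotone p (\<lambda>x. edir (x - p) $ i)"
  unfolding linewise_monotone_def
proof (intro conjI allI)
  show "(\<lambda>x. edir (x - p) $ i) \<in> borel_measurable borel"
    using edir_measurable by measurable
  show "\<bar>edir (x - p) $ i\<bar> \<le> 1" for x
    using component_le_norm_cart[of "edir (x - p)" i] by simp
  fix j r
  show "monotone_either {..p $ j} (\<lambda>t. edir (plane_line j r t - p) $ i)"
    "monotone_either {p $ j..} (\<lambda>t. edir (plane_line j r t - p) $ i)"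
    using exhaust_2[of i] exhaust_2[of j] s_pos
    by (auto simp: monotone_either_def edir_component plane_line_component)
qed

section \<open>The sector and the cells\<close>

definition sector :: "plane set" where
  "sector = {y. c * \<bar>y $ 1\<bar> \<le> s * y $ 2}"

text \<open>On the two rays \<open>y\<close> is a nonnegative multiple of \<open>edir y\<close>. So
  the wedge and the vortex agree there both in their potentials and in their gradients, and gluing
  them along the rays creates no jump.\<close>

lemma sector_boundary:
  assumes "c * \<bar>y $ 1\<bar> = s * y $ 2"
  shows "wpot y = norm y" "y \<noteq> 0 \<Longrightarrow> edir y = sgn y"
proof -
  define r where "r = \<bar>y $ 1\<bar> / s"
  have r: "\<bar>y $ 1\<bar> = s * r" "0 \<le> r" using s_pos by (auto simp: r_def)
  have "y $ 2 = c * r" using assms s_pos by (simp add: r_def field_simps)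
  then have y: "y = r *\<^sub>R edir y"
    using r by (auto simp: vec_eq_iff forall_2 edir_component abs_if mult.commute split: if_splits)
  have n: "norm y = r" using r(2) arg_cong[OF y, of norm] by simp
  have "wpot y = r * (edir y \<bullet> edir y)"
    unfolding wpot_inner by (metis y inner_scaleR_right)
  then show "wpot y = norm y" using n by (simp add: dot_square_norm)
  show "edir y = sgn y" if "y \<noteq> 0"
  proof -
    have "r \<noteq> 0" using that n by auto
    then show ?thesis using y n by (metis sgn_div_norm scaleR_scaleR left_inverse scaleR_one)
  qed
qed

text \<open>The equality case of the Cauchy-Schwarz inequality for \<open>edir y\<close> and
  \<open>y\<close>.\<close>

lemma wpot_eq_norm:
  assumes "wpot y = norm y"
  shows "c * \<bar>y $ 1\<bar> = s * y $ 2"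
proof -
  have "edir y \<bullet> y = norm (edir y) * norm y" using assms by (simp add: wpot_inner)
  then have y: "y = norm y *\<^sub>R edir y" unfolding norm_cauchy_schwarz_eq by simp
  have y1: "y $ 1 = norm y * edir y $ 1" and "y $ 2 = norm y * c"
    using arg_cong[OF y, of "\<lambda>v. v $ 1"] arg_cong[OF y, of "\<lambda>v. v $ 2"] by (simp_all add: edir_component)
  have "\<bar>y $ 1\<bar> = \<bar>norm y * edir y $ 1\<bar>" by (rule arg_cong[OF y1])
  also have "\<dots> = norm y * s" using s_pos by (simp add: edir_component abs_mult)
  finally show ?thesis using \<open>y $ 2 = norm y * c\<close> by simp
qed

lemma sector_closed_convex: "closed sector" "convex sector"
proof -
  show "closed sector" unfolding sector_def by (intro closed_Collect_le continuous_intros)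
  have "c * \<bar>a\<bar> \<le> b \<longleftrightarrow> c * a \<le> b \<and> - (c * a) \<le> b" for a b
    using c_nonneg by (metis abs_le_iff abs_mult abs_of_nonneg)
  then have "sector = {y. vector [c, - s] \<bullet> y \<le> 0} \<inter> {y. vector [- c, - s] \<bullet> y \<le> 0}"
    by (auto simp: sector_def inner_vec_def UNIV_2)
  then show "convex sector" by (simp add: convex_Int convex_halfspace_le)
qed

lemma frontier_sector: "y \<in> frontier sector \<Longrightarrow> c * \<bar>y $ 1\<bar> = s * y $ 2"
proof (rule ccontr)
  assume y: "y \<in> frontier sector" and n: "c * \<bar>y $ 1\<bar> \<noteq> s * y $ 2"
  have "y \<in> sector" using y sector_closed_convex(1) by (simp add: frontier_def)
  then have "y \<in> {y. c * \<bar>y $ 1\<bar> < s * y $ 2}" using n by (simp add: sector_def)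
  moreover have "open {y :: plane. c * \<bar>y $ 1\<bar> < s * y $ 2}" by (intro open_Collect_less continuous_intros)
  ultimately have "y \<in> interior sector" by (intro interiorI) (auto simp: sector_def)
  then show False using y by (simp add: frontier_def)
qed

text \<open>The correction that turns a vortex at the origin into the wedge inside the sector. Its
  potential \<open>wpot y - norm y\<close> vanishes on the rays.\<close>

definition sector_field :: "plane \<Rightarrow> plane" where
  "sector_field y = (if y \<in> sector then edir y - sgn y else 0)"

lemma sector_field_potential: "\<exists>u. is_potential u sector_field"
proof -
  have m: "(\<lambda>y. edir y - sgn y) \<in> borel_measurable borel"
    using edir_measurable sgn_plane_measurable by measurable
  have "is_potential (\<lambda>y. if y \<in> sector then wpot y - norm y else 0) (\<lambda>y. if y \<in> sector then edir y - sgn y else 0)"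
  proof (rule is_potential_extend_by_zero[OF sector_closed_convex, where L = 3 and B = 2])
    show "3-lipschitz_on sector (\<lambda>y. wpot y - norm y)"
    proof (rule lipschitz_onI)
      fix y z :: plane
      show "dist (wpot y - norm y) (wpot z - norm z) \<le> 3 * dist y z"
        using wpot_lipschitz[of y z] norm_triangle_ineq3[of y z] by (simp add: dist_norm)
    qed simp
    show "wpot y - norm y = 0" if "y \<in> frontier sector" for y
      using sector_boundary(1)[OF frontier_sector[OF that]] by simp
    show "norm (edir y - sgn y) \<le> 2" for y
      using norm_triangle_ineq4[of "edir y" "sgn y"] by (simp add: norm_sgn split: if_splits)
    show "negligible {x \<in> interior sector. \<not> ((\<lambda>y. wpot y - norm y) has_derivative (\<bullet>) (edir x - sgn x)) (at x)}"
    proof (rule negligible_subset[OF negligible_standard_hyperplane_cart[of 1]], rule subsetI, rule ccontr)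
      fix x assume x: "x \<in> {x \<in> interior sector. \<not> ((\<lambda>y. wpot y - norm y) has_derivative (\<bullet>) (edir x - sgn x)) (at x)}"
        "x \<notin> {y. y $ 1 = 0}"
      have "((\<lambda>y. wpot y - norm y) has_derivative (\<lambda>h. edir x \<bullet> h - sgn x \<bullet> h)) (at x)"
        by (intro has_derivative_diff wpot_has_derivative has_derivative_norm_sgn) (use x in auto)
      moreover have "(\<lambda>h. edir x \<bullet> h - sgn x \<bullet> h) = (\<bullet>) (edir x - sgn x)"
        by (simp add: fun_eq_iff inner_diff_left)
      ultimately show False using x by simp
    qed
  qed (rule m)
  then show ?thesis unfolding sector_field_def[abs_def] by blast
qed

text \<open>The part of the sector where \<open>wpot\<close> is at most
  \<open>min (norm y) (H * (1 + c) - norm y)\<close>; the comparison with \<open>norm y\<close>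
  holds everywhere, so only the other one appears.\<close>

definition cell :: "real \<Rightarrow> plane set" where
  "cell H = {y \<in> sector. norm y + wpot y \<le> H * (1 + c)}"

text \<open>The gradient of \<open>min (norm y) (H * (1 + c) - norm y)\<close>, which changes sign
  on the circle where the two functions are equal.\<close>

definition cell_dir :: "real \<Rightarrow> plane \<Rightarrow> plane" where
  "cell_dir H y = (if 2 * norm y \<le> H * (1 + c) then sgn y else - sgn y)"

definition cell_field :: "real \<Rightarrow> plane \<Rightarrow> plane" where
  "cell_field H y = (if y \<in> cell H then cell_dir H y - edir y else 0)"

lemma wpot_max: "wpot y = max (vector [s, c] \<bullet> y) (vector [- s, c] \<bullet> y)"
proof -
  have "s * \<bar>y $ 1\<bar> = \<bar>s * y $ 1\<bar>" using s_pos by (simp add: abs_mult)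
  then show ?thesis by (simp add: wpot_def inner_vec_def UNIV_2 max_def abs_if)
qed

lemma convex_norm_inner_le: "convex {y :: plane. norm y + a \<bullet> y \<le> K}"
proof (rule convexI)
  fix x y :: plane and u w :: real
  assume xy: "x \<in> {y. norm y + a \<bullet> y \<le> K}" "y \<in> {y. norm y + a \<bullet> y \<le> K}" and u: "0 \<le> u" "0 \<le> w" "u + w = 1"
  have "norm (u *\<^sub>R x + w *\<^sub>R y) \<le> u * norm x + w * norm y"
    using norm_triangle_ineq[of "u *\<^sub>R x" "w *\<^sub>R y"] u by simp
  then have "norm (u *\<^sub>R x + w *\<^sub>R y) + a \<bullet> (u *\<^sub>R x + w *\<^sub>R y) \<le> u * (norm x + a \<bullet> x) + w * (norm y + a \<bullet> y)"
    by (simp add: inner_add_right algebra_simps)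
  also have "\<dots> \<le> u * K + w * K" using xy u by (intro add_mono mult_left_mono) auto
  also have "\<dots> = K" using u by (metis distrib_right mult_1)
  finally show "u *\<^sub>R x + w *\<^sub>R y \<in> {y. norm y + a \<bullet> y \<le> K}" by simp
qed

text \<open>\<open>wpot\<close> is the maximum of two linear functions, so
  \<open>norm y + wpot y\<close> is convex and the cell is the intersection of the convex sector
  with sublevel sets. Convexity serves twice: for the extension by zero and for the
  variation.\<close>

lemma cell_closed_convex: "closed (cell H)" "convex (cell H)"
proof -
  have "cell H = sector \<inter> {y. norm y + wpot y \<le> H * (1 + c)}" by (auto simp: cell_def)
  moreover have "closed {y. norm y + wpot y \<le> H * (1 + c)}"
    unfolding wpot_def by (intro closed_Collect_le continuous_intros)
  ultimately show "closed (cell H)" using sector_closed_convex(1) by (simp add: closed_Int)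
  have "cell H = sector \<inter> ({y. norm y + vector [s, c] \<bullet> y \<le> H * (1 + c)} \<inter> {y. norm y + vector [- s, c] \<bullet> y \<le> H * (1 + c)})"
    by (auto simp: cell_def wpot_max)
  then show "convex (cell H)"
    by (simp add: convex_Int sector_closed_convex convex_norm_inner_le)
qed

lemma closed_cell_translate: "closed {x. x - q \<in> cell H}"
  unfolding cell_def sector_def mem_Collect_eq wpot_def
  by (intro closed_Collect_conj closed_Collect_le continuous_intros)

lemma frontier_cell:
  assumes "y \<in> frontier (cell H)"
  shows "c * \<bar>y $ 1\<bar> = s * y $ 2 \<or> norm y + wpot y = H * (1 + c)"
proof (rule ccontr)
  assume n: "\<not> ?thesis"
  have "y \<in> cell H" using assms cell_closed_convex(1) by (simp add: frontier_def)
  then have "y \<in> {y. c * \<bar>y $ 1\<bar> < s * y $ 2} \<inter> {y. norm y + wpot y < H * (1 + c)}"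
    using n by (auto simp: cell_def sector_def)
  moreover have "open ({y :: plane. c * \<bar>y $ 1\<bar> < s * y $ 2} \<inter> {y. norm y + wpot y < H * (1 + c)})"
    unfolding wpot_def by (intro open_Int open_Collect_less continuous_intros)
  moreover have "{y :: plane. c * \<bar>y $ 1\<bar> < s * y $ 2} \<inter> {y. norm y + wpot y < H * (1 + c)} \<subseteq> cell H"
    by (auto simp: cell_def sector_def)
  ultimately have "y \<in> interior (cell H)" by (intro interiorI)
  then show False using assms by (simp add: frontier_def)
qed

text \<open>From \<open>y $ 2 \<le> norm y\<close>. The height \<open>H\<close> is reached only on
  the axis, so that two stacked cells share at most the base point of the upper one.\<close>

lemma cell_height:
  assumes y: "y \<in> cell H"
  shows "0 \<le> y $ 2" "y $ 2 \<le> H" "y $ 2 = H \<Longrightarrow> y $ 1 = 0"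
proof -
  have "0 \<le> c * \<bar>y $ 1\<bar>" using c_nonneg by simp
  then have "0 \<le> s * y $ 2" using y unfolding cell_def sector_def by auto
  then show y0: "0 \<le> y $ 2" using s_pos by (simp add: zero_le_mult_iff)
  have "y $ 2 \<le> norm y" using component_le_norm_cart[of y 2] by simp
  then have *: "y $ 2 * (1 + c) + s * \<bar>y $ 1\<bar> \<le> H * (1 + c)"
    using y by (simp add: cell_def wpot_def algebra_simps)
  moreover have "0 \<le> s * \<bar>y $ 1\<bar>" using s_pos by simp
  ultimately have "y $ 2 * (1 + c) \<le> H * (1 + c)" by linarith
  then show "y $ 2 \<le> H" using c_nonneg by (simp add: mult_le_cancel_right)
  show "y $ 1 = 0" if "y $ 2 = H"
  proof -
    have "s * \<bar>y $ 1\<bar> \<le> 0" using * that by simp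
    then show ?thesis using s_pos by (simp add: mult_le_0_iff)
  qed
qed

lemma cell_norm: "y \<in> cell H \<Longrightarrow> norm y \<le> H * (1 + c)"
proof -
  assume y: "y \<in> cell H"
  have "0 \<le> wpot y" using cell_height(1)[OF y] s_pos c_nonneg by (simp add: wpot_def)
  then show ?thesis using y by (simp add: cell_def)
qed

lemma cell_dir_measurable: "cell_dir H \<in> borel_measurable borel"
proof -
  have "cell_dir H = (\<lambda>y. if y \<in> {y. 2 * norm y \<le> H * (1 + c)} then sgn y else - sgn y)"
    by (auto simp: cell_dir_def fun_eq_iff)
  moreover have "closed {y :: plane. 2 * norm y \<le> H * (1 + c)}" by (intro closed_Collect_le continuous_intros)
  then have [measurable]: "{y :: plane. 2 * norm y \<le> H * (1 + c)} \<in> sets borel" by simp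
  have "(\<lambda>y :: plane. if y \<in> {y. 2 * norm y \<le> H * (1 + c)} then sgn y else - sgn y) \<in> borel_measurable borel"
    using sgn_plane_measurable by measurable
  ultimately show ?thesis by simp
qed

lemma cell_field_potential: "\<exists>u. is_potential u (cell_field H)"
proof -
  define K where "K = H * (1 + c) / 2"
  \<comment> \<open>\<open>K - \<bar>r - K\<bar>\<close> is \<open>min r (2 * K - r)\<close>; this
    form shows the Lipschitz bound at once.\<close>
  define h where "h y = K - \<bar>norm y - K\<bar> - wpot y" for y
  have "is_potential (\<lambda>y. if y \<in> cell H then h y else 0) (\<lambda>y. if y \<in> cell H then cell_dir H y - edir y else 0)"
  proof (rule is_potential_extend_by_zero[OF cell_closed_convex, where L = 3 and B = 2])
    show "3-lipschitz_on (cell H) h"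
    proof (rule lipschitz_onI)
      fix y z :: plane
      show "dist (h y) (h z) \<le> 3 * dist y z"
        using wpot_lipschitz[of y z] norm_triangle_ineq3[of y z] by (auto simp: dist_norm h_def abs_if split: if_splits)
    qed simp
    \<comment> \<open>On the rays \<open>wpot y = norm y\<close>, so membership in the cell gives
      \<open>norm y \<le> K\<close> and \<open>h y = norm y - wpot y\<close>. On the remaining
      boundary \<open>wpot y \<le> norm y\<close> gives \<open>K \<le> norm y\<close>, and
      \<open>h y = 2 * K - norm y - wpot y\<close>. Both are 0.\<close>
    show "h y = 0" if "y \<in> frontier (cell H)" for y
    proof -
      have y: "y \<in> cell H" using that cell_closed_convex(1) by (simp add: frontier_def)
      have "norm y \<le> K" if "wpot y = norm y" using y that by (simp add: cell_def K_def)
      moreover have "K \<le> norm y" if "norm y + wpot y = 2 * K"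
        using wpot_le_norm[of y] that by simp
      ultimately show ?thesis
        using frontier_cell[OF that] sector_boundary(1)[of y] by (auto simp: h_def K_def)
    qed
    show "(\<lambda>y. cell_dir H y - edir y) \<in> borel_measurable borel"
      using edir_measurable cell_dir_measurable by measurable
    show "norm (cell_dir H y - edir y) \<le> 2" for y
      using norm_triangle_ineq4[of "cell_dir H y" "edir y"] by (simp add: cell_dir_def norm_sgn split: if_splits)
    have neg: "negligible ({y. y $ 1 = 0} \<union> sphere 0 K \<union> {0 :: plane})"
      by (intro negligible_Un negligible_standard_hyperplane_cart negligible_sphere negligible_sing)
    show "negligible {x \<in> interior (cell H). \<not> (h has_derivative (\<bullet>) (cell_dir H x - edir x)) (at x)}"
    proof (rule negligible_subset[OF neg], rule subsetI, rule ccontr)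
      fix x assume x: "x \<in> {x \<in> interior (cell H). \<not> (h has_derivative (\<bullet>) (cell_dir H x - edir x)) (at x)}"
        "x \<notin> {y. y $ 1 = 0} \<union> sphere 0 K \<union> {0}"
      then have x1: "x $ 1 \<noteq> 0" "norm x \<noteq> K" "x \<noteq> 0" by auto
      have dn: "(norm has_derivative (\<bullet>) (sgn x)) (at x)" using x1(3) by (rule has_derivative_norm_sgn)
      consider "norm x < K" | "K < norm x" using x1 by linarith
      then have "(h has_derivative (\<lambda>h. (cell_dir H x - edir x) \<bullet> h)) (at x)"
      proof cases
        case 1
        have "((\<lambda>y. norm y - wpot y) has_derivative (\<lambda>h. sgn x \<bullet> h - edir x \<bullet> h)) (at x)"
          by (intro has_derivative_diff wpot_has_derivative dn x1)
        then have "(h has_derivative (\<lambda>h. sgn x \<bullet> h - edir x \<bullet> h)) (at x)"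
        proof (rule has_derivative_transform_within_open)
          show "open {y :: plane. norm y < K}" by (intro open_Collect_less continuous_intros)
        qed (use 1 in \<open>auto simp: h_def\<close>)
        moreover have "(\<lambda>h. sgn x \<bullet> h - edir x \<bullet> h) = (\<bullet>) (cell_dir H x - edir x)"
          using 1 by (simp add: fun_eq_iff inner_diff_left cell_dir_def K_def)
        ultimately show ?thesis by simp
      next
        case 2
        have "((\<lambda>y. 2 * K - norm y - wpot y) has_derivative (\<lambda>h. 0 - sgn x \<bullet> h - edir x \<bullet> h)) (at x)"
          by (intro has_derivative_diff wpot_has_derivative dn x1 has_derivative_const)
        then have "(h has_derivative (\<lambda>h. 0 - sgn x \<bullet> h - edir x \<bullet> h)) (at x)"
        proof (rule has_derivative_transform_within_open)
          show "open {y :: plane. K < norm y}" by (intro open_Collect_less continuous_intros)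
        qed (use 2 in \<open>auto simp: h_def\<close>)
        moreover have "(\<lambda>h. 0 - sgn x \<bullet> h - edir x \<bullet> h) = (\<bullet>) (cell_dir H x - edir x)"
          using 2 by (simp add: fun_eq_iff inner_diff_left cell_dir_def K_def)
        ultimately show ?thesis by simp
      qed
      then show False using x by simp
    qed
  qed
  then show ?thesis unfolding cell_field_def[abs_def] by blast
qed

section \<open>Variation of the building blocks\<close>

lemma sector_field_bv:
  assumes "bounded \<Omega>"
  shows "\<exists>M. bv_field \<Omega> M (\<lambda>x. sector_field (x - p))"
proof -
  obtain R where R: "0 \<le> R" "\<Omega> \<subseteq> cball p R"
    using bounded_subset_cball_at[OF assms] by blast
  define A where "A = (+) p ` sector"
  have A: "closed A" "convex A" "A \<inter> \<Omega> \<subseteq> cball p R"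
    using R sector_closed_convex by (auto simp: A_def closed_translation convex_translation)
  have memA: "x \<in> A \<longleftrightarrow> x - p \<in> sector" for x by (force simp: A_def image_iff)
  have 1: "bv_field \<Omega> (16 * R) (\<lambda>x. if x \<in> A then edir (x - p) else 0)"
    by (rule bv_field_piece[OF A R(1)]) (rule linewise_monotone_edir)
  have 2: "bv_field \<Omega> (16 * R) (\<lambda>x. if x \<in> A then sgn (x - p) else 0)"
    by (rule bv_field_piece[OF A R(1)]) (rule linewise_monotone_sgn)
  have "bv_field \<Omega> (16 * R + 16 * R) (\<lambda>x. sector_field (x - p))"
    by (rule bv_field_cong[OF bv_field_add[OF 1 bv_field_uminus[OF 2]]]) (simp add: sector_field_def memA)
  then show ?thesis by blast
qed

text \<open>The cell has radius at most \<open>2 * H\<close>, so every convex piece costs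
  \<open>32 * H\<close>. Linearity in \<open>H\<close> is essential: \<open>N\<close> cells of size
  \<open>l / N\<close> together cost the same for every positive \<open>N\<close>.\<close>

lemma cell_field_bv:
  assumes H: "0 \<le> H"
  shows "bv_field \<Omega> (128 * H) (\<lambda>x. cell_field H (x - p))"
proof -
  define A where "A = (+) p ` cell H"
  define B where "B = A \<inter> cball p (H * (1 + c) / 2)"
  have "H * (1 + c) \<le> 2 * H" using H c_le_1 mult_left_mono[of "1 + c" 2 H] by simp
  then have "cell H \<subseteq> cball 0 (2 * H)" using cell_norm by force
  then have A: "closed A" "convex A" "A \<inter> \<Omega> \<subseteq> cball p (2 * H)" "0 \<le> 2 * H"
    using H cell_closed_convex by (auto simp: A_def closed_translation convex_translation dist_norm)
  have memA: "x \<in> A \<longleftrightarrow> x - p \<in> cell H" for x by (force simp: A_def image_iff)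
  have B: "closed B" "convex B" "B \<inter> \<Omega> \<subseteq> cball p (2 * H)" "0 \<le> 2 * H"
    using A by (auto simp: B_def convex_Int)
  have memB: "x \<in> B \<longleftrightarrow> x - p \<in> cell H \<and> 2 * norm (x - p) \<le> H * (1 + c)" for x
    by (auto simp: B_def memA dist_norm norm_minus_commute)
  have 1: "bv_field \<Omega> (16 * (2 * H)) (\<lambda>x. if x \<in> A then edir (x - p) else 0)"
    by (rule bv_field_piece[OF A]) (rule linewise_monotone_edir)
  have 2: "bv_field \<Omega> (16 * (2 * H)) (\<lambda>x. if x \<in> A then sgn (x - p) else 0)"
    by (rule bv_field_piece[OF A]) (rule linewise_monotone_sgn)
  have 3: "bv_field \<Omega> (16 * (2 * H)) (\<lambda>x. if x \<in> B then sgn (x - p) else 0)"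
    by (rule bv_field_piece[OF B]) (rule linewise_monotone_sgn)
  \<comment> \<open>The flipped region is not convex. The flip is therefore written as
    \<open>- sgn\<close> on the whole cell plus \<open>2 * sgn\<close> on the part \<open>B\<close>
    inside the circle, which is convex.\<close>
  have "bv_field \<Omega> ((16 * (2 * H) + 16 * (2 * H)) + \<bar>2\<bar> * (16 * (2 * H))) (\<lambda>x. cell_field H (x - p))"
    by (rule bv_field_cong[OF bv_field_add[OF bv_field_add[OF bv_field_uminus[OF 1] bv_field_uminus[OF 2]]
          bv_field_scale[OF 3, of 2]]])
      (auto simp: cell_field_def cell_dir_def memA memB scaleR_2)
  then show ?thesis by simp
qed

lemma sgn_bv:
  assumes "bounded \<Omega>"
  shows "\<exists>M. bv_field \<Omega> M (\<lambda>x. sgn (x - p))"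
proof -
  obtain R where R: "0 \<le> R" "\<Omega> \<subseteq> cball p R"
    using bounded_subset_cball_at[OF assms] by blast
  have "bv_field \<Omega> (16 * R) (\<lambda>x. if x \<in> UNIV then sgn (x - p) else 0)"
    by (rule bv_field_piece) (use R linewise_monotone_sgn in auto)
  then show ?thesis by auto
qed

lemma edir_bv:
  assumes "bounded \<Omega>"
  shows "\<exists>M. bv_field \<Omega> M (\<lambda>x. edir (x - p))"
proof -
  obtain R where R: "0 \<le> R" "\<Omega> \<subseteq> cball p R"
    using bounded_subset_cball_at[OF assms] by blast
  have "bv_field \<Omega> (16 * R) (\<lambda>x. if x \<in> UNIV then edir (x - p) else 0)"
    by (rule bv_field_piece) (use R linewise_monotone_edir in auto)
  then show ?thesis by auto
qed

end

section \<open>The oscillating fields\<close>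

locale wedge_cells = wedge s c for s c :: real +
  fixes p :: plane and l :: real
  assumes c_pos: "0 < c" and l_pos: "0 < l"
begin

definition pt :: "real \<Rightarrow> plane" where
  "pt a = p + vector [0, a]"

lemma pt_component: "pt a $ 1 = p $ 1" "pt a $ 2 = p $ 2 + a"
  by (simp_all add: pt_def)

lemma pt_0: "pt 0 = p"
  by (simp add: pt_def vec_eq_iff forall_2)

lemma eq_pt_iff: "x = pt a \<longleftrightarrow> x $ 1 = p $ 1 \<and> x $ 2 = p $ 2 + a"
  by (auto simp: pt_def vec_eq_iff forall_2)

lemma edir_pt: "edir (x - pt a) = edir (x - p)"
  by (simp add: edir_def pt_component)

lemma sector_pt_mono:
  assumes "x - pt b \<in> sector" "a \<le> b"
  shows "x - pt a \<in> sector"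
proof -
  have "s * (x $ 2 - (p $ 2 + b)) \<le> s * (x $ 2 - (p $ 2 + a))" using assms(2) s_pos by simp
  then show ?thesis using assms(1) by (simp add: sector_def pt_component)
qed

lemma sector_pt_strict:
  assumes "x - pt b \<in> sector" "a < b"
  shows "c * \<bar>(x - pt a) $ 1\<bar> < s * (x - pt a) $ 2"
proof -
  have "s * (x $ 2 - (p $ 2 + b)) < s * (x $ 2 - (p $ 2 + a))" using assms(2) s_pos by simp
  then show ?thesis using assms(1) by (simp add: sector_def pt_component)
qed

text \<open>Above the upper end point both sector corrections are active. The wedge gradients
  cancel, since \<open>edir\<close> depends only on the side of the axis, and so do the two terms
  \<open>sgn (x - p)\<close>; what is left is the vortex around \<open>pt l\<close>.\<close>

definition limit_field :: "plane \<Rightarrow> plane" where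
  "limit_field x = sgn (x - p) + sector_field (x - p) - sector_field (x - pt l)"

lemma limit_field_values:
  "x - p \<notin> sector \<Longrightarrow> limit_field x = sgn (x - p)"
  "x - pt l \<in> sector \<Longrightarrow> limit_field x = sgn (x - pt l)"
  "x - p \<in> sector \<Longrightarrow> x - pt l \<notin> sector \<Longrightarrow> limit_field x = edir (x - p)"
proof -
  have up: "x - p \<in> sector" if "x - pt l \<in> sector"
    using sector_pt_mono[OF that, of 0] l_pos by (simp add: pt_0)
  show "x - p \<notin> sector \<Longrightarrow> limit_field x = sgn (x - p)"
    using up by (auto simp: limit_field_def sector_field_def)
  show "x - pt l \<in> sector \<Longrightarrow> limit_field x = sgn (x - pt l)"
    using up by (auto simp: limit_field_def sector_field_def edir_pt)
  show "x - p \<in> sector \<Longrightarrow> x - pt l \<notin> sector \<Longrightarrow> limit_field x = edir (x - p)"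
    by (auto simp: limit_field_def sector_field_def)
qed

definition cell_base :: "nat \<Rightarrow> nat \<Rightarrow> plane" where
  "cell_base N k = pt (real k * (l / real N))"

definition cells_field :: "nat \<Rightarrow> plane \<Rightarrow> plane" where
  "cells_field N x = limit_field x + (\<Sum>k<N. cell_field (l / real N) (x - cell_base N k))"

text \<open>The vortex centres and the points where cells touch. \<open>pt l\<close> is listed
  separately for \<open>N = 0\<close>, where the only base point is \<open>p\<close>; that case is
  the limit field.\<close>

definition exceptional :: "nat \<Rightarrow> plane set" where
  "exceptional N = {p, pt l} \<union> cell_base N ` {..N}"

lemma finite_exceptional: "finite (exceptional N)"
  by (simp add: exceptional_def)

lemma cell_base_component: "cell_base N k $ 1 = p $ 1" "cell_base N k $ 2 = p $ 2 + real k * (l / real N)"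
  by (simp_all add: cell_base_def pt_component)

lemma not_exceptional:
  assumes "x \<notin> exceptional N"
  shows "x - p \<noteq> 0" "x - pt l \<noteq> 0" "k \<le> N \<Longrightarrow> x - cell_base N k \<noteq> 0"
  using assms by (auto simp: exceptional_def)

lemma cell_base_le: "k < N \<Longrightarrow> (real k + 1) * (l / real N) \<le> l"
proof -
  assume k: "k < N"
  then have "(real k + 1) * l \<le> real N * l" using l_pos by (intro mult_right_mono) auto
  then show ?thesis using k by (simp add: field_simps)
qed

text \<open>If \<open>x\<close> lay in cells \<open>j < k\<close>, its height above \<open>p\<close>
  would be at most \<open>(j + 1) * (l / N)\<close> and at least \<open>k * (l / N)\<close>.
  Equality makes it the tip of the lower cell and the base point of the upper one, which is
  exceptional.\<close>

lemma cell_unique: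
  assumes x: "x \<notin> exceptional N" and jk: "j < N" "k < N"
    and cells: "x - cell_base N j \<in> cell (l / real N)" "x - cell_base N k \<in> cell (l / real N)"
  shows "j = k"
proof -
  have *: False if "j < k" "k < N" "x - cell_base N j \<in> cell (l / real N)" "x - cell_base N k \<in> cell (l / real N)" for j k
  proof -
    have H: "0 < l / real N" using that l_pos by simp
    have "x $ 2 - p $ 2 - real j * (l / real N) \<le> l / real N" "0 \<le> x $ 2 - p $ 2 - real k * (l / real N)"
      using cell_height[OF that(3)] cell_height[OF that(4)] by (simp_all add: cell_base_component)
    moreover have "(real j + 1) * (l / real N) \<le> real k * (l / real N)"
      using that(1) H by (intro mult_right_mono) auto
    ultimately have eq: "x $ 2 - p $ 2 - real j * (l / real N) = l / real N" "x $ 2 - p $ 2 = real k * (l / real N)"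
      unfolding distrib_right mult_1 by linarith+
    then have "x $ 1 = p $ 1" using cell_height(3)[OF that(3)] by (simp add: cell_base_component)
    then have "x = cell_base N k" using eq by (simp add: cell_base_def eq_pt_iff)
    then show False using not_exceptional(3)[OF x, of k] that(2) by simp
  qed
  show ?thesis using *[of j k] *[of k j] jk cells by (meson linorder_neqE_nat)
qed

lemma cell_not_upper:
  assumes x: "x \<notin> exceptional N" and k: "k < N" and cell: "x - cell_base N k \<in> cell (l / real N)"
  shows "x - pt l \<notin> sector"
proof
  assume "x - pt l \<in> sector"
  then have "0 \<le> s * (x - pt l) $ 2"
    using c_pos unfolding sector_def by (smt (verit) mem_Collect_eq mult_nonneg_nonneg abs_ge_zero)
  then have "0 \<le> x $ 2 - p $ 2 - l" using s_pos by (simp add: zero_le_mult_iff pt_component)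
  moreover have "x $ 2 - p $ 2 - real k * (l / real N) \<le> l / real N"
    using cell_height[OF cell] by (simp add: cell_base_component)
  moreover have "(real k + 1) * (l / real N) \<le> l" by (rule cell_base_le[OF k])
  ultimately have eq: "x $ 2 - p $ 2 = l" "x $ 2 - p $ 2 - real k * (l / real N) = l / real N"
    unfolding distrib_right mult_1 by linarith+
  then have "x $ 1 = p $ 1" using cell_height(3)[OF cell] by (simp add: cell_base_component)
  then have "x = pt l" using eq by (simp add: eq_pt_iff)
  then show False using not_exceptional(2)[OF x] by simp
qed

lemma cell_sector: "x - cell_base N k \<in> cell (l / real N) \<Longrightarrow> x - p \<in> sector"
  using sector_pt_mono[of x "real k * (l / real N)" 0] l_pos
  by (simp add: cell_base_def pt_0 cell_def)

lemma cell_sector_strict: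
  assumes "x - cell_base N k \<in> cell (l / real N)" "0 < k" "k < N"
  shows "c * \<bar>(x - p) $ 1\<bar> < s * (x - p) $ 2"
  using sector_pt_strict[of x "real k * (l / real N)" 0] l_pos assms
  by (simp add: cell_base_def pt_0 cell_def)

lemma cells_field_values:
  assumes x: "x \<notin> exceptional N"
  shows "x - p \<notin> sector \<Longrightarrow> cells_field N x = sgn (x - p)"
    "x - pt l \<in> sector \<Longrightarrow> cells_field N x = sgn (x - pt l)"
    "k < N \<Longrightarrow> x - cell_base N k \<in> cell (l / real N) \<Longrightarrow> cells_field N x = cell_dir (l / real N) (x - cell_base N k)"
    "x - p \<in> sector \<Longrightarrow> x - pt l \<notin> sector \<Longrightarrow> (\<And>k. k < N \<Longrightarrow> x - cell_base N k \<notin> cell (l / real N)) \<Longrightarrow>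
      cells_field N x = edir (x - p)"
proof -
  have zero: "cells_field N x = limit_field x" if "\<And>k. k < N \<Longrightarrow> x - cell_base N k \<notin> cell (l / real N)"
    using that by (simp add: cells_field_def cell_field_def)
  show "x - p \<notin> sector \<Longrightarrow> cells_field N x = sgn (x - p)"
    using zero cell_sector limit_field_values(1) by metis
  show "x - pt l \<in> sector \<Longrightarrow> cells_field N x = sgn (x - pt l)"
    using zero cell_not_upper[OF x] limit_field_values(2) by metis
  show "x - p \<in> sector \<Longrightarrow> x - pt l \<notin> sector \<Longrightarrow> (\<And>k. k < N \<Longrightarrow> x - cell_base N k \<notin> cell (l / real N)) \<Longrightarrow>
      cells_field N x = edir (x - p)"
    using zero limit_field_values(3) by metis
  show "cells_field N x = cell_dir (l / real N) (x - cell_base N k)"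
    if k: "k < N" "x - cell_base N k \<in> cell (l / real N)"
  proof -
    have "(\<Sum>j<N. cell_field (l / real N) (x - cell_base N j)) = (\<Sum>j\<in>{k}. cell_field (l / real N) (x - cell_base N j))"
    proof (rule sum.mono_neutral_right)
      show "\<forall>j\<in>{..<N} - {k}. cell_field (l / real N) (x - cell_base N j) = 0"
        using cell_unique[OF x _ k(1) _ k(2)] by (auto simp: cell_field_def)
    qed (use k in auto)
    moreover have "limit_field x = edir (x - p)"
      by (rule limit_field_values(3)[OF cell_sector[OF k(2)] cell_not_upper[OF x k]])
    moreover have "edir (x - cell_base N k) = edir (x - p)" by (simp add: cell_base_def edir_pt)
    ultimately show ?thesis using k(2) by (simp add: cells_field_def cell_field_def)
  qed
qed

lemma norm_cells_field:
  assumes x: "x \<notin> exceptional N"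
  shows "norm (cells_field N x) = 1"
proof -
  note v = cells_field_values[OF x] and n = not_exceptional[OF x]
  consider "x - p \<notin> sector" | "x - pt l \<in> sector"
    | k where "k < N" "x - cell_base N k \<in> cell (l / real N)"
    | "x - p \<in> sector" "x - pt l \<notin> sector" "\<And>k. k < N \<Longrightarrow> x - cell_base N k \<notin> cell (l / real N)"
    by blast
  then show ?thesis
  proof cases
    case 1 then show ?thesis using v(1) n by (simp add: norm_sgn)
  next
    case 2 then show ?thesis using v(2) n by (simp add: norm_sgn)
  next
    case 3 then show ?thesis using v(3)[OF 3] n(3)[of k] by (simp add: cell_dir_def norm_sgn)
  next
    case 4 then show ?thesis using v(4) by simp
  qed
qed

lemma cells_field_potential: "\<exists>u. is_potential u (cells_field N)"
proof -
  obtain u1 where u1: "is_potential u1 sector_field" using sector_field_potential by blast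
  obtain u2 where u2: "is_potential u2 (cell_field (l / real N))" using cell_field_potential by blast
  have "is_potential (\<lambda>x. (norm (x - p) + u1 (x - p) + - u1 (x - pt l)) + (\<Sum>k<N. u2 (x - cell_base N k)))
    (\<lambda>x. (sgn (x - p) + sector_field (x - p) + - sector_field (x - pt l)) + (\<Sum>k<N. cell_field (l / real N) (x - cell_base N k)))"
    by (intro is_potential_add is_potential_sum is_potential_uminus is_potential_translate u1 u2 norm_potential finite_lessThan)
  then show ?thesis by (auto simp: cells_field_def[abs_def] limit_field_def)
qed

lemma cells_field_bv:
  assumes "bounded \<Omega>"
  shows "\<exists>M. \<forall>N. bv_field \<Omega> M (cells_field N)"
proof -
  obtain M1 where M1: "bv_field \<Omega> M1 (\<lambda>x. sgn (x - p))" using sgn_bv[OF assms] by blast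
  obtain M2 where M2: "bv_field \<Omega> M2 (\<lambda>x. sector_field (x - p))" using sector_field_bv[OF assms] by blast
  obtain M3 where M3: "bv_field \<Omega> M3 (\<lambda>x. sector_field (x - pt l))" using sector_field_bv[OF assms] by blast
  have base: "bv_field \<Omega> (M1 + M2 + M3) limit_field"
    by (rule bv_field_cong[OF bv_field_add[OF bv_field_add[OF M1 M2] bv_field_uminus[OF M3]]])
      (simp add: limit_field_def)
  have cells: "bv_field \<Omega> (\<Sum>k<N. 128 * (l / real N)) (\<lambda>x. \<Sum>k<N. cell_field (l / real N) (x - cell_base N k))" for N
    by (intro bv_field_sum cell_field_bv) (use l_pos in simp_all)
  have tot: "bv_field \<Omega> (M1 + M2 + M3 + (\<Sum>k<N. 128 * (l / real N))) (cells_field N)" for N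
    by (rule bv_field_cong[OF bv_field_add[OF base cells]]) (simp add: cells_field_def)
  \<comment> \<open>The sum over the cells is \<open>128 * l\<close> for positive \<open>N\<close>
    and 0 for \<open>N = 0\<close>.\<close>
  have "bv_field \<Omega> (M1 + M2 + M3 + 128 * l) (cells_field N)" for N
    by (rule bv_field_mono[OF tot]) (use l_pos in simp)
  then show ?thesis by blast
qed

text \<open>
  Closed regions, each with one continuous expression for the field: the traces at a point are
  values of the expressions whose regions contain it.
\<close>

definition outer_region :: "plane set" where
  "outer_region = {x. s * (x - p) $ 2 \<le> c * \<bar>(x - p) $ 1\<bar>}"

definition upper_region :: "plane set" where
  "upper_region = {x. x - pt l \<in> sector}"

definition inner_region :: "nat \<Rightarrow> nat \<Rightarrow> plane set" where
  "inner_region N k = {x. x - cell_base N k \<in> cell (l / real N) \<and> 2 * norm (x - cell_base N k) \<le> l / real N * (1 + c)}"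

definition flipped_region :: "nat \<Rightarrow> nat \<Rightarrow> plane set" where
  "flipped_region N k = {x. x - cell_base N k \<in> cell (l / real N) \<and> l / real N * (1 + c) \<le> 2 * norm (x - cell_base N k)}"

text \<open>The part of the sector outside the cells and outside the upper vortex, with every strict
  inequality relaxed so that the region becomes closed.\<close>

definition wedge_region :: "nat \<Rightarrow> plane set" where
  "wedge_region N = {x. x - p \<in> sector \<and> s * (x - pt l) $ 2 \<le> c * \<bar>(x - pt l) $ 1\<bar> \<and>
    (\<forall>k<N. s * (x - cell_base N k) $ 2 \<le> c * \<bar>(x - cell_base N k) $ 1\<bar> \<or>
      l / real N * (1 + c) \<le> norm (x - cell_base N k) + wpot (x - cell_base N k))}"

text \<open>\<open>edir\<close> is discontinuous on the axis, so the wedge region enters twice, with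
  one of the two constant gradients on each closed half.\<close>

definition cover :: "nat \<Rightarrow> (plane set \<times> (plane \<Rightarrow> plane)) set" where
  "cover N = {(outer_region, \<lambda>x. sgn (x - p)), (upper_region, \<lambda>x. sgn (x - pt l)),
      (wedge_region N \<inter> {x. x $ 1 \<le> p $ 1}, \<lambda>x. vector [- s, c]),
      (wedge_region N \<inter> {x. p $ 1 \<le> x $ 1}, \<lambda>x. vector [s, c])} \<union>
    (\<lambda>k. (inner_region N k, \<lambda>x. sgn (x - cell_base N k))) ` {..<N} \<union>
    (\<lambda>k. (flipped_region N k, \<lambda>x. - sgn (x - cell_base N k))) ` {..<N}"

lemma finite_cover: "finite (cover N)"
  by (simp add: cover_def)

lemma closed_regions:
  "closed outer_region" "closed upper_region" "closed (inner_region N k)" "closed (flipped_region N k)" "closed (wedge_region N)"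
proof -
  show "closed outer_region"
    unfolding outer_region_def by (intro closed_Collect_le continuous_intros)
  have sec: "closed {x. x - q \<in> sector}" for q
    unfolding sector_def mem_Collect_eq by (intro closed_Collect_le continuous_intros)
  then show "closed upper_region" unfolding upper_region_def .
  show "closed (inner_region N k)" "closed (flipped_region N k)"
    unfolding inner_region_def flipped_region_def
    by (intro closed_Collect_conj closed_cell_translate closed_Collect_le continuous_intros)+
  have "wedge_region N = {x. x - p \<in> sector} \<inter> ({x. s * (x - pt l) $ 2 \<le> c * \<bar>(x - pt l) $ 1\<bar>} \<inter>
    (\<Inter>k\<in>{..<N}. {x. s * (x - cell_base N k) $ 2 \<le> c * \<bar>(x - cell_base N k) $ 1\<bar>} \<union>
      {x. l / real N * (1 + c) \<le> norm (x - cell_base N k) + wpot (x - cell_base N k)}))"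
    by (auto simp: wedge_region_def)
  also have "closed \<dots>"
    unfolding wpot_def
    by (intro closed_Int sec closed_INT ballI closed_Un closed_Collect_le continuous_intros)
  finally show "closed (wedge_region N)" .
qed

lemma closed_cover: "(R, g) \<in> cover N \<Longrightarrow> closed R"
proof -
  assume "(R, g) \<in> cover N"
  moreover have "closed {x :: plane. x $ 1 \<le> p $ 1}" "closed {x :: plane. p $ 1 \<le> x $ 1}"
    by (intro closed_Collect_le continuous_intros)+
  ultimately show ?thesis
    unfolding cover_def using closed_regions by (auto intro: closed_Int)
qed

lemma isCont_sgn_diff: "x - q \<noteq> 0 \<Longrightarrow> isCont (\<lambda>x :: plane. sgn (x - q)) x"
  by (intro isCont_sgn continuous_intros) auto

lemma isCont_cover:
  assumes "(R, g) \<in> cover N" "x \<notin> exceptional N"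
  shows "isCont g x"
  using assms(1) not_exceptional[OF assms(2)] isCont_sgn_diff
  unfolding cover_def by (auto intro!: continuous_minus isCont_sgn_diff)

lemma cover_covers:
  assumes y: "y \<notin> exceptional N"
  shows "\<exists>(R, g)\<in>cover N. y \<in> R \<and> cells_field N y = g y"
proof -
  note v = cells_field_values[OF y]
  have intro: "\<exists>(R, g)\<in>cover N. y \<in> R \<and> cells_field N y = g y"
    if "(R, g) \<in> cover N" "y \<in> R" "cells_field N y = g y" for R g
    using that by blast
  consider "y - p \<notin> sector" | "y - pt l \<in> sector"
    | k where "k < N" "y - cell_base N k \<in> cell (l / real N)"
    | "y - p \<in> sector" "y - pt l \<notin> sector" "\<And>k. k < N \<Longrightarrow> y - cell_base N k \<notin> cell (l / real N)"
    by blast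
  then show ?thesis
  proof cases
    case 1
    show ?thesis
      by (rule intro[of outer_region "\<lambda>x. sgn (x - p)"])
        (use 1 v(1) in \<open>auto simp: cover_def outer_region_def sector_def\<close>)
  next
    case 2
    show ?thesis
      by (rule intro[of upper_region "\<lambda>x. sgn (x - pt l)"])
        (use 2 v(2) in \<open>auto simp: cover_def upper_region_def\<close>)
  next
    case 3
    show ?thesis
    proof (cases "2 * norm (y - cell_base N k) \<le> l / real N * (1 + c)")
      case True
      show ?thesis
        by (rule intro[of "inner_region N k" "\<lambda>x. sgn (x - cell_base N k)"])
          (use 3 True v(3)[OF 3] in \<open>auto simp: cover_def inner_region_def cell_dir_def\<close>)
    next
      case False
      show ?thesis
        by (rule intro[of "flipped_region N k" "\<lambda>x. - sgn (x - cell_base N k)"])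
          (use 3 False v(3)[OF 3] in \<open>auto simp: cover_def flipped_region_def cell_dir_def\<close>)
    qed
  next
    case 4
    have "s * (y - cell_base N k) $ 2 \<le> c * \<bar>(y - cell_base N k) $ 1\<bar> \<or>
      l / real N * (1 + c) \<le> norm (y - cell_base N k) + wpot (y - cell_base N k)" if "k < N" for k
      using 4(3)[OF that] linear unfolding cell_def sector_def mem_Collect_eq by meson
    moreover have "s * (y - pt l) $ 2 \<le> c * \<bar>(y - pt l) $ 1\<bar>"
      using 4(2) linear unfolding sector_def mem_Collect_eq by meson
    ultimately have w: "y \<in> wedge_region N"
      using 4(1) unfolding wedge_region_def by blast
    show ?thesis
    proof (cases "y $ 1 < p $ 1")
      case True
      show ?thesis
        by (rule intro[of "wedge_region N \<inter> {x. x $ 1 \<le> p $ 1}" "\<lambda>x. vector [- s, c]"])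
          (use w True v(4)[OF 4] in \<open>auto simp: cover_def edir_def\<close>)
    next
      case False
      show ?thesis
        by (rule intro[of "wedge_region N \<inter> {x. p $ 1 \<le> x $ 1}" "\<lambda>x. vector [s, c]"])
          (use w False v(4)[OF 4] in \<open>auto simp: cover_def edir_def\<close>)
    qed
  qed
qed

text \<open>All expressions except those behind the sign flip. At a point that is not exceptional
  all of them turn out to have the same value, so that a jump can only occur between an upward and a
  downward value.\<close>

definition up_value :: "nat \<Rightarrow> plane \<Rightarrow> plane \<Rightarrow> bool" where
  "up_value N x v \<longleftrightarrow> x \<in> outer_region \<and> v = sgn (x - p) \<or> x \<in> upper_region \<and> v = sgn (x - pt l) \<or>
    (\<exists>k<N. x \<in> inner_region N k \<and> v = sgn (x - cell_base N k)) \<or>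
    x \<in> wedge_region N \<and> (x $ 1 \<le> p $ 1 \<and> v = vector [- s, c] \<or> p $ 1 \<le> x $ 1 \<and> v = vector [s, c])"

definition down_value :: "nat \<Rightarrow> plane \<Rightarrow> plane \<Rightarrow> bool" where
  "down_value N x v \<longleftrightarrow> (\<exists>k<N. x \<in> flipped_region N k \<and> v = - sgn (x - cell_base N k))"

lemma cover_value: "(R, g) \<in> cover N \<Longrightarrow> x \<in> R \<Longrightarrow> up_value N x (g x) \<or> down_value N x (g x)"
  unfolding cover_def up_value_def down_value_def by auto

text \<open>This is how the small jump disappears. A non-exceptional point of the axis at height
  \<open>y\<close> strictly between the end points satisfies the inequalities of the cell with
  number \<open>floor (y / H)\<close> strictly, and hence is not in the closed wedge region; the
  other points of the axis fail the conditions at \<open>p\<close> or at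
  \<open>pt l\<close>.\<close>

lemma wedge_region_off_axis:
  assumes x: "x \<notin> exceptional N" and N: "0 < N" and w: "x \<in> wedge_region N"
  shows "x $ 1 \<noteq> p $ 1"
proof
  assume x1: "x $ 1 = p $ 1"
  define H where "H = l / real N"
  have H: "0 < H" using N l_pos by (simp add: H_def)
  define y where "y = x $ 2 - p $ 2"
  have "0 \<le> s * y" using w x1 by (simp add: wedge_region_def sector_def y_def)
  moreover have "y \<noteq> 0" using not_exceptional(1)[OF x] x1 by (auto simp: y_def vec_eq_iff forall_2)
  ultimately have y0: "0 < y" using s_pos by (simp add: zero_le_mult_iff)
  have "s * (y - l) \<le> 0" using w x1 by (simp add: wedge_region_def pt_component y_def diff_diff_eq)
  then have "y \<le> l" using s_pos by (simp add: mult_le_0_iff)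
  moreover have "y \<noteq> l"
    using not_exceptional(2)[OF x] x1 eq_pt_iff[of x l] by (auto simp: y_def)
  ultimately have yl: "y < l" by simp
  define k where "k = nat \<lfloor>y / H\<rfloor>"
  have fl: "real k = of_int \<lfloor>y / H\<rfloor>" using y0 H by (simp add: k_def)
  have k1: "real k * H \<le> y" "y < (real k + 1) * H"
  proof -
    have "real k \<le> y / H" "y / H < real k + 1" unfolding fl by linarith+
    then show "real k * H \<le> y" "y < (real k + 1) * H"
      using H by (simp_all only: pos_le_divide_eq pos_divide_less_eq)
  qed
  have kN: "k < N"
  proof -
    have "real k * H < real N * H" using k1(1) yl N by (simp add: H_def)
    then show ?thesis using H by simp
  qed
  have "y \<noteq> real k * H"
    using not_exceptional(3)[OF x, of k] kN x1 eq_pt_iff[of x "real k * H"] by (auto simp: y_def cell_base_def H_def)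
  then have k2: "real k * H < y" using k1 by simp
  define v where "v = x - cell_base N k"
  have v: "v $ 1 = 0" "v $ 2 = y - real k * H"
    using x1 by (simp_all add: v_def cell_base_component y_def H_def)
  have "norm v = v $ 2" using v k2 by (simp add: norm_plane)
  then have "norm v + wpot v = v $ 2 * (1 + c)" using v(1) by (simp add: wpot_def algebra_simps)
  then have "norm v + wpot v = (y - real k * H) * (1 + c)" by (simp only: v(2))
  also have "\<dots> < H * (1 + c)" using k1 c_pos by (intro mult_strict_right_mono) (auto simp: algebra_simps)
  finally have "norm v + wpot v < H * (1 + c)" .
  moreover have "0 < s * v $ 2" using v k2 s_pos by simp
  ultimately show False
    using w kN v(1) unfolding wedge_region_def by (auto simp: v_def H_def)
qed

text \<open>\<open>2 * norm y \<le> H * (1 + c) \<le> norm y + wpot y\<close> forces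
  \<open>norm y \<le> wpot y\<close>, the equality case of Cauchy-Schwarz. So the unflipped part of
  a cell borders on the wedge only along the rays, where the gradients agree.\<close>

lemma inner_boundary:
  assumes y: "y \<in> cell H" "2 * norm y \<le> H * (1 + c)"
    and b: "s * y $ 2 \<le> c * \<bar>y $ 1\<bar> \<or> H * (1 + c) \<le> norm y + wpot y"
  shows "c * \<bar>y $ 1\<bar> = s * y $ 2"
proof (cases "s * y $ 2 \<le> c * \<bar>y $ 1\<bar>")
  case True
  then show ?thesis using y(1) by (simp add: cell_def sector_def)
next
  case False
  then have "norm y \<le> wpot y" using b y(2) by simp
  then show ?thesis using wpot_le_norm[of y] by (intro wpot_eq_norm) simp
qed

text \<open>The base points of the higher cells lie strictly inside the sector at \<open>p\<close>,
  and so do these cells. Only the lowest cell reaches the rays from \<open>p\<close>.\<close>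

lemma outer_cell:
  assumes "x \<in> outer_region" "x - cell_base N k \<in> cell (l / real N)" "k < N"
  shows "x - cell_base N k = x - p" "c * \<bar>(x - p) $ 1\<bar> = s * (x - p) $ 2"
proof -
  have "k = 0" using cell_sector_strict[OF assms(2) _ assms(3)] assms(1) by (force simp: outer_region_def)
  then show "x - cell_base N k = x - p" by (simp add: cell_base_def pt_0)
  show "c * \<bar>(x - p) $ 1\<bar> = s * (x - p) $ 2"
    using cell_sector[OF assms(2)] assms(1) by (simp add: outer_region_def sector_def)
qed

lemma outer_upper_disjoint: "x \<in> outer_region \<Longrightarrow> x \<notin> upper_region"
  using sector_pt_strict[of x l 0] l_pos by (force simp: outer_region_def upper_region_def pt_0)

lemma wedge_value:
  assumes "x \<notin> exceptional N" "0 < N" "x \<in> wedge_region N"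
    "x $ 1 \<le> p $ 1 \<and> v = vector [- s, c] \<or> p $ 1 \<le> x $ 1 \<and> v = vector [s, c]"
  shows "v = edir (x - p)"
  using wedge_region_off_axis[OF assms(1-3)] assms(4) by (auto simp: edir_def)

text \<open>Where two regions overlap, either they share a ray, on which \<open>edir\<close> and
  \<open>sgn\<close> coincide, or the two expressions are the same; the remaining pairs do not meet
  away from the exceptional points.\<close>

lemma up_value_unique:
  assumes x: "x \<notin> exceptional N" and N: "0 < N" and v: "up_value N x v"
  shows "x \<in> outer_region \<Longrightarrow> v = sgn (x - p)"
    "x \<in> upper_region \<Longrightarrow> v = sgn (x - pt l)"
    "k < N \<Longrightarrow> x \<in> inner_region N k \<Longrightarrow> v = sgn (x - cell_base N k)"
    "x \<in> wedge_region N \<Longrightarrow> v = edir (x - p)"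
proof -
  note ne = not_exceptional[OF x]
  have wedge_outer: "edir (x - p) = sgn (x - p)" if "x \<in> outer_region" "x \<in> wedge_region N"
    using that ne(1) by (intro sector_boundary(2)) (auto simp: outer_region_def wedge_region_def sector_def)
  have wedge_upper: "edir (x - p) = sgn (x - pt l)" if "x \<in> upper_region" "x \<in> wedge_region N"
    using that ne(2) sector_boundary(2)[of "x - pt l"]
    by (auto simp: upper_region_def wedge_region_def sector_def edir_pt)
  have wedge_inner: "edir (x - p) = sgn (x - cell_base N k)" if "k < N" "x \<in> inner_region N k" "x \<in> wedge_region N" for k
  proof -
    have "c * \<bar>(x - cell_base N k) $ 1\<bar> = s * (x - cell_base N k) $ 2"
      using that by (intro inner_boundary[of _ "l / real N"]) (auto simp: inner_region_def wedge_region_def)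
    from sector_boundary(2)[OF this ne(3)] show ?thesis using that(1) by (simp add: cell_base_def edir_pt)
  qed
  have outer_inner: "sgn (x - cell_base N k) = sgn (x - p)" if "k < N" "x \<in> inner_region N k" "x \<in> outer_region" for k
    using outer_cell(1)[OF that(3) _ that(1)] that(2) by (simp add: inner_region_def)
  have upper_inner: False if "k < N" "x \<in> inner_region N k" "x \<in> upper_region" for k
    using cell_not_upper[OF x that(1)] that by (simp add: inner_region_def upper_region_def)
  have inner_inner: "j = k" if "j < N" "x \<in> inner_region N j" "k < N" "x \<in> inner_region N k" for j k
    using cell_unique[OF x that(1,3)] that by (simp add: inner_region_def)
  consider (o) "x \<in> outer_region" "v = sgn (x - p)" | (u) "x \<in> upper_region" "v = sgn (x - pt l)"
    | (i) j where "j < N" "x \<in> inner_region N j" "v = sgn (x - cell_base N j)"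
    | (w) "x \<in> wedge_region N" "x $ 1 \<le> p $ 1 \<and> v = vector [- s, c] \<or> p $ 1 \<le> x $ 1 \<and> v = vector [s, c]"
    using v unfolding up_value_def by blast
  then have "(x \<in> outer_region \<longrightarrow> v = sgn (x - p)) \<and> (x \<in> upper_region \<longrightarrow> v = sgn (x - pt l)) \<and>
    (\<forall>k. k < N \<longrightarrow> x \<in> inner_region N k \<longrightarrow> v = sgn (x - cell_base N k)) \<and> (x \<in> wedge_region N \<longrightarrow> v = edir (x - p))"
  proof cases
    case o
    then show ?thesis using outer_upper_disjoint outer_inner wedge_outer by simp
  next
    case u
    then show ?thesis using outer_upper_disjoint upper_inner wedge_upper by auto
  next
    case i
    show ?thesis
    proof (intro conjI impI allI)
      show "v = sgn (x - p)" if "x \<in> outer_region" using outer_inner[OF i(1,2) that] i(3) by simp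
      show "v = sgn (x - pt l)" if "x \<in> upper_region" using upper_inner[OF i(1,2) that] by simp
      show "v = sgn (x - cell_base N k)" if "k < N" "x \<in> inner_region N k" for k
        using inner_inner[OF i(1,2) that] i(3) by simp
      show "v = edir (x - p)" if "x \<in> wedge_region N" using wedge_inner[OF i(1,2) that] i(3) by simp
    qed
  next
    case w
    have "v = edir (x - p)" by (rule wedge_value[OF x N w])
    then show ?thesis using w(1) wedge_outer wedge_upper wedge_inner by simp
  qed
  then show "x \<in> outer_region \<Longrightarrow> v = sgn (x - p)"
    "x \<in> upper_region \<Longrightarrow> v = sgn (x - pt l)"
    "k < N \<Longrightarrow> x \<in> inner_region N k \<Longrightarrow> v = sgn (x - cell_base N k)"
    "x \<in> wedge_region N \<Longrightarrow> v = edir (x - p)" by auto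
qed

section \<open>Location and size of the jumps\<close>

definition jump_curves :: "nat \<Rightarrow> plane set" where
  "jump_curves N = (\<Union>k<N. {x. x - cell_base N k \<in> cell (l / real N) \<and>
    (2 * norm (x - cell_base N k) = l / real N * (1 + c) \<or>
     norm (x - cell_base N k) + wpot (x - cell_base N k) = l / real N * (1 + c))})"

lemma sector_wpot_ge:
  assumes "y \<in> sector"
  shows "c * norm y \<le> wpot y"
proof -
  have y: "c * \<bar>y $ 1\<bar> \<le> s * y $ 2" using assms by (simp add: sector_def)
  then have y2: "0 \<le> y $ 2"
    using c_pos s_pos by (smt (verit) mult_nonneg_nonneg abs_ge_zero zero_le_mult_iff)
  have "(c * norm y)\<^sup>2 = c\<^sup>2 * ((y $ 1)\<^sup>2 + (y $ 2)\<^sup>2)"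
    by (simp add: norm_plane power_mult_distrib)
  also have "\<dots> \<le> (wpot y)\<^sup>2"
  proof -
    have "c * \<bar>y $ 1\<bar> * (c * \<bar>y $ 1\<bar>) \<le> c * \<bar>y $ 1\<bar> * (s * y $ 2)"
      using y c_pos by (intro mult_left_mono) auto
    then have 1: "c\<^sup>2 * (y $ 1)\<^sup>2 \<le> c * s * \<bar>y $ 1\<bar> * y $ 2"
      by (simp add: power2_eq_square algebra_simps abs_mult_self_eq flip: abs_mult)
    have "(wpot y)\<^sup>2 = c\<^sup>2 * (y $ 2)\<^sup>2 + 2 * (c * s * \<bar>y $ 1\<bar> * y $ 2) + s\<^sup>2 * (y $ 1)\<^sup>2"
      by (simp add: wpot_def power2_eq_square algebra_simps abs_mult_self_eq flip: abs_mult)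
    moreover have "0 \<le> s\<^sup>2 * (y $ 1)\<^sup>2" "0 \<le> c\<^sup>2 * (y $ 1)\<^sup>2" by auto
    ultimately show ?thesis using 1 unfolding distrib_left by linarith
  qed
  finally have "(c * norm y)\<^sup>2 \<le> (wpot y)\<^sup>2" .
  moreover have "0 \<le> wpot y" using y2 c_pos s_pos by (simp add: wpot_def)
  ultimately show ?thesis by (rule power2_le_imp_le)
qed

text \<open>The square of the norm is 2 plus twice the cosine of the angle between \<open>y\<close>
  and \<open>edir y\<close>. Within the sector this angle is largest on the axis, where its cosine
  is \<open>c\<close>; this is the origin of \<open>sqrt (2 + 2 * c)\<close>.\<close>

lemma norm_sgn_add_edir:
  assumes "y \<in> sector" "y \<noteq> 0"
  shows "sqrt (2 + 2 * c) \<le> norm (sgn y + edir y)"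
proof -
  have "edir y \<bullet> sgn y = wpot y / norm y" by (simp add: sgn_div_norm wpot_inner divide_inverse mult.commute)
  also have "c \<le> \<dots>" using sector_wpot_ge[OF assms(1)] assms(2) by (simp add: field_simps)
  finally have "c \<le> edir y \<bullet> sgn y" .
  moreover have "(norm (sgn y + edir y))\<^sup>2 = sgn y \<bullet> sgn y + edir y \<bullet> edir y + 2 * (edir y \<bullet> sgn y)"
    unfolding power2_norm_eq_inner by (simp add: inner_add_left inner_add_right inner_commute)
  moreover have "sgn y \<bullet> sgn y = 1" "edir y \<bullet> edir y = 1"
    using assms(2) by (simp_all add: dot_square_norm norm_sgn)
  ultimately have "2 + 2 * c \<le> (norm (sgn y + edir y))\<^sup>2" by simp
  then show ?thesis by (simp add: real_le_lsqrt)
qed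

text \<open>Opposite to \<open>- sgn y\<close> stands \<open>sgn y\<close> across the circle, a jump
  of exactly 2, or \<open>edir y\<close> across the curve \<open>norm y + wpot y = C\<close>. Since
  \<open>wpot\<close> is linear on each side of the axis, the latter consists of two arcs of
  parabolas with focus at the base point.\<close>

lemma down_up_jump:
  assumes x: "x \<notin> exceptional N" and a: "down_value N x a" and b: "up_value N x b"
  shows "x \<in> jump_curves N \<and> sqrt (2 + 2 * c) \<le> norm (a - b) \<and> norm (a - b) \<le> 2"
proof -
  obtain k where k: "k < N" "x \<in> flipped_region N k" "a = - sgn (x - cell_base N k)"
    using a by (auto simp: down_value_def)
  then have N: "0 < N" by simp
  define y where "y = x - cell_base N k"
  define C where "C = l / real N * (1 + c)"
  have y: "y \<in> cell (l / real N)" "C \<le> 2 * norm y" "y \<noteq> 0" "norm y + wpot y \<le> C"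
    using k not_exceptional(3)[OF x, of k] by (auto simp: flipped_region_def y_def C_def cell_def)
  have mem: "2 * norm y = C \<or> norm y + wpot y = C \<Longrightarrow> x \<in> jump_curves N"
    using k(1) y(1) by (auto simp: jump_curves_def y_def C_def)
  note uv = up_value_unique[OF x N b]
  \<comment> \<open>On a ray \<open>wpot y = norm y\<close>, so the inequalities
    \<open>norm y + wpot y \<le> C \<le> 2 * norm y\<close> become equalities: circle, parabola and
    ray meet in one point, and the gradients of the wedge and the vortex agree there.\<close>
  have bdry: "2 * norm y = C \<and> edir y = sgn y" if "c * \<bar>y $ 1\<bar> = s * y $ 2"
    using sector_boundary[OF that] y by auto
  have "(2 * norm y = C \<or> norm y + wpot y = C) \<and> (b = sgn y \<or> b = edir y)"
  proof -
    consider (o) "x \<in> outer_region" | (u) "x \<in> upper_region"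
      | (i) j where "j < N" "x \<in> inner_region N j" | (w) "x \<in> wedge_region N"
      using b unfolding up_value_def by blast
    then show ?thesis
    proof cases
      case o
      have "y = x - p" "c * \<bar>y $ 1\<bar> = s * y $ 2"
        using outer_cell[OF o _ k(1)] y(1) by (simp_all add: y_def)
      then show ?thesis using uv(1)[OF o] bdry by simp
    next
      case u
      then show ?thesis using cell_not_upper[OF x k(1)] y(1) by (simp add: upper_region_def y_def)
    next
      case i
      then have "j = k" using cell_unique[OF x i(1) k(1)] y(1) by (simp add: inner_region_def y_def)
      then have "2 * norm y \<le> C" using i by (simp add: inner_region_def y_def C_def)
      then show ?thesis using y(2) uv(3)[OF i] \<open>j = k\<close> by (simp add: y_def)
    next
      case w
      have be: "b = edir y" using uv(4)[OF w] by (simp add: y_def cell_base_def edir_pt)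
      have "s * y $ 2 \<le> c * \<bar>y $ 1\<bar> \<or> C \<le> norm y + wpot y"
        using w k(1) by (auto simp: wedge_region_def y_def C_def)
      moreover have "c * \<bar>y $ 1\<bar> \<le> s * y $ 2" using y(1) by (simp add: cell_def sector_def)
      ultimately have "2 * norm y = C \<or> norm y + wpot y = C" using bdry y(4) by force
      then show ?thesis using be by simp
    qed
  qed
  moreover have "norm (a - b) = norm (sgn y + b)"
    using norm_minus_cancel[of "sgn y + b"] by (simp add: k(3) y_def)
  moreover have "norm (sgn y + sgn y) = 2" using y(3) by (simp flip: scaleR_2 add: norm_sgn)
  moreover have "sqrt (2 + 2 * c) \<le> 2" using c_le_1 by (intro real_le_lsqrt) auto
  moreover have "sqrt (2 + 2 * c) \<le> norm (sgn y + edir y)"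
    using y by (intro norm_sgn_add_edir) (auto simp: cell_def)
  moreover have "norm (sgn y + edir y) \<le> 2"
    using norm_triangle_ineq[of "sgn y" "edir y"] y(3) by (simp add: norm_sgn)
  ultimately show ?thesis using mem by auto
qed

lemma cells_field_jump_values:
  assumes x: "x \<notin> exceptional N" and T: "is_jump_triple (\<lambda>x. rot (cells_field N x)) x T"
  obtains R g R' g' where "(R, g) \<in> cover N" "x \<in> R" "(R', g') \<in> cover N" "x \<in> R'" "g x \<noteq> g' x"
    "norm (fst T - fst (snd T)) = norm (g x - g' x)"
proof -
  obtain u where u: "is_potential u (cells_field N)" using cells_field_potential by blast
  obtain B where B: "\<And>y. norm (cells_field N y) \<le> B" using u by (auto simp: is_potential_def)
  show thesis
  proof (rule jump_values_closed_cover[where G = "cells_field N" and B = B and \<C> = "cover N"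
        and P = "exceptional N" and x = x and T = T])
    show "cells_field N \<in> borel_measurable borel" by (rule is_potential_measurable(1)[OF u])
    show "norm (cells_field N y) \<le> B" for y by (rule B)
    show "finite (cover N)" "finite (exceptional N)" by (rule finite_cover finite_exceptional)+
    show "closed R" if "(R, g) \<in> cover N" for R g using that by (rule closed_cover)
    show "isCont g x" if "(R, g) \<in> cover N" for R g using that x by (rule isCont_cover)
    show "\<exists>(R, g)\<in>cover N. y \<in> R \<and> cells_field N y = g y" if "y \<notin> exceptional N" for y
      using that by (rule cover_covers)
  qed (fact x, fact T, rule that)
qed

lemma cells_field_jump:
  assumes x: "x \<notin> exceptional N" and N: "0 < N" and T: "is_jump_triple (\<lambda>x. rot (cells_field N x)) x T"
  shows "x \<in> jump_curves N \<and> sqrt (2 + 2 * c) \<le> norm (fst T - fst (snd T)) \<and> norm (fst T - fst (snd T)) \<le> 2"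
proof -
  obtain R g R' g' where *: "(R, g) \<in> cover N" "x \<in> R" "(R', g') \<in> cover N" "x \<in> R'" "g x \<noteq> g' x"
    "norm (fst T - fst (snd T)) = norm (g x - g' x)"
    using cells_field_jump_values[OF x T] by metis
  have up: "v = w" if v: "up_value N x v" and w: "up_value N x w" for v w
  proof -
    consider "x \<in> outer_region" | "x \<in> upper_region" | k where "k < N" "x \<in> inner_region N k"
      | "x \<in> wedge_region N"
      using v unfolding up_value_def by blast
    then show ?thesis
    proof cases
      case 1 then show ?thesis using up_value_unique(1)[OF x N v 1] up_value_unique(1)[OF x N w 1] by simp
    next
      case 2 then show ?thesis using up_value_unique(2)[OF x N v 2] up_value_unique(2)[OF x N w 2] by simp
    next
      case 3 then show ?thesis using up_value_unique(3)[OF x N v 3] up_value_unique(3)[OF x N w 3] by simp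
    next
      case 4 then show ?thesis using up_value_unique(4)[OF x N v 4] up_value_unique(4)[OF x N w 4] by simp
    qed
  qed
  have down: "v = w" if v: "down_value N x v" and w: "down_value N x w" for v w
  proof -
    obtain j k where "j < N" "k < N" "x \<in> flipped_region N j" "x \<in> flipped_region N k"
      "v = - sgn (x - cell_base N j)" "w = - sgn (x - cell_base N k)"
      using v w unfolding down_value_def by blast
    moreover from this have "j = k"
      by (intro cell_unique[OF x]) (simp_all add: flipped_region_def)
    ultimately show ?thesis by simp
  qed
  consider "up_value N x (g x)" "up_value N x (g' x)" | "down_value N x (g x)" "down_value N x (g' x)"
    | "down_value N x (g x)" "up_value N x (g' x)" | "up_value N x (g x)" "down_value N x (g' x)"
    using cover_value[OF *(1,2)] cover_value[OF *(3,4)] by blast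
  then show ?thesis
  proof cases
    case 1 then show ?thesis using up *(5) by blast
  next
    case 2 then show ?thesis using down *(5) by blast
  next
    case 3 then show ?thesis using down_up_jump[OF x] *(6) by simp
  next
    case 4 then show ?thesis using down_up_jump[OF x 4(2,1)] *(6) by (simp add: norm_minus_commute)
  qed
qed

end

section \<open>Lengths and energies\<close>

lemma hausdorff1_outer_Un:
  assumes "A \<in> sets borel" "B \<in> sets borel"
  shows "hausdorff1_outer (A \<union> B) \<le> hausdorff1_outer A + hausdorff1_outer B"
  using emeasure_subadditive[of A hausdorff1 B] assms by (simp add: emeasure_hausdorff1)

lemma hausdorff1_outer_UN:
  assumes "finite I" "\<And>i. i \<in> I \<Longrightarrow> A i \<in> sets borel"
  shows "hausdorff1_outer (\<Union>i\<in>I. A i) \<le> (\<Sum>i\<in>I. hausdorff1_outer (A i))"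
proof -
  have "emeasure hausdorff1 (\<Union>i\<in>I. A i) \<le> (\<Sum>i\<in>I. emeasure hausdorff1 (A i))"
    by (rule emeasure_subadditive_finite) (use assms in auto)
  moreover have "(\<Union>i\<in>I. A i) \<in> sets borel" using assms by (intro sets.finite_UN) auto
  ultimately show ?thesis using assms(2) by (simp add: emeasure_hausdorff1)
qed

lemma negligible_vertical_line: "negligible {x :: plane. x $ 1 = a}"
proof -
  have "{x :: plane. x $ 1 = a} = {x. axis 1 1 \<bullet> x = a}" by (simp add: inner_axis')
  moreover have "axis 1 1 \<noteq> (0 :: plane)" by simp
  ultimately show ?thesis using negligible_hyperplane[of "axis 1 1 :: plane" a] by simp
qed

context wedge
begin

lemma jump_triple_wedge:
  assumes \<delta>: "0 < \<delta>" and G: "\<And>y. y \<in> ball x \<delta> \<Longrightarrow> G y = edir (y - p)" and x: "x $ 1 = p $ 1"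
  shows "is_jump_triple (\<lambda>x. rot (G x)) x (rot (vector [s, c]), rot (vector [- s, c]), axis 1 1)"
proof -
  have "approx_one_sided_limit (\<lambda>x. rot (G x)) x (axis 1 1) (rot (vector [s, c]))"
    by (rule approx_one_sided_limit_const[OF \<delta>])
      (use G x in \<open>auto simp: half_ball_def inner_axis edir_def\<close>)
  moreover have "approx_one_sided_limit (\<lambda>x. rot (G x)) x (- axis 1 1) (rot (vector [- s, c]))"
    by (rule approx_one_sided_limit_const[OF \<delta>])
      (use G x in \<open>auto simp: half_ball_def inner_axis edir_def\<close>)
  moreover have "rot (vector [s, c]) $ 2 \<noteq> rot (vector [- s, c]) $ 2" using s_pos by simp
  then have "rot (vector [s, c]) \<noteq> rot (vector [- s, c])" by metis
  ultimately show ?thesis by (simp add: is_jump_triple_def)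
qed

lemma norm_wedge_jump: "norm (vector [- s, c] - vector [s, c] :: plane) = 2 * s" "norm (vector [s, c] - vector [- s, c] :: plane) = 2 * s"
proof -
  have "norm (vector [- s, c] - vector [s, c] :: plane) = sqrt ((- s - s)\<^sup>2)" by (simp add: norm_plane)
  then show "norm (vector [- s, c] - vector [s, c] :: plane) = 2 * s" using s_pos by (simp add: real_sqrt_mult)
  then show "norm (vector [s, c] - vector [- s, c] :: plane) = 2 * s" by (simp add: norm_minus_commute)
qed

section \<open>Fields with a single straight jump line\<close>

definition half_plane_field :: "plane \<Rightarrow> plane \<Rightarrow> plane" where
  "half_plane_field p x = edir (x - p)"

lemma half_plane_potential: "is_potential (\<lambda>x. wpot (x - p)) (half_plane_field p)"
  using is_potential_translate[OF edir_potential, of p] by (simp add: half_plane_field_def[abs_def])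

lemma half_plane_jump:
  assumes T: "is_jump_triple (\<lambda>x. rot (half_plane_field p x)) x T"
  shows "x $ 1 = p $ 1 \<and> norm (fst T - fst (snd T)) = 2 * s"
proof -
  define C where "C = {({x :: plane. x $ 1 \<le> p $ 1}, \<lambda>x :: plane. vector [- s, c] :: plane),
    ({x. p $ 1 \<le> x $ 1}, \<lambda>x. vector [s, c])}"
  have "\<exists>R g R' g'. (R, g) \<in> C \<and> x \<in> R \<and> (R', g') \<in> C \<and> x \<in> R' \<and> g x \<noteq> g' x \<and>
    norm (fst T - fst (snd T)) = norm (g x - g' x)"
  proof (rule jump_values_closed_cover[where G = "half_plane_field p" and B = 1 and \<C> = C
        and P = "{}" and x = x and T = T])
    show "half_plane_field p \<in> borel_measurable borel"
      by (rule is_potential_measurable(1)[OF half_plane_potential])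
    show "norm (half_plane_field p y) \<le> 1" for y by (simp add: half_plane_field_def)
    show "finite C" by (simp add: C_def)
    have "closed {x :: plane. x $ 1 \<le> p $ 1}" "closed {x :: plane. p $ 1 \<le> x $ 1}"
      by (intro closed_Collect_le continuous_intros)+
    then show "closed R" if "(R, g) \<in> C" for R g using that by (auto simp: C_def)
    show "isCont g x" if "(R, g) \<in> C" for R g using that by (auto simp: C_def)
    show "\<exists>(R, g)\<in>C. y \<in> R \<and> half_plane_field p y = g y" for y
      by (cases "y $ 1 < p $ 1") (auto simp: C_def half_plane_field_def edir_def)
  qed (simp, simp, fact T, blast)
  then show ?thesis using norm_wedge_jump by (auto simp: C_def)
qed

lemma half_plane_energy:
  assumes "open \<Omega>"
  shows "line_energy f \<Omega> (\<lambda>x. rot (half_plane_field p x)) = f (2 * s) * hausdorff1_outer (\<Omega> \<inter> {x. x $ 1 = p $ 1})"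
proof -
  have "closed {x :: plane. x $ 1 = p $ 1}" by (intro closed_Collect_eq continuous_intros)
  then have b: "\<Omega> \<inter> {x. x $ 1 = p $ 1} \<in> sets borel" using assms by (intro sets.Int) auto
  show ?thesis
  proof (rule antisym)
    show "line_energy f \<Omega> (\<lambda>x. rot (half_plane_field p x)) \<le> f (2 * s) * hausdorff1_outer (\<Omega> \<inter> {x. x $ 1 = p $ 1})"
      by (rule line_energy_le[OF b, of "{}"]) (use half_plane_jump in auto)
    show "f (2 * s) * hausdorff1_outer (\<Omega> \<inter> {x. x $ 1 = p $ 1}) \<le> line_energy f \<Omega> (\<lambda>x. rot (half_plane_field p x))"
    proof (rule line_energy_ge[OF b])
      show "\<Omega> \<inter> {x. x $ 1 = p $ 1} \<subseteq> jump_set \<Omega> (\<lambda>x. rot (half_plane_field p x))"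
        using jump_triple_wedge[of 1 _ "half_plane_field p" p]
        by (auto simp: jump_set_def half_plane_field_def)
    qed (use half_plane_jump in blast)
  qed
qed

lemma half_plane_A_space:
  assumes "open \<Omega>" "bounded \<Omega>"
  shows "(\<lambda>x. rot (half_plane_field p x)) \<in> A_space \<Omega>"
proof -
  obtain M where "bv_field \<Omega> M (half_plane_field p)"
    using edir_bv[OF assms(2), of p] unfolding half_plane_field_def[abs_def] by blast
  then show ?thesis
    by (rule potential_A_space(1)[OF assms half_plane_potential, of M p "{}"]) (simp_all add: half_plane_field_def)
qed

end

text \<open>One bound for all \<open>s\<close> and \<open>c\<close>, as needed for a weakly
  convergent sequence of fields with varying jump size. The variation estimate uses only the radius
  of \<open>\<Omega>\<close> seen from \<open>p\<close>.\<close>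

lemma half_plane_BV_norm:
  assumes "open \<Omega>" "bounded \<Omega>"
  obtains K where "\<And>s c. wedge s c \<Longrightarrow> BV_norm \<Omega> (\<lambda>x. rot (wedge.half_plane_field s c p x)) \<le> ennreal K"
proof -
  obtain R where R: "0 \<le> R" "\<Omega> \<subseteq> cball p R"
    using bounded_subset_cball_at[OF assms(2)] by blast
  have "BV_norm \<Omega> (\<lambda>x. rot (wedge.half_plane_field s c p x)) \<le> ennreal (measure lebesgue \<Omega> + 4 * \<bar>16 * R\<bar>)"
    if w: "wedge s c" for s c
  proof -
    interpret wedge s c by (rule w)
    have "bv_field \<Omega> (16 * R) (\<lambda>x. if x \<in> UNIV then edir (x - p) else 0)"
      by (rule bv_field_piece) (use R linewise_monotone_edir in auto)
    then have "bv_field \<Omega> (16 * R) (half_plane_field p)" by (simp add: half_plane_field_def[abs_def])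
    then show ?thesis
      by (rule potential_A_space(2)[OF assms half_plane_potential, of "16 * R" p "{}"]) (simp_all add: half_plane_field_def)
  qed
  then show thesis by (rule that)
qed

section \<open>Lengths of the jump curves\<close>

context wedge_cells
begin

text \<open>A vector of slope at most \<open>s / c\<close> is at most \<open>1 / c\<close> times as
  long as its horizontal part, because \<open>1 + (s / c)^2 = 1 / c^2\<close>.\<close>

lemma tilt_bound:
  fixes d :: plane
  assumes "c * \<bar>d $ 2\<bar> \<le> s * \<bar>d $ 1\<bar>"
  shows "norm d \<le> 1 / c * \<bar>d $ 1\<bar>"
proof -
  have "(c * \<bar>d $ 2\<bar>)\<^sup>2 \<le> (s * \<bar>d $ 1\<bar>)\<^sup>2"
    using assms c_pos by (intro power_mono) auto
  then have "(c * norm d)\<^sup>2 \<le> (s\<^sup>2 + c\<^sup>2) * (d $ 1)\<^sup>2"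
    by (simp add: norm_plane power_mult_distrib algebra_simps)
  then have "(c * norm d)\<^sup>2 \<le> \<bar>d $ 1\<bar>\<^sup>2" by (simp add: sc)
  then have "c * norm d \<le> \<bar>d $ 1\<bar>" by (rule power2_le_imp_le) simp
  then show ?thesis using c_pos by (simp add: field_simps)
qed

text \<open>The second hypothesis puts the normal \<open>(A, B)\<close> of the chord
  \<open>d\<close> into the sector, so the chord is flat. The last one covers a vanishing
  normal.\<close>

lemma tilt_from_normal:
  fixes d :: plane
  assumes eq: "A * d $ 1 + B * d $ 2 = 0" and AB: "c * \<bar>A\<bar> \<le> s * B" and B: "B = 0 \<Longrightarrow> d = 0"
  shows "c * \<bar>d $ 2\<bar> \<le> s * \<bar>d $ 1\<bar>"
proof (cases "B = 0")
  case False
  have "0 \<le> c * \<bar>A\<bar>" using c_pos by simp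
  then have "0 \<le> s * B" using AB by linarith
  then have Bp: "0 < B" using s_pos False by (simp add: zero_le_mult_iff)
  have "B * d $ 2 = - (A * d $ 1)" using eq by simp
  then have "B * \<bar>d $ 2\<bar> = \<bar>A\<bar> * \<bar>d $ 1\<bar>" using Bp by (metis abs_minus_cancel abs_mult abs_of_pos)
  then have "B * (c * \<bar>d $ 2\<bar>) = c * \<bar>A\<bar> * \<bar>d $ 1\<bar>" by (simp add: algebra_simps)
  also have "\<dots> \<le> s * B * \<bar>d $ 1\<bar>" using AB by (rule mult_right_mono) simp
  finally have "B * (c * \<bar>d $ 2\<bar>) \<le> B * (s * \<bar>d $ 1\<bar>)" by (simp add: algebra_simps)
  then show ?thesis using Bp by simp
qed (use B in simp)

lemma sector_component_nonneg: "y \<in> sector \<Longrightarrow> 0 \<le> y $ 2"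
proof -
  assume "y \<in> sector"
  moreover have "0 \<le> c * \<bar>y $ 1\<bar>" using c_pos by simp
  ultimately have "0 \<le> s * y $ 2" unfolding sector_def by simp
  then show ?thesis using s_pos by (simp add: zero_le_mult_iff)
qed

lemma sector_zero: "y \<in> sector \<Longrightarrow> y $ 2 = 0 \<Longrightarrow> y = 0"
  using c_pos by (auto simp: sector_def vec_eq_iff forall_2 mult_le_0_iff)

text \<open>A chord of a circle around the origin is orthogonal to \<open>y + z\<close>, and the
  sector is closed under sums.\<close>

lemma circle_tilt:
  assumes y: "y \<in> sector" and z: "z \<in> sector" and n: "norm y = norm z"
  shows "norm (y - z) \<le> 1 / c * \<bar>(y - z) $ 1\<bar>"
proof (rule tilt_bound, rule tilt_from_normal)
  have "(y $ 1)\<^sup>2 + (y $ 2)\<^sup>2 = (z $ 1)\<^sup>2 + (z $ 2)\<^sup>2" using n by (simp add: norm_plane)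
  then show "(y $ 1 + z $ 1) * (y - z) $ 1 + (y $ 2 + z $ 2) * (y - z) $ 2 = 0"
    by (simp add: power2_eq_square algebra_simps)
  have "c * \<bar>y $ 1 + z $ 1\<bar> \<le> c * (\<bar>y $ 1\<bar> + \<bar>z $ 1\<bar>)"
    using c_pos by (intro mult_left_mono abs_triangle_ineq) simp
  then show "c * \<bar>y $ 1 + z $ 1\<bar> \<le> s * (y $ 2 + z $ 2)"
    using y z unfolding sector_def mem_Collect_eq distrib_left by linarith
  assume "y $ 2 + z $ 2 = 0"
  then have "y $ 2 = 0" "z $ 2 = 0"
    using sector_component_nonneg[OF y] sector_component_nonneg[OF z] by linarith+
  then show "y - z = 0" using sector_zero[OF y] sector_zero[OF z] by simp
qed

text \<open>Multiplying the equation for \<open>norm y - norm z\<close> by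
  \<open>m = norm y + norm z\<close> removes the square roots. The chord is then seen to be
  orthogonal to \<open>y + z + m * (\<sigma> * s, c)\<close>. The last vector lies on a boundary
  ray, so the sum is again in the sector. Both points have to be on the same side
  \<open>\<sigma>\<close> of the axis for \<open>wpot\<close> to be linear.\<close>

lemma curve_tilt:
  assumes y: "y \<in> sector" and z: "z \<in> sector" and n: "norm y + wpot y = norm z + wpot z"
    and sg: "0 \<le> \<sigma> * y $ 1" "0 \<le> \<sigma> * z $ 1" "\<bar>\<sigma>\<bar> = 1"
  shows "norm (y - z) \<le> 1 / c * \<bar>(y - z) $ 1\<bar>"
proof (rule tilt_bound, rule tilt_from_normal)
  define m where "m = norm y + norm z"
  have m: "0 \<le> m" by (simp add: m_def)
  have "\<sigma> = 1 \<or> \<sigma> = - 1" using sg(3) by linarith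
  then have ab: "\<bar>y $ 1\<bar> = \<sigma> * y $ 1" "\<bar>z $ 1\<bar> = \<sigma> * z $ 1" using sg(1,2) by auto
  have "(norm y - norm z) * m = (norm y)\<^sup>2 - (norm z)\<^sup>2"
    by (simp add: m_def power2_eq_square algebra_simps)
  also have "\<dots> = (y $ 1)\<^sup>2 + (y $ 2)\<^sup>2 - ((z $ 1)\<^sup>2 + (z $ 2)\<^sup>2)" by (simp add: norm_plane)
  finally have 1: "(norm y - norm z) * m = (y $ 1)\<^sup>2 + (y $ 2)\<^sup>2 - ((z $ 1)\<^sup>2 + (z $ 2)\<^sup>2)" .
  have "norm y - norm z = wpot z - wpot y" using n by simp
  then have "norm y - norm z = c * z $ 2 + s * (\<sigma> * z $ 1) - (c * y $ 2 + s * (\<sigma> * y $ 1))"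
    by (simp add: wpot_def ab)
  with 1 have "(c * z $ 2 + s * (\<sigma> * z $ 1) - (c * y $ 2 + s * (\<sigma> * y $ 1))) * m
    = (y $ 1)\<^sup>2 + (y $ 2)\<^sup>2 - ((z $ 1)\<^sup>2 + (z $ 2)\<^sup>2)" by simp
  then show "(y $ 1 + z $ 1 + \<sigma> * s * m) * (y - z) $ 1 + (y $ 2 + z $ 2 + c * m) * (y - z) $ 2 = 0"
    by (simp add: power2_eq_square algebra_simps)
  have "\<bar>y $ 1 + z $ 1 + \<sigma> * s * m\<bar> \<le> \<bar>y $ 1\<bar> + \<bar>z $ 1\<bar> + \<bar>\<sigma> * s * m\<bar>" by linarith
  also have "\<bar>\<sigma> * s * m\<bar> = s * m" using m s_pos sg(3) by (simp add: abs_mult)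
  finally have "c * \<bar>y $ 1 + z $ 1 + \<sigma> * s * m\<bar> \<le> c * (\<bar>y $ 1\<bar> + \<bar>z $ 1\<bar> + s * m)"
    using c_pos by (intro mult_left_mono) auto
  also have "\<dots> = c * \<bar>y $ 1\<bar> + c * \<bar>z $ 1\<bar> + s * (c * m)" by (simp add: algebra_simps)
  also have "\<dots> \<le> s * y $ 2 + s * z $ 2 + s * (c * m)"
    using y z unfolding sector_def mem_Collect_eq by linarith
  finally show "c * \<bar>y $ 1 + z $ 1 + \<sigma> * s * m\<bar> \<le> s * (y $ 2 + z $ 2 + c * m)"
    by (simp add: distrib_left)
  assume "y $ 2 + z $ 2 + c * m = 0"
  moreover have "0 \<le> c * m" using m c_pos by simp
  ultimately have "y $ 2 = 0" "z $ 2 = 0"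
    using sector_component_nonneg[OF y] sector_component_nonneg[OF z] by linarith+
  then show "y - z = 0" using sector_zero[OF y] sector_zero[OF z] by simp
qed

lemma cell_width:
  assumes "y \<in> cell H"
  shows "\<bar>y $ 1\<bar> \<le> s * H / c"
proof -
  have "c * \<bar>y $ 1\<bar> \<le> s * y $ 2" using assms by (simp add: cell_def sector_def)
  also have "\<dots> \<le> s * H" using cell_height(2)[OF assms] s_pos by simp
  finally show ?thesis using c_pos by (simp add: field_simps)
qed

text \<open>Three graphs over the horizontal coordinate with factor \<open>1 / c\<close>: the
  circular arc over the full width \<open>2 * s * H / c\<close>, and the parabolic arcs over one
  half of it each. The two sides are kept apart because the tilt of the parabolas is controlled on
  one side at a time.\<close>

lemma cell_curves_length:
  assumes H: "0 < H"
  shows "hausdorff1_outer {x. x - b \<in> cell H \<and> (2 * norm (x - b) = H * (1 + c) \<or> norm (x - b) + wpot (x - b) = H * (1 + c))}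
    \<le> ennreal (4 * s * H / c\<^sup>2)"
proof -
  define A where "A = {x. x - b \<in> cell H \<and> 2 * norm (x - b) = H * (1 + c)}"
  define B where "B \<sigma> = {x. x - b \<in> cell H \<and> norm (x - b) + wpot (x - b) = H * (1 + c) \<and> 0 \<le> \<sigma> * (x - b) $ 1}" for \<sigma>
  have w: "0 < s * H / c" using H s_pos c_pos by simp
  have A: "hausdorff1_outer A \<le> ennreal (1 / c * ((b $ 1 + s * H / c) - (b $ 1 - s * H / c)))"
  proof (rule hausdorff1_outer_le_graph[where g = "\<lambda>x. x $ 1"])
    fix x y assume "x \<in> A" "y \<in> A"
    then show "norm (x - y) \<le> 1 / c * \<bar>x $ 1 - y $ 1\<bar>"
      using circle_tilt[of "x - b" "y - b"] by (simp add: A_def cell_def)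
  next
    fix x assume "x \<in> A"
    then show "b $ 1 - s * H / c \<le> x $ 1 \<and> x $ 1 \<le> b $ 1 + s * H / c"
      using cell_width[of "x - b" H] by (simp add: A_def abs_le_iff)
  qed (use w c_pos in auto)
  have lip: "norm (x - y) \<le> 1 / c * \<bar>x $ 1 - y $ 1\<bar>" if "x \<in> B \<sigma>" "y \<in> B \<sigma>" "\<bar>\<sigma>\<bar> = 1" for x y \<sigma>
    using curve_tilt[of "x - b" "y - b" \<sigma>] that by (simp add: B_def cell_def)
  have B1: "hausdorff1_outer (B 1) \<le> ennreal (1 / c * ((b $ 1 + s * H / c) - b $ 1))"
  proof (rule hausdorff1_outer_le_graph[where g = "\<lambda>x. x $ 1"])
    fix x assume "x \<in> B 1"
    then show "b $ 1 \<le> x $ 1 \<and> x $ 1 \<le> b $ 1 + s * H / c"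
      using cell_width[of "x - b" H] by (simp add: B_def abs_le_iff)
  qed (use w c_pos lip[of _ 1] in auto)
  have B2: "hausdorff1_outer (B (- 1)) \<le> ennreal (1 / c * (b $ 1 - (b $ 1 - s * H / c)))"
  proof (rule hausdorff1_outer_le_graph[where g = "\<lambda>x. x $ 1"])
    fix x assume "x \<in> B (- 1)"
    then show "b $ 1 - s * H / c \<le> x $ 1 \<and> x $ 1 \<le> b $ 1"
      using cell_width[of "x - b" H] by (simp add: B_def abs_le_iff)
  qed (use w c_pos lip[of _ "- 1"] in auto)
  have "closed A" unfolding A_def
    by (intro closed_Collect_conj closed_cell_translate closed_Collect_eq continuous_intros)
  moreover have "closed (B \<sigma>)" for \<sigma> unfolding B_def wpot_def
    by (intro closed_Collect_conj closed_cell_translate closed_Collect_eq closed_Collect_le continuous_intros)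
  ultimately have bor: "A \<in> sets borel" "B 1 \<in> sets borel" "B (- 1) \<in> sets borel" by auto
  have "hausdorff1_outer {x. x - b \<in> cell H \<and> (2 * norm (x - b) = H * (1 + c) \<or> norm (x - b) + wpot (x - b) = H * (1 + c))}
    \<le> hausdorff1_outer (A \<union> (B 1 \<union> B (- 1)))"
    by (rule hausdorff1_outer_mono) (auto simp: A_def B_def)
  also have "\<dots> \<le> hausdorff1_outer A + (hausdorff1_outer (B 1) + hausdorff1_outer (B (- 1)))"
    using hausdorff1_outer_Un[of A "B 1 \<union> B (- 1)"] hausdorff1_outer_Un[of "B 1" "B (- 1)"] bor
    by (meson add_left_mono order_trans sets.Un)
  also have "\<dots> \<le> ennreal (1 / c * ((b $ 1 + s * H / c) - (b $ 1 - s * H / c))) +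
    (ennreal (1 / c * ((b $ 1 + s * H / c) - b $ 1)) + ennreal (1 / c * (b $ 1 - (b $ 1 - s * H / c))))"
    by (intro add_mono A B1 B2)
  also have "\<dots> = ennreal (4 * s * H / c\<^sup>2)"
    using w c_pos H s_pos by (simp add: power2_eq_square flip: ennreal_plus)
  finally show ?thesis .
qed

lemma closed_cell_curves:
  "closed {x. x - b \<in> cell H \<and> (2 * norm (x - b) = K \<or> norm (x - b) + wpot (x - b) = K)}"
  unfolding wpot_def
  by (intro closed_Collect_conj closed_Collect_disj closed_cell_translate closed_Collect_eq continuous_intros)

lemma closed_jump_curves: "closed (jump_curves N)"
  unfolding jump_curves_def by (intro closed_UN ballI closed_cell_curves finite_lessThan)

lemma jump_curves_length:
  assumes N: "0 < N"
  shows "hausdorff1_outer (jump_curves N) \<le> ennreal (4 * s * l / c\<^sup>2)"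
proof -
  define J where "J k = {x. x - cell_base N k \<in> cell (l / real N) \<and>
      (2 * norm (x - cell_base N k) = l / real N * (1 + c) \<or>
       norm (x - cell_base N k) + wpot (x - cell_base N k) = l / real N * (1 + c))}" for k
  have "closed (J k)" for k unfolding J_def by (rule closed_cell_curves)
  then have "hausdorff1_outer (\<Union>k<N. J k) \<le> (\<Sum>k<N. hausdorff1_outer (J k))"
    by (intro hausdorff1_outer_UN) auto
  also have "\<dots> \<le> (\<Sum>k<N. ennreal (4 * s * (l / real N) / c\<^sup>2))"
    unfolding J_def using N l_pos by (intro sum_mono cell_curves_length) simp
  also have "\<dots> = ennreal (4 * s * l / c\<^sup>2)"
    using N l_pos s_pos by (simp add: ennreal_of_nat_eq_real_of_nat flip: ennreal_mult)
  finally show ?thesis by (simp add: jump_curves_def J_def)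
qed

section \<open>Energies of the limit field and of the oscillating fields\<close>

definition segment :: "plane set" where
  "segment = {x. x $ 1 = p $ 1 \<and> p $ 2 < x $ 2 \<and> x $ 2 < p $ 2 + l}"

lemma cells_field_0: "cells_field 0 = limit_field"
  by (simp add: fun_eq_iff cells_field_def)

lemma segment_borel: "segment \<in> sets borel"
proof -
  have "segment = {x. x $ 1 = p $ 1} \<inter> {x. p $ 2 < x $ 2} \<inter> {x. x $ 2 < p $ 2 + l}"
    by (auto simp: segment_def)
  moreover have "closed {x :: plane. x $ 1 = p $ 1}" by (intro closed_Collect_eq continuous_intros)
  moreover have "open {x :: plane. p $ 2 < x $ 2}" "open {x :: plane. x $ 2 < p $ 2 + l}"
    by (intro open_Collect_less continuous_intros)+
  ultimately show ?thesis by (simp add: borel_closed borel_open sets.Int)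
qed

lemma segment_length: "ennreal l \<le> hausdorff1_outer segment"
  using hausdorff1_outer_vertical_segment_ge[of "p $ 2" "p $ 2 + l" "p $ 1" segment]
  by (simp add: segment_def)

lemma limit_field_near_segment:
  assumes x: "x \<in> segment"
  obtains \<delta> where "0 < \<delta>" "\<And>y. y \<in> ball x \<delta> \<Longrightarrow> limit_field y = edir (y - p)"
proof -
  define U where "U = {y. c * \<bar>y $ 1 - p $ 1\<bar> < s * (y $ 2 - p $ 2)} \<inter> {y :: plane. y $ 2 < p $ 2 + l}"
  have "open U" unfolding U_def by (intro open_Int open_Collect_less continuous_intros)
  moreover have "x \<in> U" using x s_pos by (simp add: U_def segment_def)
  ultimately obtain \<delta> where \<delta>: "0 < \<delta>" "ball x \<delta> \<subseteq> U" using openE by blast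
  have "limit_field y = edir (y - p)" if "y \<in> U" for y
  proof (rule limit_field_values(3))
    show "y - p \<in> sector" using that by (simp add: U_def sector_def)
    show "y - pt l \<notin> sector"
      using that sector_component_nonneg[of "y - pt l"] by (auto simp: U_def pt_component)
  qed
  then show thesis using \<delta> by (intro that[of \<delta>]) auto
qed

text \<open>The limit field is the case without cells, so the same closed cover applies. On the open
  segment only the two constant wedge gradients are active, and two different traces must be exactly
  these.\<close>

lemma segment_jump:
  assumes x: "x \<in> segment" and T: "is_jump_triple (\<lambda>x. rot (limit_field x)) x T"
  shows "norm (fst T - fst (snd T)) = 2 * s"
proof -
  have ne: "x \<notin> exceptional 0"
    using x l_pos by (auto simp: segment_def exceptional_def cell_base_def pt_component)
  have "is_jump_triple (\<lambda>x. rot (cells_field 0 x)) x T" using T by (simp add: cells_field_0)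
  then obtain R g R' g' where *: "(R, g) \<in> cover 0" "x \<in> R" "(R', g') \<in> cover 0" "x \<in> R'" "g x \<noteq> g' x"
    "norm (fst T - fst (snd T)) = norm (g x - g' x)"
    using cells_field_jump_values[OF ne] by metis
  have "x \<notin> outer_region" using x s_pos by (auto simp: segment_def outer_region_def not_le)
  moreover have "x \<notin> upper_region"
    using x sector_component_nonneg[of "x - pt l"] by (auto simp: segment_def upper_region_def pt_component)
  ultimately have "g x = vector [- s, c] \<or> g x = vector [s, c]" "g' x = vector [- s, c] \<or> g' x = vector [s, c]"
    using *(1-4) by (auto simp: cover_def)
  then show ?thesis using *(5,6) norm_wedge_jump by auto
qed

lemma limit_energy:
  assumes "segment \<subseteq> \<Omega>"
  shows "f (2 * s) * ennreal l \<le> line_energy f \<Omega> (\<lambda>x. rot (limit_field x))"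
proof -
  have "f (2 * s) * ennreal l \<le> f (2 * s) * hausdorff1_outer segment"
    by (intro mult_left_mono segment_length) simp
  also have "\<dots> \<le> line_energy f \<Omega> (\<lambda>x. rot (limit_field x))"
  proof (rule line_energy_ge[OF segment_borel])
    show "segment \<subseteq> jump_set \<Omega> (\<lambda>x. rot (limit_field x))"
    proof
      fix x assume x: "x \<in> segment"
      obtain \<delta> where \<delta>: "0 < \<delta>" "\<And>y. y \<in> ball x \<delta> \<Longrightarrow> limit_field y = edir (y - p)"
        using limit_field_near_segment[OF x] by blast
      have "x $ 1 = p $ 1" using x by (simp add: segment_def)
      from jump_triple_wedge[OF \<delta> this] show "x \<in> jump_set \<Omega> (\<lambda>x. rot (limit_field x))"
        using x assms by (auto simp: jump_set_def)
    qed
  qed (rule segment_jump)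
  finally show ?thesis .
qed

lemma cells_energy:
  assumes N: "0 < N" and S: "\<And>t. sqrt (2 + 2 * c) \<le> t \<Longrightarrow> t \<le> 2 \<Longrightarrow> f t \<le> S"
  shows "line_energy f \<Omega> (\<lambda>x. rot (cells_field N x)) \<le> S * ennreal (4 * s * l / c\<^sup>2)"
proof -
  have "line_energy f \<Omega> (\<lambda>x. rot (cells_field N x)) \<le> S * hausdorff1_outer (jump_curves N)"
  proof (rule line_energy_le[OF _ finite_exceptional[of N]])
    show "jump_curves N \<in> sets borel" using closed_jump_curves by (rule borel_closed)
    fix x T assume "x \<notin> exceptional N" "is_jump_triple (\<lambda>x. rot (cells_field N x)) x T"
    then show "x \<in> jump_curves N \<and> f (norm (fst T - fst (snd T))) \<le> S"
      using cells_field_jump[OF _ N] S by blast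
  qed
  also have "\<dots> \<le> S * ennreal (4 * s * l / c\<^sup>2)" by (intro mult_left_mono jump_curves_length[OF N]) simp
  finally show ?thesis .
qed

section \<open>Weak convergence and the slope bound for one jump size\<close>

lemma exceptional_axis: "x \<in> exceptional N \<Longrightarrow> x $ 1 = p $ 1"
  by (auto simp: exceptional_def pt_component cell_base_component)

text \<open>The cells lie within distance \<open>2 * l / N\<close> of their base points on the axis,
  so a point off the axis is eventually in none of them and the values become equal to the
  limit.\<close>

lemma cells_field_tendsto:
  assumes "x $ 1 \<noteq> p $ 1"
  shows "(\<lambda>n. cells_field (Suc n) x) \<longlonglongrightarrow> limit_field x"
proof (rule tendsto_eventually)
  have "(\<lambda>n. 2 * l * (1 / real (Suc n))) \<longlonglongrightarrow> 2 * l * 0"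
    by (intro tendsto_mult tendsto_const) (rule LIMSEQ_inverse_real_of_nat[unfolded inverse_eq_divide])
  moreover have "2 * l * 0 < \<bar>x $ 1 - p $ 1\<bar>" using assms by simp
  ultimately have "\<forall>\<^sub>F n in sequentially. 2 * l * (1 / real (Suc n)) < \<bar>x $ 1 - p $ 1\<bar>"
    by (rule order_tendstoD(2))
  then show "\<forall>\<^sub>F n in sequentially. cells_field (Suc n) x = limit_field x"
  proof eventually_elim
    case (elim n)
    have "x - cell_base (Suc n) k \<notin> cell (l / real (Suc n))" for k
    proof
      assume "x - cell_base (Suc n) k \<in> cell (l / real (Suc n))"
      then have "norm (x - cell_base (Suc n) k) \<le> l / real (Suc n) * (1 + c)" by (rule cell_norm)
      also have "\<dots> \<le> l / real (Suc n) * 2" using l_pos c_le_1 by (intro mult_left_mono) auto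
      finally have "\<bar>x $ 1 - p $ 1\<bar> \<le> l / real (Suc n) * 2"
        using component_le_norm_cart[of "x - cell_base (Suc n) k" 1] by (simp add: cell_base_component)
      then show False using elim by (simp add: mult.commute)
    qed
    then show ?case by (simp add: cells_field_def cell_field_def)
  qed
qed

lemma cells_A_space:
  assumes "open \<Omega>" "bounded \<Omega>"
  obtains K where "\<And>N. (\<lambda>x. rot (cells_field N x)) \<in> A_space \<Omega>"
    "\<And>N. BV_norm \<Omega> (\<lambda>x. rot (cells_field N x)) \<le> ennreal K"
proof -
  obtain M where M: "\<And>N. bv_field \<Omega> M (cells_field N)" using cells_field_bv[OF assms(2)] by blast
  have "(\<lambda>x. rot (cells_field N x)) \<in> A_space \<Omega> \<and>
    BV_norm \<Omega> (\<lambda>x. rot (cells_field N x)) \<le> ennreal (measure lebesgue \<Omega> + 4 * \<bar>M\<bar>)" for N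
  proof -
    obtain u where u: "is_potential u (cells_field N)" using cells_field_potential by blast
    show ?thesis
      using potential_A_space[OF assms u M finite_exceptional[of N] norm_cells_field] by simp
  qed
  then show thesis by (intro that[of "measure lebesgue \<Omega> + 4 * \<bar>M\<bar>"]) blast+
qed

text \<open>Dominated convergence on the bounded set \<open>\<Omega>\<close>: off the axis the
  fields are unit vectors and differ by at most 2. The variation is bounded uniformly because the
  cost of the cells is.\<close>

lemma cells_weakly_converge:
  assumes "open \<Omega>" "bounded \<Omega>"
  shows "BV_weakly_converges \<Omega> (\<lambda>n x. rot (cells_field (Suc n) x)) (\<lambda>x. rot (limit_field x))"
  unfolding BV_weakly_converges_def
proof
  obtain K where "\<And>N. BV_norm \<Omega> (\<lambda>x. rot (cells_field N x)) \<le> ennreal K"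
    using cells_A_space[OF assms] by blast
  then show "\<exists>C. \<forall>n. BV_norm \<Omega> (\<lambda>x. rot (cells_field (Suc n) x)) \<le> ennreal C" by blast
  have m\<Omega>: "\<Omega> \<in> lmeasurable" using assms by (simp add: lmeasurable_open)
  have [measurable]: "cells_field N \<in> borel_measurable borel" for N
    using cells_field_potential[of N] is_potential_measurable(1) by blast
  have [measurable]: "limit_field \<in> borel_measurable borel" "\<Omega> \<in> sets borel"
    using \<open>cells_field 0 \<in> borel_measurable borel\<close> assms(1) by (auto simp: cells_field_0)
  have AEx: "AE x in (lebesgue :: plane measure). x $ 1 \<noteq> p $ 1"
    using negligible_vertical_line[of "p $ 1"]
    by (intro AE_I'[of "{x :: plane. x $ 1 = p $ 1}"]) (auto simp: negligible_iff_null_sets)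
  have "(\<lambda>n. \<integral>x. indicat_real \<Omega> x *\<^sub>R norm (rot (cells_field (Suc n) x) - rot (limit_field x)) \<partial>lebesgue)
    \<longlonglongrightarrow> (\<integral>x. 0 \<partial>(lebesgue :: plane measure))"
  proof (rule integral_dominated_convergence[where w = "\<lambda>x. indicat_real \<Omega> x * 2"])
    show "integrable lebesgue (\<lambda>x. indicat_real \<Omega> x * 2)" using m\<Omega> by (simp add: fmeasurable_def)
    show "(\<lambda>x. indicat_real \<Omega> x *\<^sub>R norm (rot (cells_field (Suc n) x) - rot (limit_field x))) \<in> borel_measurable lebesgue" for n
      by (rule measurable_completion) measurable
    show "AE x in lebesgue. (\<lambda>n. indicat_real \<Omega> x *\<^sub>R norm (rot (cells_field (Suc n) x) - rot (limit_field x))) \<longlonglongrightarrow> 0"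
      using AEx
    proof eventually_elim
      case (elim x)
      have "(\<lambda>n. indicat_real \<Omega> x *\<^sub>R norm (cells_field (Suc n) x - limit_field x))
        \<longlonglongrightarrow> indicat_real \<Omega> x *\<^sub>R norm (limit_field x - limit_field x)"
        by (intro tendsto_intros cells_field_tendsto elim)
      then show ?case by (simp add: rot_diff)
    qed
    show "AE x in lebesgue. norm (indicat_real \<Omega> x *\<^sub>R norm (rot (cells_field (Suc n) x) - rot (limit_field x)))
        \<le> indicat_real \<Omega> x * 2" for n
      using AEx
    proof eventually_elim
      case (elim x)
      have "norm (cells_field (Suc n) x) = 1" "norm (limit_field x) = 1"
        using norm_cells_field[of x] exceptional_axis[of x] elim cells_field_0 by metis+
      then have "norm (cells_field (Suc n) x - limit_field x) \<le> 2"
        using norm_triangle_ineq4[of "cells_field (Suc n) x" "limit_field x"] by simp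
      then show ?case by (auto simp: rot_diff indicator_def)
    qed
  qed simp
  then show "(\<lambda>n. LINT x:\<Omega>|lebesgue. norm (rot (cells_field (Suc n) x) - rot (limit_field x))) \<longlonglongrightarrow> 0"
    by (simp add: set_lebesgue_integral_def)
qed

lemma lsc_slope_bound:
  assumes \<Omega>: "open \<Omega>" "bounded \<Omega>" "segment \<subseteq> \<Omega>" and lsc: "BV_weakly_lsc \<Omega> (line_energy f \<Omega>)"
    and S: "\<And>t. sqrt (2 + 2 * c) \<le> t \<Longrightarrow> t \<le> 2 \<Longrightarrow> f t \<le> S"
  shows "f (2 * s) / ennreal (2 * s) \<le> ennreal (2 / c\<^sup>2) * S"
proof -
  have A: "(\<lambda>x. rot (cells_field N x)) \<in> A_space \<Omega>" for N using cells_A_space[OF \<Omega>(1,2)] by blast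
  then have A0: "(\<lambda>x. rot (limit_field x)) \<in> A_space \<Omega>" using cells_field_0 by metis
  have "f (2 * s) * ennreal l \<le> line_energy f \<Omega> (\<lambda>x. rot (limit_field x))" by (rule limit_energy[OF \<Omega>(3)])
  also have "\<dots> \<le> liminf (\<lambda>n. line_energy f \<Omega> (\<lambda>x. rot (cells_field (Suc n) x)))"
    using lsc[unfolded BV_weakly_lsc_def, rule_format, of "\<lambda>n x. rot (cells_field (Suc n) x)", OF A A0 cells_weakly_converge[OF \<Omega>(1,2)]] .
  also have "\<dots> \<le> limsup (\<lambda>n. line_energy f \<Omega> (\<lambda>x. rot (cells_field (Suc n) x)))"
    by (rule Liminf_le_Limsup) simp
  also have "\<dots> \<le> S * ennreal (4 * s * l / c\<^sup>2)"
    by (intro Limsup_bounded always_eventually allI cells_energy S) simp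
  \<comment> \<open>The factors are grouped so that the finite positive length \<open>l\<close>
    cancels; \<open>2 * s\<close> is the small jump by which \<open>f\<close> is finally
    divided.\<close>
  also have "\<dots> = ennreal l * (ennreal (2 * s) * (ennreal (2 / c\<^sup>2) * S))"
  proof -
    have "4 * s * l / c\<^sup>2 = l * ((2 * s) * (2 / c\<^sup>2))" by simp
    moreover have "ennreal (2 * s * (2 / c\<^sup>2)) = ennreal (2 * s) * ennreal (2 / c\<^sup>2)"
      by (rule ennreal_mult) (use s_pos in simp_all)
    moreover have "ennreal (l * (2 * s * (2 / c\<^sup>2))) = ennreal l * ennreal (2 * s * (2 / c\<^sup>2))"
      by (rule ennreal_mult) (use s_pos l_pos in simp_all)
    ultimately have "ennreal (4 * s * l / c\<^sup>2) = ennreal l * (ennreal (2 * s) * ennreal (2 / c\<^sup>2))"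
      by (simp only:)
    then show ?thesis by (simp only: ac_simps)
  qed
  finally have "ennreal l * f (2 * s) \<le> ennreal l * (ennreal (2 * s) * (ennreal (2 / c\<^sup>2) * S))"
    by (simp add: mult.commute)
  then have "f (2 * s) \<le> ennreal (2 * s) * (ennreal (2 / c\<^sup>2) * S)"
    using l_pos by (subst (asm) ennreal_mult_le_mult_iff) auto
  then show ?thesis using s_pos by (intro divide_le_posI_ennreal) auto
qed

end

section \<open>Semicontinuity\<close>

lemma wedge_of_jump:
  assumes "0 < t" "t \<le> 2"
  shows "wedge (t / 2) (sqrt (1 - (t / 2)\<^sup>2))"
proof
  have "(t / 2)\<^sup>2 \<le> 1" using assms by (intro power_le_one) auto
  then show "0 \<le> sqrt (1 - (t / 2)\<^sup>2)" "(t / 2)\<^sup>2 + (sqrt (1 - (t / 2)\<^sup>2))\<^sup>2 = 1" by auto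
qed (use assms in simp)

text \<open>Positive and finite, so that this length can be cancelled from an inequality between
  energies, even where \<open>f\<close> is infinite.\<close>

lemma vertical_line_length:
  assumes \<Omega>: "open \<Omega>" "bounded \<Omega>" and p: "p \<in> \<Omega>"
  shows "0 < hausdorff1_outer (\<Omega> \<inter> {x. x $ 1 = p $ 1})" "hausdorff1_outer (\<Omega> \<inter> {x. x $ 1 = p $ 1}) < \<infinity>"
proof -
  obtain r where r: "0 < r" "ball p r \<subseteq> \<Omega>" using \<Omega>(1) p openE by blast
  have "0 < ennreal ((p $ 2 + r) - p $ 2)" using r(1) by simp
  also have "\<dots> \<le> hausdorff1_outer (\<Omega> \<inter> {x. x $ 1 = p $ 1})"
  proof (rule hausdorff1_outer_vertical_segment_ge)
    fix y assume "p $ 2 < y" "y < p $ 2 + r"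
    then have "dist p (vector [p $ 1, y]) < r" by (simp add: dist_norm norm_plane)
    then show "vector [p $ 1, y] \<in> \<Omega> \<inter> {x. x $ 1 = p $ 1}" using r(2) by auto
  qed
  finally show "0 < hausdorff1_outer (\<Omega> \<inter> {x. x $ 1 = p $ 1})" .
  obtain R where R: "0 \<le> R" "\<Omega> \<subseteq> cball 0 R" using bounded_subset_cball_at[OF \<Omega>(2)] by blast
  have "hausdorff1_outer (\<Omega> \<inter> {x. x $ 1 = p $ 1}) \<le> ennreal (1 * ((R + 1) - (- R - 1)))"
  proof (rule hausdorff1_outer_le_graph[where g = "\<lambda>x. x $ 2"])
    show "norm (x - y) \<le> 1 * \<bar>x $ 2 - y $ 2\<bar>" if "x \<in> \<Omega> \<inter> {x. x $ 1 = p $ 1}" "y \<in> \<Omega> \<inter> {x. x $ 1 = p $ 1}" for x y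
      using that by (simp add: norm_plane)
    show "- R - 1 \<le> x $ 2 \<and> x $ 2 \<le> R + 1" if "x \<in> \<Omega> \<inter> {x. x $ 1 = p $ 1}" for x
    proof -
      have "norm x \<le> R" using that R(2) by auto
      then show ?thesis using component_le_norm_cart[of x 2] by linarith
    qed
  qed (use R in auto)
  then show "hausdorff1_outer (\<Omega> \<inter> {x. x $ 1 = p $ 1}) < \<infinity>"
    by (rule le_less_trans) simp
qed

text \<open>Fields with a single jump on the same vertical line and jump sizes \<open>X n\<close>
  and \<open>t\<close> have the energies \<open>f (X n) * h\<close> and \<open>f t * h\<close> with
  a common length \<open>h\<close>. The gradients depend continuously on the jump size, up to and
  including 2.\<close>

lemma energy_lsc_imp_sequential_lsc:
  assumes \<Omega>: "open \<Omega>" "bounded \<Omega>" "\<Omega> \<noteq> {}" and lsc: "BV_weakly_lsc \<Omega> (line_energy f \<Omega>)"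
    and t: "0 < t" "t \<le> 2" and X: "\<And>n. 0 < X n" "\<And>n. X n \<le> 2" "X \<longlonglongrightarrow> t" and y: "\<And>n. f (X n) \<le> y"
  shows "f t \<le> y"
proof -
  obtain p where p: "p \<in> \<Omega>" using \<Omega>(3) by blast
  define h where "h = hausdorff1_outer (\<Omega> \<inter> {x. x $ 1 = p $ 1})"
  have h: "h \<noteq> 0" "h \<noteq> \<infinity>" using vertical_line_length[OF \<Omega>(1,2) p] by (auto simp: h_def)
  define cc where "cc t = sqrt (1 - (t / 2)\<^sup>2)" for t :: real
  define F where "F t x = rot (wedge.half_plane_field (t / 2) (cc t) p x)" for t x
  have w: "wedge (t / 2) (cc t)" if "0 < t" "t \<le> 2" for t
    unfolding cc_def using that by (rule wedge_of_jump)
  have A: "F t \<in> A_space \<Omega>" if "0 < t" "t \<le> 2" for t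
    using wedge.half_plane_A_space[OF w[OF that] \<Omega>(1,2), of p] by (simp add: F_def[abs_def])
  have E: "line_energy f \<Omega> (F t) = f t * h" if "0 < t" "t \<le> 2" for t
    using wedge.half_plane_energy[OF w[OF that] \<Omega>(1), of f p] by (simp add: F_def[abs_def] h_def)
  \<comment> \<open>Both fields switch sides on the same line, so the norm of their difference does
    not depend on \<open>x\<close> and the distance in the mean is this number times the
    area.\<close>
  have D: "norm (F a x - F b x) = sqrt ((a / 2 - b / 2)\<^sup>2 + (cc a - cc b)\<^sup>2)"
    if "0 < a" "a \<le> 2" "0 < b" "b \<le> 2" for a b x
    unfolding F_def rot_diff norm_rot
    by (simp add: norm_plane wedge.half_plane_field_def[OF w[OF that(1,2)]] wedge.half_plane_field_def[OF w[OF that(3,4)]]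
        wedge.edir_component[OF w[OF that(1,2)]] wedge.edir_component[OF w[OF that(3,4)]] power2_commute)
  have m\<Omega>: "\<Omega> \<in> lmeasurable" using \<Omega> by (simp add: lmeasurable_open)
  have "BV_weakly_converges \<Omega> (\<lambda>n. F (X n)) (F t)"
    unfolding BV_weakly_converges_def
  proof
    have "(LINT x:\<Omega>|lebesgue. norm (F (X n) x - F t x)) = measure lebesgue \<Omega> * sqrt ((X n / 2 - t / 2)\<^sup>2 + (cc (X n) - cc t)\<^sup>2)" for n
      unfolding D[OF X(1,2) t] by (simp add: set_lebesgue_integral_def)
    moreover have "(\<lambda>n. measure lebesgue \<Omega> * sqrt ((X n / 2 - t / 2)\<^sup>2 + (cc (X n) - cc t)\<^sup>2))
        \<longlonglongrightarrow> measure lebesgue \<Omega> * sqrt ((t / 2 - t / 2)\<^sup>2 + (cc t - cc t)\<^sup>2)"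
      unfolding cc_def by (intro tendsto_intros X(3)) auto
    ultimately show "(\<lambda>n. LINT x:\<Omega>|lebesgue. norm (F (X n) x - F t x)) \<longlonglongrightarrow> 0" by simp
    obtain K where K: "\<And>s c. wedge s c \<Longrightarrow> BV_norm \<Omega> (\<lambda>x. rot (wedge.half_plane_field s c p x)) \<le> ennreal K"
      using half_plane_BV_norm[OF \<Omega>(1,2), of p] by blast
    have "BV_norm \<Omega> (F (X n)) \<le> ennreal K" for n
      using K[OF w[OF X(1,2)]] by (simp add: F_def[abs_def])
    then show "\<exists>C. \<forall>n. BV_norm \<Omega> (F (X n)) \<le> ennreal C" by blast
  qed
  then have "line_energy f \<Omega> (F t) \<le> liminf (\<lambda>n. line_energy f \<Omega> (F (X n)))"
    by (intro lsc[unfolded BV_weakly_lsc_def, rule_format, of "\<lambda>n. F (X n)"] A X t)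
  also have "\<dots> \<le> limsup (\<lambda>n. line_energy f \<Omega> (F (X n)))"
    by (rule Liminf_le_Limsup) simp
  also have "\<dots> \<le> y * h"
    by (intro Limsup_bounded always_eventually allI) (simp add: E X y mult_right_mono)
  finally have "h * f t \<le> h * y" by (simp add: E[OF t] mult.commute)
  then show "f t \<le> y" using h by (simp add: ennreal_mult_le_mult_iff)
qed

text \<open>If the lower limit were too small, a sequence of arguments tending to \<open>t\<close>
  with values of \<open>f\<close> below a level \<open>y < f t\<close> would contradict the
  sequential statement. \<open>S\<close> is left open since it is used with and without the point
  0.\<close>

lemma energy_lsc_imp_lsc_at:
  assumes \<Omega>: "open \<Omega>" "bounded \<Omega>" "\<Omega> \<noteq> {}" and lsc: "BV_weakly_lsc \<Omega> (line_energy f \<Omega>)"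
    and t: "0 < t" "t \<le> 2" and S: "S \<subseteq> {0..2}"
  shows "f t \<le> Liminf (at t within S) f"
  unfolding le_Liminf_iff
proof (intro allI impI, rule ccontr)
  fix y assume y: "y < f t" and n: "\<not> (\<forall>\<^sub>F x in at t within S. y < f x)"
  have "\<exists>x\<in>S. dist x t < d \<and> f x \<le> y" if "0 < d" for d
  proof -
    have "\<exists>x\<in>S. x \<noteq> t \<and> dist x t < d \<and> \<not> y < f x"
      using n that unfolding eventually_at by blast
    then show ?thesis by (auto simp: not_less)
  qed
  \<comment> \<open>The minimum with \<open>t\<close> keeps the chosen points positive; a wedge
    needs a jump that is not 0.\<close>
  moreover have "0 < min t (1 / real (Suc n))" for n using t(1) by simp
  ultimately have "\<exists>x\<in>S. dist x t < min t (1 / real (Suc n)) \<and> f x \<le> y" for n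
    by blast
  then obtain X where X: "\<And>n. X n \<in> S" "\<And>n. dist (X n) t < min t (1 / real (Suc n))" "\<And>n. f (X n) \<le> y"
    by metis
  have "X \<longlonglongrightarrow> t"
  proof (rule metric_LIMSEQ_I)
    fix e :: real assume "0 < e"
    then obtain N where N: "1 / real (Suc N) < e" using nat_approx_posE by blast
    have "dist (X n) t < e" if "N \<le> n" for n
    proof -
      have "1 / real (Suc n) \<le> 1 / real (Suc N)" using that by (simp add: frac_le)
      then show ?thesis using X(2)[of n] N by simp
    qed
    then show "\<exists>N. \<forall>n\<ge>N. dist (X n) t < e" by blast
  qed
  moreover have "0 < X n" for n
  proof -
    have "\<bar>X n - t\<bar> < t" using X(2)[of n] by (simp add: dist_real_def)
    then show ?thesis by linarith
  qed
  moreover have "X n \<le> 2" for n using X(1)[of n] S by auto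
  ultimately have "f t \<le> y"
    by (intro energy_lsc_imp_sequential_lsc[OF \<Omega> lsc t, of X y] X(3))
  then show False using y by simp
qed

text \<open>A ball inside \<open>\<Omega>\<close> provides room for a segment of the length of its
  radius. The threshold \<open>a\<close> may be smaller than the least new jump, so that one
  supremum can serve for all small \<open>t\<close>; \<open>t < 2\<close> makes \<open>c\<close>
  positive.\<close>

lemma slope_at_small_jump:
  assumes \<Omega>: "open \<Omega>" "bounded \<Omega>" "\<Omega> \<noteq> {}" and lsc: "BV_weakly_lsc \<Omega> (line_energy f \<Omega>)"
    and t: "0 < t" "t < 2" and a: "a \<le> sqrt (2 + 2 * sqrt (1 - (t / 2)\<^sup>2))"
  shows "f t / ennreal t \<le> ennreal (2 / (1 - (t / 2)\<^sup>2)) * (SUP x\<in>{a..2}. f x)"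
proof -
  obtain p where p: "p \<in> \<Omega>" using \<Omega>(3) by blast
  obtain r where r: "0 < r" "ball p r \<subseteq> \<Omega>" using \<Omega>(1) p openE by blast
  have sq: "(t / 2)\<^sup>2 < 1" using t by (simp add: power_less_one_iff)
  interpret wedge_cells "t / 2" "sqrt (1 - (t / 2)\<^sup>2)" p r
    by (intro wedge_cells.intro wedge_of_jump wedge_cells_axioms.intro) (use t sq r in auto)
  have "segment \<subseteq> \<Omega>"
  proof
    fix x assume "x \<in> segment"
    then have "dist p x < r" by (simp add: segment_def dist_norm norm_plane)
    then show "x \<in> \<Omega>" using r(2) by auto
  qed
  moreover have "f x \<le> (SUP x\<in>{a..2}. f x)" if "sqrt (2 + 2 * sqrt (1 - (t / 2)\<^sup>2)) \<le> x" "x \<le> 2" for x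
    using a that by (intro SUP_upper) auto
  ultimately have "f (2 * (t / 2)) / ennreal (2 * (t / 2)) \<le> ennreal (2 / (sqrt (1 - (t / 2)\<^sup>2))\<^sup>2) * (SUP x\<in>{a..2}. f x)"
    by (intro lsc_slope_bound[OF \<Omega>(1,2) _ lsc])
  then show ?thesis using sq by simp
qed

text \<open>As \<open>t\<close> tends to 0, the least new jump tends to 2 and the factor
  \<open>2 / (1 - (t / 2)^2)\<close> tends to 2. The margins \<open>\<delta>\<close> and
  \<open>K\<close> absorb the two errors for all small \<open>t\<close>.\<close>

lemma slope_limsup_bound:
  assumes \<Omega>: "open \<Omega>" "bounded \<Omega>" "\<Omega> \<noteq> {}" and lsc: "BV_weakly_lsc \<Omega> (line_energy f \<Omega>)"
    and \<delta>: "0 < \<delta>" and K: "1 < K"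
  shows "limsup_slope_at_0 f \<le> ennreal (2 * K) * (SUP x\<in>{2 - \<delta>..2}. f x)"
proof -
  have "((\<lambda>t. sqrt (2 + 2 * sqrt (1 - (t / 2)\<^sup>2))) \<longlongrightarrow> sqrt (2 + 2 * sqrt (1 - (0 / 2)\<^sup>2))) (at_right 0)"
    by (intro tendsto_intros) auto
  moreover have "2 - \<delta> < sqrt (2 + 2 * sqrt (1 - (0 / 2)\<^sup>2))" using \<delta> by simp
  ultimately have e1: "\<forall>\<^sub>F t in at_right 0. 2 - \<delta> < sqrt (2 + 2 * sqrt (1 - (t / 2)\<^sup>2))"
    by (rule order_tendstoD(1))
  have "((\<lambda>t. 2 / (1 - (t / 2)\<^sup>2)) \<longlongrightarrow> 2 / (1 - (0 / 2)\<^sup>2)) (at_right (0::real))"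
    by (intro tendsto_intros) auto
  moreover have "2 / (1 - (0 / 2)\<^sup>2) < 2 * K" using K by simp
  ultimately have e2: "\<forall>\<^sub>F t in at_right 0. 2 / (1 - (t / 2)\<^sup>2) < 2 * K"
    by (rule order_tendstoD(2))
  obtain b where b: "0 < b" "\<And>t. 0 < t \<Longrightarrow> t < b \<Longrightarrow> 2 - \<delta> < sqrt (2 + 2 * sqrt (1 - (t / 2)\<^sup>2)) \<and> 2 / (1 - (t / 2)\<^sup>2) < 2 * K"
    using eventually_conj[OF e1 e2] unfolding eventually_at_right_field by auto
  define d where "d = min (b / 2) 1"
  have d: "0 < d" "d < b" "d < 2" using b(1) by (auto simp: d_def)
  have "limsup_slope_at_0 f \<le> (SUP t\<in>{0<..d}. f t / ennreal t)"
    unfolding limsup_slope_at_0_def by (rule INF_lower) (use d in auto)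
  also have "\<dots> \<le> ennreal (2 * K) * (SUP x\<in>{2 - \<delta>..2}. f x)"
  proof (rule SUP_least)
    fix t assume "t \<in> {0<..d}"
    then have t: "0 < t" "t < b" "t < 2" using d by auto
    have "f t / ennreal t \<le> ennreal (2 / (1 - (t / 2)\<^sup>2)) * (SUP x\<in>{2 - \<delta>..2}. f x)"
      by (rule slope_at_small_jump[OF \<Omega> lsc t(1,3)]) (use b(2)[OF t(1,2)] in simp)
    also have "\<dots> \<le> ennreal (2 * K) * (SUP x\<in>{2 - \<delta>..2}. f x)"
      using b(2)[OF t(1,2)] by (intro mult_right_mono ennreal_leI) auto
    finally show "f t / ennreal t \<le> ennreal (2 * K) * (SUP x\<in>{2 - \<delta>..2}. f x)" .
  qed
  finally show ?thesis .
qed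

lemma ennreal_le_if_le_mult_above_1:
  fixes x y :: ennreal
  assumes "\<And>K. 1 < K \<Longrightarrow> x \<le> ennreal (2 * K) * y"
  shows "x \<le> 2 * y"
proof (cases y rule: ennreal_cases)
  case (real r)
  show ?thesis
  proof (rule ennreal_le_epsilon)
    fix e :: real assume e: "0 < e"
    \<comment> \<open>The gain is \<open>2 * r * (e / (2 * r + 1)) \<le> e\<close>; the summand 1
      keeps the denominator positive for \<open>r = 0\<close>.\<close>
    define K where "K = 1 + e / (2 * r + 1)"
    have "1 < K" using e real by (simp add: K_def)
    then have "x \<le> ennreal (2 * K) * ennreal r" using assms real by simp
    also have "\<dots> = ennreal (2 * K * r)" using \<open>1 < K\<close> real by (simp add: ennreal_mult)
    also have "\<dots> \<le> ennreal (2 * r + e)"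
    proof (rule ennreal_leI)
      have "2 * r * e \<le> (2 * r + 1) * e" using e by simp
      then have "2 * r * (e / (2 * r + 1)) \<le> e" using real by (simp add: field_simps)
      then show "2 * K * r \<le> 2 * r + e" by (simp add: K_def algebra_simps)
    qed
    also have "\<dots> = 2 * y + ennreal e" using e real by (simp add: ennreal_mult)
    finally show "x \<le> 2 * y + ennreal e" .
  qed
qed (simp add: ennreal_mult_eq_top_iff)

theorem theorem1:
  fixes f :: "real \<Rightarrow> ennreal" and \<Omega> :: "(real^2) set"
  assumes f_measurable: "f \<in> borel_measurable (lebesgue_on {0..2})"
    and \<Omega>_open: "open \<Omega>" and \<Omega>_bounded: "bounded \<Omega>" and \<Omega>_nonempty: "\<Omega> \<noteq> {}"
    and energy_lsc: "BV_weakly_lsc \<Omega> (line_energy f \<Omega>)"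
  shows "lsc_on {0<..2} f \<and> (f 0 = 0 \<longrightarrow> lsc_on {0..2} f) \<and>
    limsup_slope_at_0 f \<le> 2 * limsup_at_2 f"
proof (intro conjI impI)
  note lsc_at = energy_lsc_imp_lsc_at[OF \<Omega>_open \<Omega>_bounded \<Omega>_nonempty energy_lsc]
  show "lsc_on {0<..2} f"
    unfolding lsc_on_def by (intro ballI lsc_at) auto
  show "lsc_on {0..2} f" if "f 0 = 0"
    unfolding lsc_on_def
  proof
    fix t :: real assume t: "t \<in> {0..2}"
    show "f t \<le> Liminf (at t within {0..2}) f"
    proof (cases "t = 0")
      case False
      then show ?thesis using t by (intro lsc_at) auto
    qed (simp add: that)
  qed
  \<comment> \<open>The factor 2 is moved to the left because the infimum defining
    \<open>limsup_at_2\<close> is reached by bounding each of its members from below. As 2 is finite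
    and not 0, it can be moved back afterwards.\<close>
  have "limsup_slope_at_0 f / 2 \<le> limsup_at_2 f"
    unfolding limsup_at_2_def
  proof (rule INF_greatest)
    fix \<delta> :: real assume "\<delta> \<in> {0<..2}"
    then have "limsup_slope_at_0 f \<le> 2 * (SUP x\<in>{2 - \<delta>..2}. f x)"
      by (intro ennreal_le_if_le_mult_above_1
          slope_limsup_bound[OF \<Omega>_open \<Omega>_bounded \<Omega>_nonempty energy_lsc]) auto
    then show "limsup_slope_at_0 f / 2 \<le> (SUP x\<in>{2 - \<delta>..2}. f x)"
      by (intro divide_le_posI_ennreal) auto
  qed
  then have "2 * (limsup_slope_at_0 f / 2) \<le> 2 * limsup_at_2 f" by (rule mult_left_mono) simp
  moreover have "2 * (limsup_slope_at_0 f / 2) = limsup_slope_at_0 f * 2 / 2"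
    by (subst ennreal_times_divide) (simp only: mult.commute)
  moreover have "\<dots> = limsup_slope_at_0 f" by (rule ennreal_mult_divide_eq) auto
  ultimately show "limsup_slope_at_0 f \<le> 2 * limsup_at_2 f" by simp
qed

end
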